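(* Let $\theta\in\mathbb{R}$ and let $\lambda=(\lambda_{ij})_{1\le i,j\le 3}$ be a real antisymmetric matrix. Let $u_{ij}$ ($1\le i,j\le 3$) be the matrix coordinate generators of $SU(3)_\theta$ and $v_{kl}$ ($1\le k,l\le 4$) the matrix coordinate generators of $SU(4)_\lambda$. The map defined on generators by $$\rho(v_{kl})=\sum_{\alpha=1}^{3}u_{k\alpha}\otimes v_{\alpha l}\quad (k=1,2,3,\ l=1,2,3,4),\qquad \rho(v_{4l})=1\otimes v_{4l}\quad (l=1,2,3,4),$$ is a (left) action $\rho:SU(4)_\lambda\to SU(3)_\theta\otimes SU(4)_\lambda$ of the compact quantum group $SU(3)_\theta$ on the algebra $SU(4)_\lambda$ if and only if $\theta=\lambda_{12}=-\lambda_{13}=\lambda_{23}$. In this case, the algebra $B=(SU(4)_\lambda)^{SU(3)_\theta}$ of invariant elements is generated, as a $*$-algebra, by $\{v_{4l}: l=1,2,3,4\}$.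
   Context: Deformed algebras. For $n\ge 3$, let $\mathcal{O}(SU(n))$ be the commutative $*$-algebra of functions on $SU(n)$ generated by the matrix coordinate functions, with involution complex conjugation. Let $\mathbb{T}^{n-1}\subset SU(n)$ be the diagonal maximal torus, whose elements are written $t=\mathrm{diag}(e^{2\pi i\varphi_1},\dots,e^{2\pi i\varphi_n})$ with $\varphi_n=-(\varphi_1+\dots+\varphi_{n-1})$. The group $\mathbb{T}^{n-1}\times\mathbb{T}^{n-1}$ acts by $\alpha_{(t,s)}(f)(U)=f(tUs)$, which decomposes $\mathcal{O}(SU(n))$ into isotypic components indexed by $(r,q)\in\mathbb{Z}^{n-1}\times\mathbb{Z}^{n-1}$. The $(i,j)$ coordinate function lies in the component of index $(w_i,w_j)$, where $w_1,\dots,w_{n-1}$ is the standard basis of $\mathbb{Z}^{n-1}$ and $w_n=-(w_1+\dots+w_{n-1})$. Given a real antisymmetric $(n-1)\times(n-1)$ matrix $K$, the deformed algebra is the same vector space $\mathcal{O}(SU(n))$ with the same involution and with the associative product determined by $$f\times g=e^{\pi i\,(r^{T}Kr'-q^{T}Kq')}\,fg$$ for $f$ of index $(r,q)$ and $g$ of index $(r',q')$ (i.e. the deformation by $K\oplus(-K)$). $SU(3)_\theta$ denotes the deformed algebra for $n=3$ with $K=\begin{pmatrix}0&\theta\\-\theta&0\end{pmatrix}$; its coordinate generators are denoted $u_{ij}$. $SU(4)_\lambda$ denotes the deformed algebra for $n=4$ with $K=\lambda=(\lambda_{ij})_{1\le i,j\le3}$ (a 3-parameter deformation); its coordinate generators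 are denoted $v_{kl}$. Both are compact quantum groups (Hopf $*$-algebras) with the undeformed coalgebra structure; for $SU(3)_\theta$ it is $\Delta(u_{ij})=\sum_{k}u_{ik}\otimes u_{kj}$, $\epsilon(u_{ij})=\delta_{ij}$, $S(u_{ij})=u_{ji}^*$. Everything is at the algebraic level (no $C^*$-completion), and $\otimes$ is the tensor product of algebras. Action. For a compact quantum group $H$ and an algebra $A$, a (left) action of $H$ on $A$ is an algebra homomorphism $\rho:A\to H\otimes A$ with $(\Delta\otimes\mathrm{id})\circ\rho=(\mathrm{id}\otimes\rho)\circ\rho$ and $(\epsilon\otimes\mathrm{id})\circ\rho=\mathrm{id}$. The map in the claim is given on generators and is called an action if it extends to such a homomorphism. The fixed-point subalgebra is $A^H=\{a\in A:\rho(a)=1\otimes a\}$; its elements are the invariant elements.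
   Formalization: The equalities θ=λ12=-λ13=λ23 are read modulo 1: as equalities of real numbers the "only if" fails, e.g. θ=0, λ12=2, λ13=λ23=0 gives the undeformed algebras with their standard action. *)

theory Defs
  imports
    "Jordan_Normal_Form.Determinant"
    "Jordan_Normal_Form.Schur_Decomposition"
    "HOL-Algebra.Ring"
    "HOL-Library.Function_Algebras"
    "HOL-Library.Real_Mod"
begin

section \<open>Complex algebras of functions\<close>

text \<open>
  All vector spaces below consist of complex-valued functions on some type, with pointwise
  addition and scaling. An algebra is presented by the library record for an algebra over a
  coefficient type; its multiplication need not be pointwise.
\<close>

definition fscale :: "complex \<Rightarrow> ('x \<Rightarrow> complex) \<Rightarrow> ('x \<Rightarrow> complex)" where
  "fscale c f = (\<lambda>x. c * f x)"

record 'b star_algebra = "(complex, 'b) module" +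
  star :: "'b \<Rightarrow> 'b"

definition alg_hom ::
  "(complex, 'a, 'm) module_scheme \<Rightarrow> (complex, 'b, 'n) module_scheme \<Rightarrow> ('a \<Rightarrow> 'b) set" where
  "alg_hom A B = {h \<in> Ring.ring_hom A B. \<forall>c. \<forall>a\<in>carrier A. h (c \<odot>\<^bsub>A\<^esub> a) = c \<odot>\<^bsub>B\<^esub> h a}"

definition star_subalgebra :: "('b, 'm) star_algebra_scheme \<Rightarrow> 'b set \<Rightarrow> bool" where
  "star_subalgebra A S \<longleftrightarrow> S \<subseteq> carrier A \<and> \<zero>\<^bsub>A\<^esub> \<in> S \<and> \<one>\<^bsub>A\<^esub> \<in> S \<and>
     (\<forall>a\<in>S. \<forall>b\<in>S. a \<oplus>\<^bsub>A\<^esub> b \<in> S \<and> a \<otimes>\<^bsub>A\<^esub> b \<in> S) \<and>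
     (\<forall>c. \<forall>a\<in>S. c \<odot>\<^bsub>A\<^esub> a \<in> S) \<and> (\<forall>a\<in>S. star A a \<in> S)"

abbreviation star_generated :: "('b, 'm) star_algebra_scheme \<Rightarrow> 'b set \<Rightarrow> 'b set" where
  "star_generated A S \<equiv> star_subalgebra A hull S"

section \<open>Algebraic tensor products\<close>

text \<open>
  The algebraic tensor product of two spaces of functions on \<open>'x\<close> and \<open>'y\<close> is realised as the span
  of the functions \<open>a(x) b(y)\<close> on \<open>'x \<times> 'y\<close>. The lemma \<open>tensor_lift_eq\<close> below is its universal
  property.
\<close>

definition etensor :: "('x \<Rightarrow> complex) \<Rightarrow> ('y \<Rightarrow> complex) \<Rightarrow> ('x \<times> 'y \<Rightarrow> complex)"
    (infixl \<open>\<boxtimes>\<close> 75) where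
  "a \<boxtimes> b = (\<lambda>(x, y). a x * b y)"

definition tensor_space ::
  "('x \<Rightarrow> complex) set \<Rightarrow> ('y \<Rightarrow> complex) set \<Rightarrow> ('x \<times> 'y \<Rightarrow> complex) set" where
  "tensor_space A B = {\<Sum>(a, b)\<leftarrow>xs. a \<boxtimes> b | xs. set xs \<subseteq> A \<times> B}"

text \<open>The linear map on the tensor product induced by a bilinear map \<open>\<phi>\<close>.\<close>

definition tensor_lift ::
  "('x \<Rightarrow> complex) set \<Rightarrow> ('y \<Rightarrow> complex) set \<Rightarrow>
   (('x \<Rightarrow> complex) \<Rightarrow> ('y \<Rightarrow> complex) \<Rightarrow> ('z \<Rightarrow> complex)) \<Rightarrow>
   ('x \<times> 'y \<Rightarrow> complex) \<Rightarrow> ('z \<Rightarrow> complex)" where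
  "tensor_lift A B \<phi> F = (THE G. \<forall>xs. set xs \<subseteq> A \<times> B \<longrightarrow> F = (\<Sum>(a, b)\<leftarrow>xs. a \<boxtimes> b) \<longrightarrow>
     G = (\<Sum>(a, b)\<leftarrow>xs. \<phi> a b))"

definition tensor_map ::
  "('x \<Rightarrow> complex) set \<Rightarrow> ('y \<Rightarrow> complex) set \<Rightarrow>
   (('x \<Rightarrow> complex) \<Rightarrow> ('u \<Rightarrow> complex)) \<Rightarrow> (('y \<Rightarrow> complex) \<Rightarrow> ('v \<Rightarrow> complex)) \<Rightarrow>
   ('x \<times> 'y \<Rightarrow> complex) \<Rightarrow> ('u \<times> 'v \<Rightarrow> complex)" where
  "tensor_map A B S T = tensor_lift A B (\<lambda>a b. S a \<boxtimes> T b)"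

text \<open>The multiplication is the bilinear extension of \<open>(a \<otimes> b)(a' \<otimes> b') = aa' \<otimes> bb'\<close>.\<close>

definition tensor_algebra ::
  "(complex, 'x \<Rightarrow> complex, 'm) module_scheme \<Rightarrow> (complex, 'y \<Rightarrow> complex, 'n) module_scheme \<Rightarrow>
   (complex, 'x \<times> 'y \<Rightarrow> complex) module" where
  "tensor_algebra A B =
     \<lparr> carrier = tensor_space (carrier A) (carrier B),
       monoid.mult = (\<lambda>F G. tensor_lift (carrier A) (carrier B) (\<lambda>a b.
                tensor_lift (carrier A) (carrier B) (\<lambda>a' b'. (a \<otimes>\<^bsub>A\<^esub> a') \<boxtimes> (b \<otimes>\<^bsub>B\<^esub> b')) G) F),
       one = \<one>\<^bsub>A\<^esub> \<boxtimes> \<one>\<^bsub>B\<^esub>,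
       zero = 0,
       add = (+),
       module.smult = fscale \<rparr>"

definition fun_subspace :: "('x \<Rightarrow> complex) set \<Rightarrow> bool" where
  "fun_subspace A \<longleftrightarrow> 0 \<in> A \<and> (\<forall>a\<in>A. \<forall>b\<in>A. a + b \<in> A) \<and> (\<forall>c. \<forall>a\<in>A. fscale c a \<in> A)"

definition bilinear_on ::
  "('x \<Rightarrow> complex) set \<Rightarrow> ('y \<Rightarrow> complex) set \<Rightarrow>
   (('x \<Rightarrow> complex) \<Rightarrow> ('y \<Rightarrow> complex) \<Rightarrow> ('z \<Rightarrow> complex)) \<Rightarrow> bool" where
  "bilinear_on A B \<phi> \<longleftrightarrow>
     (\<forall>a\<in>A. \<forall>a'\<in>A. \<forall>b\<in>B. \<phi> (a + a') b = \<phi> a b + \<phi> a' b) \<and>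
     (\<forall>a\<in>A. \<forall>b\<in>B. \<forall>b'\<in>B. \<phi> a (b + b') = \<phi> a b + \<phi> a b') \<and>
     (\<forall>c. \<forall>a\<in>A. \<forall>b\<in>B. \<phi> (fscale c a) b = fscale c (\<phi> a b) \<and> \<phi> a (fscale c b) = fscale c (\<phi> a b))"

lemma sum_list_fun_apply: "(\<Sum>p\<leftarrow>xs. f p) x = (\<Sum>p\<leftarrow>xs. f p x)"
  for f :: "'p \<Rightarrow> 'x \<Rightarrow> 'b :: comm_monoid_add"
  by (induction xs) auto

lemma fun_subspace_sum_list:
  assumes "fun_subspace A" "\<And>p. p \<in> set xs \<Longrightarrow> f p \<in> A"
  shows "(\<Sum>p\<leftarrow>xs. f p) \<in> A"
  using assms(2) by (induction xs) (use assms(1) in \<open>auto simp: fun_subspace_def\<close>)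

lemma bilinear_on_sum_right:
  assumes A: "fun_subspace A" and B: "fun_subspace B" and \<phi>: "bilinear_on A B \<phi>"
    and a: "a \<in> A" and xs: "\<And>p. p \<in> set xs \<Longrightarrow> f p \<in> B"
  shows "\<phi> a (\<Sum>p\<leftarrow>xs. f p) = (\<Sum>p\<leftarrow>xs. \<phi> a (f p))"
  using xs
proof (induction xs)
  case Nil
  have "\<phi> a (fscale 0 0) = fscale 0 (\<phi> a 0)"
    using \<phi> a B by (auto simp: bilinear_on_def fun_subspace_def)
  then show ?case by (simp add: fscale_def zero_fun_def)
next
  case (Cons p xs)
  have "(\<Sum>p\<leftarrow>xs. f p) \<in> B" by (rule fun_subspace_sum_list) (use B Cons in auto)
  then have "\<phi> a (f p + (\<Sum>p\<leftarrow>xs. f p)) = \<phi> a (f p) + \<phi> a (\<Sum>p\<leftarrow>xs. f p)"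
    using Cons.prems \<phi> a unfolding bilinear_on_def by (metis list.set_intros(1))
  moreover have "\<phi> a (\<Sum>p\<leftarrow>xs. f p) = (\<Sum>p\<leftarrow>xs. \<phi> a (f p))" using Cons by simp
  ultimately show ?case by (simp only: list.map sum_list.Cons)
qed

lemma tensor_lift_zero:
  assumes A: "fun_subspace A" and B: "fun_subspace B" and \<phi>: "bilinear_on A B \<phi>"
    and "set xs \<subseteq> A \<times> B" "(\<Sum>(a, b)\<leftarrow>xs. a \<boxtimes> b) = 0"
  shows "(\<Sum>(a, b)\<leftarrow>xs. \<phi> a b) = 0"
  using assms(4,5)
proof (induction "length xs" arbitrary: xs)
  case 0
  then show ?case by simp
next
  case (Suc n)
  then obtain a b ys where xs: "xs = (a, b) # ys" by (cases xs) auto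
  have a: "a \<in> A" and b: "b \<in> B" and ys: "set ys \<subseteq> A \<times> B" and n: "n = length ys"
    using Suc xs by auto
  have eq: "a x * b y + (\<Sum>p\<leftarrow>ys. fst p x * snd p y) = 0" for x y
    using fun_cong[OF Suc.prems(2), of "(x, y)"]
    by (simp add: xs sum_list_fun_apply etensor_def case_prod_beta)
  show ?case
  proof (cases "a = 0")
    case True
    have "\<phi> (fscale 0 a) b = fscale 0 (\<phi> a b)"
      using \<phi> a b by (auto simp: bilinear_on_def)
    then have "\<phi> a b = 0" by (simp add: fscale_def True zero_fun_def)
    moreover have "(\<Sum>(a, b)\<leftarrow>ys. a \<boxtimes> b) = 0"
      using Suc.prems(2) by (simp add: xs True etensor_def zero_fun_def plus_fun_def split_def)
    ultimately show ?thesis using Suc.hyps(1)[OF n ys] by (simp add: xs)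
  next
    case False
    then obtain x0 where x0: "a x0 \<noteq> 0" by (auto simp: fun_eq_iff)
    define c where "c p = - (fst p x0 / a x0)" for p :: "('a \<Rightarrow> complex) \<times> ('b \<Rightarrow> complex)"
    have bsum: "b = (\<Sum>p\<leftarrow>ys. fscale (c p) (snd p))"
    proof
      fix y
      have "a x0 * b y = - (\<Sum>p\<leftarrow>ys. fst p x0 * snd p y)" using eq[of x0 y]
        by (simp add: eq_neg_iff_add_eq_0)
      then have "b y = - (\<Sum>p\<leftarrow>ys. fst p x0 * snd p y) / a x0" using x0
        by (simp add: field_simps)
      also have "\<dots> = (\<Sum>p\<leftarrow>ys. c p * snd p y)"
        by (induction ys) (auto simp: c_def field_simps x0 add_divide_distrib)
      finally show "b y = (\<Sum>p\<leftarrow>ys. fscale (c p) (snd p)) y"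
        by (simp add: sum_list_fun_apply fscale_def)
    qed
    define zs where "zs = map (\<lambda>p. (fst p + fscale (c p) a, snd p)) ys"
    have zsA: "set zs \<subseteq> A \<times> B" using ys a A by (auto simp: zs_def fun_subspace_def)
    have "(\<Sum>(a, b)\<leftarrow>zs. a \<boxtimes> b) = 0"
    proof (rule ext, clarify)
      fix x y
      have "(\<Sum>(a, b)\<leftarrow>zs. a \<boxtimes> b) (x, y) = (\<Sum>p\<leftarrow>ys. fst p x * snd p y) + a x * (\<Sum>p\<leftarrow>ys. c p * snd p y)"
        unfolding zs_def
        by (induction ys) (auto simp: etensor_def fscale_def algebra_simps)
      also have "(\<Sum>p\<leftarrow>ys. c p * snd p y) = b y"
        by (subst bsum) (simp add: sum_list_fun_apply fscale_def)
      finally show "(\<Sum>(a, b)\<leftarrow>zs. a \<boxtimes> b) (x, y) = 0 (x, y)"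
        using eq[of x y] by (simp add: add.commute)
    qed
    from Suc.hyps(1)[OF _ zsA this] have "(\<Sum>(a, b)\<leftarrow>zs. \<phi> a b) = 0"
      by (simp add: zs_def n)
    moreover have "(\<Sum>(a, b)\<leftarrow>zs. \<phi> a b) =
        (\<Sum>p\<leftarrow>ys. \<phi> (fst p) (snd p)) + (\<Sum>p\<leftarrow>ys. \<phi> a (fscale (c p) (snd p)))"
      (is "?Z = _")
    proof -
      have "?Z = (\<Sum>p\<leftarrow>ys. \<phi> (fst p + fscale (c p) a) (snd p))"
        by (simp only: zs_def list.map_comp o_def prod.case)
      also have "\<dots> = (\<Sum>p\<leftarrow>ys. \<phi> (fst p) (snd p) + \<phi> a (fscale (c p) (snd p)))"
      proof (intro arg_cong[where f = sum_list] map_cong refl)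
        fix p assume "p \<in> set ys"
        then have p: "fst p \<in> A" "snd p \<in> B" "fscale (c p) a \<in> A"
          using ys a A by (auto simp: fun_subspace_def)
        then show "\<phi> (fst p + fscale (c p) a) (snd p) = \<phi> (fst p) (snd p) + \<phi> a (fscale (c p) (snd p))"
          using \<phi> a by (auto simp: bilinear_on_def)
      qed
      finally show ?thesis by (simp only: sum_list_addf)
    qed
    moreover have "(\<Sum>p\<leftarrow>ys. \<phi> a (fscale (c p) (snd p))) = \<phi> a b"
      unfolding bsum
      by (rule bilinear_on_sum_right[OF A B \<phi> a, symmetric])
        (use ys B in \<open>auto simp: fun_subspace_def\<close>)
    ultimately show ?thesis by (simp add: xs split_def add.commute)
  qed
qed

lemma tensor_lift_eq:
  assumes A: "fun_subspace A" and B: "fun_subspace B" and \<phi>: "bilinear_on A B \<phi>"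
    and xs: "set xs \<subseteq> A \<times> B"
  shows "tensor_lift A B \<phi> (\<Sum>(a, b)\<leftarrow>xs. a \<boxtimes> b) = (\<Sum>(a, b)\<leftarrow>xs. \<phi> a b)"
proof -
  have *: "(\<Sum>(a, b)\<leftarrow>xs. \<phi> a b) = (\<Sum>(a, b)\<leftarrow>ys. \<phi> a b)"
    if ys: "set ys \<subseteq> A \<times> B" and eq: "(\<Sum>(a, b)\<leftarrow>xs. a \<boxtimes> b) = (\<Sum>(a, b)\<leftarrow>ys. a \<boxtimes> b)" for ys
  proof -
    define zs where "zs = map (\<lambda>(a, b). (fscale (-1) a, b)) ys"
    have zs: "set (xs @ zs) \<subseteq> A \<times> B" using xs ys A by (auto simp: zs_def fun_subspace_def)
    have "(\<Sum>(a, b)\<leftarrow>zs. a \<boxtimes> b) = - (\<Sum>(a, b)\<leftarrow>ys. a \<boxtimes> b)" unfolding zs_def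
      by (induction ys) (auto simp: etensor_def fscale_def fun_eq_iff)
    then have "(\<Sum>(a, b)\<leftarrow>xs @ zs. a \<boxtimes> b) = 0" using eq by simp
    from tensor_lift_zero[OF A B \<phi> zs this]
    have "(\<Sum>(a, b)\<leftarrow>xs. \<phi> a b) + (\<Sum>(a, b)\<leftarrow>zs. \<phi> a b) = 0" by simp
    moreover have "(\<Sum>(a, b)\<leftarrow>zs. \<phi> a b) = - (\<Sum>(a, b)\<leftarrow>ys. \<phi> a b)"
      using ys unfolding zs_def
    proof (induction ys)
      case (Cons p ys)
      have "\<phi> (fscale (-1) (fst p)) (snd p) = fscale (-1) (\<phi> (fst p) (snd p))"
        using \<phi> Cons.prems by (auto simp: bilinear_on_def)
      then show ?case using Cons by (auto simp: fscale_def fun_eq_iff split_def)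
    qed simp
    ultimately show ?thesis by simp
  qed
  show ?thesis unfolding tensor_lift_def
    by (rule the_equality) (use * xs in blast)+
qed

section \<open>Coactions\<close>

definition tensor_assoc :: "('x \<times> 'y \<times> 'z \<Rightarrow> complex) \<Rightarrow> (('x \<times> 'y) \<times> 'z \<Rightarrow> complex)" where
  "tensor_assoc F = (\<lambda>((x, y), z). F (x, y, z))"

text \<open>
  In the counit axiom, the tensor product of the ground field with \<open>A\<close> is identified with \<open>A\<close>.
\<close>

definition left_action ::
  "(complex, 'x \<Rightarrow> complex, 'm) module_scheme \<Rightarrow>
   (('x \<Rightarrow> complex) \<Rightarrow> ('x \<times> 'x \<Rightarrow> complex)) \<Rightarrow> (('x \<Rightarrow> complex) \<Rightarrow> complex) \<Rightarrow>
   (complex, 'y \<Rightarrow> complex, 'n) module_scheme \<Rightarrow>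
   (('y \<Rightarrow> complex) \<Rightarrow> ('x \<times> 'y \<Rightarrow> complex)) \<Rightarrow> bool" where
  "left_action H \<Delta> \<epsilon> A \<rho> \<longleftrightarrow> \<rho> \<in> alg_hom A (tensor_algebra H A) \<and>
     (\<forall>a\<in>carrier A. tensor_map (carrier H) (carrier A) \<Delta> (\<lambda>b. b) (\<rho> a) =
        tensor_assoc (tensor_map (carrier H) (carrier A) (\<lambda>h. h) \<rho> (\<rho> a))) \<and>
     (\<forall>a\<in>carrier A. tensor_lift (carrier H) (carrier A) (\<lambda>h b. fscale (\<epsilon> h) b) (\<rho> a) = a)"

definition fixed_points ::
  "(complex, 'x \<Rightarrow> complex, 'm) module_scheme \<Rightarrow> (complex, 'y \<Rightarrow> complex, 'n) module_scheme \<Rightarrow>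
   (('y \<Rightarrow> complex) \<Rightarrow> ('x \<times> 'y \<Rightarrow> complex)) \<Rightarrow> ('y \<Rightarrow> complex) set" where
  "fixed_points H A \<rho> = {a \<in> carrier A. \<rho> a = \<one>\<^bsub>H\<^esub> \<boxtimes> a}"

section \<open>The algebra of functions on the special unitary group\<close>

definition SU :: "nat \<Rightarrow> complex mat set" where
  "SU n = {U \<in> carrier_mat n n. U * mat_adjoint U = 1\<^sub>m n \<and> det U = 1}"

text \<open>
  A function on \<open>SU n\<close> is represented by its extension by zero to all matrices, so the unit
  is the indicator function of \<open>SU n\<close>.
\<close>

definition SU_one :: "nat \<Rightarrow> complex mat \<Rightarrow> complex" where
  "SU_one n = (\<lambda>U. if U \<in> SU n then 1 else 0)"

definition fstar :: "('x \<Rightarrow> complex) \<Rightarrow> ('x \<Rightarrow> complex)" where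
  "fstar f = (\<lambda>x. cnj (f x))"

definition SU_functions :: "nat \<Rightarrow> (complex mat \<Rightarrow> complex) star_algebra" where
  "SU_functions n =
     \<lparr> carrier = {f. \<forall>U. U \<notin> SU n \<longrightarrow> f U = 0}, monoid.mult = (*), one = SU_one n, zero = 0,
       add = (+), module.smult = fscale, star = fstar \<rparr>"

text \<open>Row and column indices run over \<open>1, \<dots>, n\<close>, while the library's matrices are indexed from 0.\<close>

definition coord :: "nat \<Rightarrow> nat \<Rightarrow> nat \<Rightarrow> complex mat \<Rightarrow> complex" where
  "coord n i j = (\<lambda>U. if U \<in> SU n then U $$ (i - 1, j - 1) else 0)"

definition O_SU :: "nat \<Rightarrow> (complex mat \<Rightarrow> complex) set" where
  "O_SU n = star_generated (SU_functions n) {coord n i j | i j. i \<in> {1..n} \<and> j \<in> {1..n}}"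

definition comult :: "nat \<Rightarrow> (complex mat \<Rightarrow> complex) \<Rightarrow> (complex mat \<times> complex mat \<Rightarrow> complex)" where
  "comult n f = (\<lambda>(U, V). if U \<in> SU n \<and> V \<in> SU n then f (U * V) else 0)"

definition counit :: "nat \<Rightarrow> (complex mat \<Rightarrow> complex) \<Rightarrow> complex" where
  "counit n f = f (1\<^sub>m n)"

section \<open>The torus deformation\<close>

text \<open>
  Elements of the character group of the torus are functions \<open>nat \<Rightarrow> int\<close> of which only the values
  at \<open>1, \<dots>, n - 1\<close> matter; likewise for the coordinates \<open>\<phi>\<close> on the torus.
\<close>

definition torus :: "nat \<Rightarrow> (nat \<Rightarrow> real) \<Rightarrow> complex mat" where
  "torus n \<phi> = mat_diag n (\<lambda>i. cis (2 * pi * (if Suc i < n then \<phi> (Suc i) else - (\<Sum>k = 1..<n. \<phi> k))))"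

definition isotypic :: "nat \<Rightarrow> (nat \<Rightarrow> int) \<times> (nat \<Rightarrow> int) \<Rightarrow> (complex mat \<Rightarrow> complex) set" where
  "isotypic n = (\<lambda>(r, q). {f \<in> O_SU n. \<forall>\<phi> \<psi>. \<forall>U\<in>SU n.
     f (torus n \<phi> * U * torus n \<psi>) =
       cis (2 * pi * (\<Sum>k = 1..<n. of_int (r k) * \<phi> k + of_int (q k) * \<psi> k)) * f U})"

definition torus_form :: "nat \<Rightarrow> (nat \<Rightarrow> nat \<Rightarrow> real) \<Rightarrow> (nat \<Rightarrow> int) \<Rightarrow> (nat \<Rightarrow> int) \<Rightarrow> real" where
  "torus_form n K r r' = (\<Sum>i = 1..<n. \<Sum>j = 1..<n. of_int (r i) * K i j * of_int (r' j))"

definition deform_phase :: "nat \<Rightarrow> (nat \<Rightarrow> nat \<Rightarrow> real) \<Rightarrow>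
    (nat \<Rightarrow> int) \<times> (nat \<Rightarrow> int) \<Rightarrow> (nat \<Rightarrow> int) \<times> (nat \<Rightarrow> int) \<Rightarrow> complex" where
  "deform_phase n K = (\<lambda>(r, q) (r', q'). cis (pi * (torus_form n K r r' - torus_form n K q q')))"

definition isotypic_decomp ::
  "nat \<Rightarrow> (complex mat \<Rightarrow> complex) \<Rightarrow>
   (((nat \<Rightarrow> int) \<times> (nat \<Rightarrow> int)) \<times> (complex mat \<Rightarrow> complex)) list \<Rightarrow> bool" where
  "isotypic_decomp n f F \<longleftrightarrow> (\<forall>(w, a)\<in>set F. a \<in> isotypic n w) \<and> f = (\<Sum>(w, a)\<leftarrow>F. a)"

definition deformed_mult ::
  "nat \<Rightarrow> (nat \<Rightarrow> nat \<Rightarrow> real) \<Rightarrow> (complex mat \<Rightarrow> complex) \<Rightarrow> (complex mat \<Rightarrow> complex) \<Rightarrow>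
   (complex mat \<Rightarrow> complex)" where
  "deformed_mult n K f g = (THE h. \<forall>F G. isotypic_decomp n f F \<longrightarrow> isotypic_decomp n g G \<longrightarrow>
     h = (\<Sum>(w, a)\<leftarrow>F. \<Sum>(w', b)\<leftarrow>G. fscale (deform_phase n K w w') (a * b)))"

text \<open>
  By \<open>deformed_mult_eq\<close> and \<open>isotypic_decomp_exists\<close> below, the description in \<open>deformed_mult\<close>
  determines a product on all of \<open>O_SU n\<close>.
\<close>

lemma SU_zero_outside:
  assumes "f \<in> O_SU n" "U \<notin> SU n"
  shows "f U = 0"
proof -
  have "O_SU n \<subseteq> carrier (SU_functions n)"
    unfolding O_SU_def
    by (rule hull_minimal)
      (auto simp: star_subalgebra_def SU_functions_def SU_one_def fscale_def fstar_def coord_def)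
  then show ?thesis using assms by (auto simp: SU_functions_def)
qed

lemma isotypic_torus:
  assumes "a \<in> isotypic n (r, q)" "U \<in> SU n"
  shows "a (torus n \<phi> * U * torus n \<psi>) =
    cis (2 * pi * (\<Sum>k = 1..<n. of_int (r k) * \<phi> k + of_int (q k) * \<psi> k)) * a U"
  using assms by (auto simp: isotypic_def)

lemma isotypic_decomp_left_phase:
  assumes F: "isotypic_decomp n f F" and U: "U \<in> SU n"
  shows "(\<Sum>(w, a)\<leftarrow>F. deform_phase n K w (r', q') * a U) =
    f (torus n (\<lambda>i. (\<Sum>j = 1..<n. K i j * of_int (r' j)) / 2) * U *
       torus n (\<lambda>i. - (\<Sum>j = 1..<n. K i j * of_int (q' j)) / 2))"
    (is "_ = f ?V")
proof -
  have "deform_phase n K w (r', q') * a U = a ?V" if "(w, a) \<in> set F" for w a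
  proof (cases w)
    case (Pair r q)
    have "a \<in> isotypic n (r, q)" using F that Pair by (auto simp: isotypic_decomp_def)
    moreover have "deform_phase n K w (r', q') =
      cis (2 * pi * (\<Sum>k = 1..<n. of_int (r k) * ((\<Sum>j = 1..<n. K k j * of_int (r' j)) / 2) +
        of_int (q k) * (- (\<Sum>j = 1..<n. K k j * of_int (q' j)) / 2)))"
      (is "_ = cis (2 * pi * ?s)")
    proof -
      have tf: "torus_form n K x y = (\<Sum>k = 1..<n. of_int (x k) * (\<Sum>j = 1..<n. K k j * of_int (y j)))"
        for x y by (simp add: torus_form_def sum_distrib_left mult.assoc)
      have half: "(\<Sum>k\<in>I. x k * (X k / 2) + y k * (- Y k / 2)) =
          ((\<Sum>k\<in>I. x k * X k) - (\<Sum>k\<in>I. y k * Y k)) / 2" for I :: "nat set" and x y X Y :: "nat \<Rightarrow> real"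
        by (simp add: sum_subtractf sum_divide_distrib diff_divide_distrib)
      have "?s = (torus_form n K r r' - torus_form n K q q') / 2"
        unfolding tf by (rule half)
      then show ?thesis unfolding Pair deform_phase_def prod.case by (simp only:) simp
    qed
    ultimately show ?thesis using U by (simp add: isotypic_torus)
  qed
  then have "(\<Sum>(w, a)\<leftarrow>F. deform_phase n K w (r', q') * a U) = (\<Sum>(w, a)\<leftarrow>F. a ?V)"
    by (intro arg_cong[where f = sum_list] map_cong) auto
  also have "\<dots> = f ?V"
    using F by (simp add: isotypic_decomp_def sum_list_fun_apply split_def)
  finally show ?thesis .
qed

lemma deform_phase_swap:
  "deform_phase n K (r, q) w' = deform_phase n (\<lambda>i j. K j i) w' (r, q)"
proof -
  have "torus_form n K r r' = torus_form n (\<lambda>i j. K j i) r' r" for r r'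
    unfolding torus_form_def by (subst sum.swap) (simp add: mult_ac)
  then show ?thesis by (cases w') (simp add: deform_phase_def)
qed

lemma sum_list_swap:
  "(\<Sum>p\<leftarrow>xs. \<Sum>q\<leftarrow>ys. f p q) = (\<Sum>q\<leftarrow>ys. \<Sum>p\<leftarrow>xs. f p q)"
  for f :: "'p \<Rightarrow> 'q \<Rightarrow> 'b :: comm_monoid_add"
  by (induction xs) (simp_all add: sum_list_addf)

lemma deformed_mult_eq:
  assumes F: "isotypic_decomp n f F" and G: "isotypic_decomp n g G"
  shows "deformed_mult n K f g =
    (\<Sum>(w, a)\<leftarrow>F. \<Sum>(w', b)\<leftarrow>G. fscale (deform_phase n K w w') (a * b))"
proof -
  define P where "P F G = (\<Sum>(w, a)\<leftarrow>F. \<Sum>(w', b)\<leftarrow>G. fscale (deform_phase n K w w') (a * b))"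
    for F G :: "(((nat \<Rightarrow> int) \<times> (nat \<Rightarrow> int)) \<times> (complex mat \<Rightarrow> complex)) list"
  have P_apply: "P F G U = (\<Sum>p\<leftarrow>F. \<Sum>p'\<leftarrow>G. deform_phase n K (fst p) (fst p') * (snd p U * snd p' U))"
    for F G U
    by (simp add: P_def sum_list_fun_apply fscale_def split_def)
  have L: "P F G = P F' G" if F: "isotypic_decomp n f F" and F': "isotypic_decomp n f F'"
    and G: "isotypic_decomp n g G" for F F' G
  proof (rule ext)
    fix U :: "complex mat"
    have *: "P F G U = (\<Sum>p'\<leftarrow>G. (\<Sum>(w, a)\<leftarrow>F. deform_phase n K w (fst p') * a U) * snd p' U)" for F
      unfolding P_apply
      by (subst sum_list_swap) (simp add: split_def mult.assoc flip: sum_list_mult_const)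
    show "P F G U = P F' G U"
    proof (cases "U \<in> SU n")
      case True
      then have "(\<Sum>(w, a)\<leftarrow>F. deform_phase n K w w' * a U) = (\<Sum>(w, a)\<leftarrow>F'. deform_phase n K w w' * a U)" for w'
        using isotypic_decomp_left_phase[OF F True, of K "fst w'" "snd w'"]
          isotypic_decomp_left_phase[OF F' True, of K "fst w'" "snd w'"] by simp
      then show ?thesis by (simp add: *)
    next
      case False
      then have "snd p' U = 0" if "p' \<in> set G" for p'
        using G that SU_zero_outside[OF _ False, of "snd p'"] by (auto simp: isotypic_decomp_def isotypic_def)
      then show ?thesis unfolding * by (intro arg_cong[where f = sum_list] map_cong) auto
    qed
  qed
  have R: "P F G = P F G'" if F: "isotypic_decomp n f F" and G: "isotypic_decomp n g G"
    and G': "isotypic_decomp n g G'" for F G G'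
  proof (rule ext)
    fix U :: "complex mat"
    have *: "P F G U = (\<Sum>p\<leftarrow>F. snd p U * (\<Sum>(w, b)\<leftarrow>G. deform_phase n (\<lambda>i j. K j i) w (fst p) * b U))" for G
      unfolding P_apply
      by (intro arg_cong[where f = sum_list] map_cong)
        (auto simp: deform_phase_swap[of n K] split_def mult_ac simp flip: sum_list_const_mult)
    show "P F G U = P F G' U"
    proof (cases "U \<in> SU n")
      case True
      then have "(\<Sum>(w, a)\<leftarrow>G. deform_phase n (\<lambda>i j. K j i) w w' * a U) =
          (\<Sum>(w, a)\<leftarrow>G'. deform_phase n (\<lambda>i j. K j i) w w' * a U)" for w'
        using isotypic_decomp_left_phase[OF G True, of "\<lambda>i j. K j i" "fst w'" "snd w'"]
          isotypic_decomp_left_phase[OF G' True, of "\<lambda>i j. K j i" "fst w'" "snd w'"] by simp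
      then show ?thesis by (simp add: *)
    next
      case False
      then have "snd p U = 0" if "p \<in> set F" for p
        using F that SU_zero_outside[OF _ False, of "snd p"] by (auto simp: isotypic_decomp_def isotypic_def)
      then show ?thesis unfolding * by (intro arg_cong[where f = sum_list] map_cong) auto
    qed
  qed
  show ?thesis unfolding deformed_mult_def P_def[symmetric]
    by (rule the_equality) (metis F G L R)+
qed

lemma mat_adjoint_index:
  fixes A :: "complex mat"
  assumes "A \<in> carrier_mat n m" "i < m" "j < n"
  shows "mat_adjoint A $$ (i, j) = cnj (A $$ (j, i))"
  using assms by (auto simp: mat_adjoint_def mat_of_rows_def conjugate_complex_def)

lemma mat_adjoint_carrier: "A \<in> carrier_mat n m \<Longrightarrow> mat_adjoint A \<in> carrier_mat m n"
  for A :: "complex mat"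
  by (auto simp: mat_adjoint_def)

lemma SU_mult_closed:
  assumes U: "U \<in> SU n" and V: "V \<in> SU n"
  shows "U * V \<in> SU n"
proof -
  have c: "U \<in> carrier_mat n n" "V \<in> carrier_mat n n" "mat_adjoint U \<in> carrier_mat n n"
    "mat_adjoint V \<in> carrier_mat n n" "U * V \<in> carrier_mat n n"
    using U V by (auto simp: SU_def intro: mat_adjoint_carrier)
  have "mat_adjoint (U * V) = mat_adjoint V * mat_adjoint U"
  proof (rule eq_matI)
    fix i j assume "i < dim_row (mat_adjoint V * mat_adjoint U)" "j < dim_col (mat_adjoint V * mat_adjoint U)"
    then have ij: "i < n" "j < n" using c by auto
    have "mat_adjoint (U * V) $$ (i, j) = cnj ((U * V) $$ (j, i))"
      using mat_adjoint_index[OF c(5)] ij by blast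
    also have "\<dots> = (\<Sum>k = 0..<n. cnj (V $$ (k, i)) * cnj (U $$ (j, k)))"
      using c ij by (simp add: scalar_prod_def mult.commute)
    also have "\<dots> = (mat_adjoint V * mat_adjoint U) $$ (i, j)"
      using c ij by (simp add: scalar_prod_def mat_adjoint_index)
    finally show "mat_adjoint (U * V) $$ (i, j) = (mat_adjoint V * mat_adjoint U) $$ (i, j)" .
  qed (use c mat_adjoint_carrier[OF c(5)] in auto)
  then have "(U * V) * mat_adjoint (U * V) = U * V * (mat_adjoint V * mat_adjoint U)" by simp
  also have "\<dots> = U * (V * (mat_adjoint V * mat_adjoint U))"
    using c by (intro assoc_mult_mat) auto
  also have "V * (mat_adjoint V * mat_adjoint U) = V * mat_adjoint V * mat_adjoint U"
    using c by (intro assoc_mult_mat[symmetric]) auto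
  also have "\<dots> = mat_adjoint U" using V c by (simp add: SU_def)
  also have "U * mat_adjoint U = 1\<^sub>m n" using U by (simp add: SU_def)
  finally have "(U * V) * mat_adjoint (U * V) = 1\<^sub>m n" .
  moreover have "det (U * V) = 1" using U V c by (simp add: SU_def det_mult)
  ultimately show ?thesis using c by (simp add: SU_def)
qed

lemma torus_SU: "torus n \<phi> \<in> SU n"
proof -
  define d where "d i = cis (2 * pi * (if Suc i < n then \<phi> (Suc i) else - (\<Sum>k = 1..<n. \<phi> k)))" for i
  have t: "torus n \<phi> = mat_diag n d" by (simp add: torus_def d_def [abs_def])
  have "mat_adjoint (mat_diag n d) = mat_diag n (\<lambda>i. cnj (d i))"
    using mat_adjoint_carrier[of "mat_diag n d" n n]
    by (intro eq_matI) (auto simp: mat_adjoint_index[of _ n n] mat_diag_def)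
  then have "mat_diag n d * mat_adjoint (mat_diag n d) = mat_diag n (\<lambda>i. d i * cnj (d i))" by simp
  also have "\<dots> = 1\<^sub>m n" by (simp add: d_def cis_cnj cis_mult)
  finally have "mat_diag n d * mat_adjoint (mat_diag n d) = 1\<^sub>m n" .
  moreover have "det (mat_diag n d) = 1"
  proof -
    have "det (mat_diag n d) = prod_list (diag_mat (mat_diag n d))"
      by (rule det_upper_triangular[of _ n]) (auto simp: upper_triangular_def mat_diag_def)
    also have "\<dots> = (\<Prod>i = 0..<n. d i)"
      by (simp add: prod_list_diag_prod) (auto simp: mat_diag_def intro!: prod.cong)
    also have "\<dots> = 1"
    proof (cases n)
      case (Suc m)
      have "(\<Prod>i = 0..<m. d i) = cis (2 * pi * (\<Sum>i = 0..<m. \<phi> (Suc i)))"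
      proof -
        have "(\<Prod>i = 0..<m'. d i) = cis (2 * pi * (\<Sum>i = 0..<m'. \<phi> (Suc i)))" if "m' \<le> m" for m'
          using that by (induction m') (auto simp: d_def Suc cis_mult distrib_left)
        then show ?thesis by simp
      qed
      moreover have "(\<Sum>i = 0..<m. \<phi> (Suc i)) = (\<Sum>k = 1..<n. \<phi> k)"
        using sum.shift_bounds_Suc_ivl[of \<phi> 0 m] by (simp add: Suc)
      ultimately show ?thesis by (simp add: Suc d_def cis_mult)
    qed simp
    finally show ?thesis .
  qed
  ultimately show ?thesis by (simp add: SU_def t)
qed

definition coord_weight :: "nat \<Rightarrow> nat \<Rightarrow> nat \<Rightarrow> int" where
  "coord_weight n i = (if i < n then (\<lambda>k. if k = i then 1 else 0) else (\<lambda>k. - 1))"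

lemma O_SU_subalgebra: "star_subalgebra (SU_functions n) (O_SU n)"
proof -
  let ?X = "{coord n i j | i j. i \<in> {1..n} \<and> j \<in> {1..n}}"
  have car: "star_subalgebra (SU_functions n) (carrier (SU_functions n))"
    by (auto simp: star_subalgebra_def SU_functions_def SU_one_def fscale_def fstar_def)
  have X: "?X \<subseteq> carrier (SU_functions n)" by (auto simp: SU_functions_def coord_def)
  have mem: "x \<in> O_SU n \<longleftrightarrow> (\<forall>t. star_subalgebra (SU_functions n) t \<longrightarrow> ?X \<subseteq> t \<longrightarrow> x \<in> t)" for x
    unfolding O_SU_def hull_def by blast
  have "O_SU n \<subseteq> carrier (SU_functions n)" using mem car X by blast
  then show ?thesis unfolding star_subalgebra_def
    by (intro conjI ballI allI) (simp_all only: mem star_subalgebra_def, blast+)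
qed

lemma coord_isotypic:
  assumes i: "i \<in> {1..n}" and j: "j \<in> {1..n}"
  shows "coord n i j \<in> isotypic n (coord_weight n i, coord_weight n j)"
proof -
  have w: "cis (2 * pi * (if Suc (i - 1) < n then \<phi> (Suc (i - 1)) else - (\<Sum>k = 1..<n. \<phi> k))) =
      cis (2 * pi * (\<Sum>k = 1..<n. of_int (coord_weight n i k) * \<phi> k))" if "i \<in> {1..n}" for i \<phi>
  proof (cases "i < n")
    case True
    have "(\<Sum>k = 1..<n. of_int (coord_weight n i k) * \<phi> k) = (\<Sum>k = 1..<n. if k = i then \<phi> k else 0)"
      by (intro sum.cong) (auto simp: coord_weight_def True)
    then show ?thesis using True that by simp
  next
    case False
    then show ?thesis using that by (simp add: coord_weight_def sum_negf)
  qed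
  have "coord n i j (torus n \<phi> * U * torus n \<psi>) =
     cis (2 * pi * (\<Sum>k = 1..<n. of_int (coord_weight n i k) * \<phi> k + of_int (coord_weight n j k) * \<psi> k)) *
       coord n i j U" if U: "U \<in> SU n" for U \<phi> \<psi>
  proof -
    have c: "U \<in> carrier_mat n n" using U by (simp add: SU_def)
    have V: "torus n \<phi> * U * torus n \<psi> \<in> SU n" using U by (intro SU_mult_closed torus_SU)
    have "(torus n \<phi> * U * torus n \<psi>) $$ (i - 1, j - 1) =
       cis (2 * pi * (if Suc (i - 1) < n then \<phi> (Suc (i - 1)) else - (\<Sum>k = 1..<n. \<phi> k))) * U $$ (i - 1, j - 1) *
       cis (2 * pi * (if Suc (j - 1) < n then \<psi> (Suc (j - 1)) else - (\<Sum>k = 1..<n. \<psi> k)))"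
      unfolding torus_def using i j c
      by (simp add: mat_diag_mult_left[OF c] mat_diag_mult_right[of _ n n] less_diff_conv2)
    also have "\<dots> = cis (2 * pi * (\<Sum>k = 1..<n. of_int (coord_weight n i k) * \<phi> k)) * U $$ (i - 1, j - 1) *
       cis (2 * pi * (\<Sum>k = 1..<n. of_int (coord_weight n j k) * \<psi> k))"
      unfolding w[OF i] w[OF j] ..
    also have "\<dots> = cis (2 * pi * (\<Sum>k = 1..<n. of_int (coord_weight n i k) * \<phi> k + of_int (coord_weight n j k) * \<psi> k)) * U $$ (i - 1, j - 1)"
      by (simp add: sum.distrib distrib_left mult_ac flip: cis_mult)
    finally show ?thesis using V U by (simp add: coord_def)
  qed
  moreover have "coord n i j \<in> O_SU n"
    unfolding O_SU_def by (rule hull_inc) (use i j in blast)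
  ultimately show ?thesis by (auto simp: isotypic_def)
qed

lemma isotypic_decomp_exists:
  assumes "f \<in> O_SU n"
  shows "\<exists>F. isotypic_decomp n f F"
proof -
  let ?S = "{f \<in> O_SU n. \<exists>F. isotypic_decomp n f F}"
  have S: "star_subalgebra (SU_functions n) (O_SU n)" by (rule O_SU_subalgebra)
  have iso: "\<exists>F. isotypic_decomp n f F" if "f \<in> isotypic n w" for f w
    using that by (intro exI[of _ "[(w, f)]"]) (simp add: isotypic_decomp_def)
  have closed: "f + g \<in> O_SU n" "f * g \<in> O_SU n" "fscale c f \<in> O_SU n" "fstar f \<in> O_SU n"
    if "f \<in> O_SU n" "g \<in> O_SU n" for f g c
    using S that by (auto simp: star_subalgebra_def SU_functions_def)
  have add: "\<exists>F. isotypic_decomp n (f + g) F"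
    if "\<exists>F. isotypic_decomp n f F" "\<exists>G. isotypic_decomp n g G" for f g
  proof -
    from that obtain F G where "isotypic_decomp n f F" "isotypic_decomp n g G" by blast
    then show ?thesis by (intro exI[of _ "F @ G"]) (auto simp: isotypic_decomp_def)
  qed
  have zero: "\<exists>F. isotypic_decomp n 0 F"
    by (intro exI[of _ "[]"]) (simp add: isotypic_decomp_def)
  have sum: "\<exists>F. isotypic_decomp n (\<Sum>p\<leftarrow>xs. h p) F"
    if "\<And>p. p \<in> set xs \<Longrightarrow> \<exists>F. isotypic_decomp n (h p) F"
    for xs and h :: "((nat \<Rightarrow> int) \<times> (nat \<Rightarrow> int)) \<times> (complex mat \<Rightarrow> complex) \<Rightarrow> complex mat \<Rightarrow> complex"
    using that
  proof (induction xs)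
    case (Cons p xs)
    then show ?case unfolding list.map sum_list.Cons by (intro add) auto
  qed (simp only: list.map sum_list.Nil zero)
  have lin: "\<exists>G. isotypic_decomp n (T f) G"
    if f: "\<exists>F. isotypic_decomp n f F"
      and T: "\<And>w a. a \<in> isotypic n w \<Longrightarrow> \<exists>w'. T a \<in> isotypic n w'"
      and T_add: "\<And>a b. T (a + b) = T a + T b" and T_zero: "T 0 = 0" for f T
  proof -
    from f obtain F where F: "isotypic_decomp n f F" by blast
    have "T (\<Sum>p\<leftarrow>F. snd p) = (\<Sum>p\<leftarrow>F. T (snd p))" for F :: "(((nat \<Rightarrow> int) \<times> (nat \<Rightarrow> int)) \<times> _) list"
    proof (induction F)
      case (Cons p F)
      then show ?case unfolding list.map sum_list.Cons by (simp only: T_add)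
    qed (simp only: list.map sum_list.Nil T_zero)
    then have "T f = (\<Sum>p\<leftarrow>F. T (snd p))" using F by (simp add: isotypic_decomp_def split_def)
    moreover have "\<exists>G. isotypic_decomp n (\<Sum>p\<leftarrow>F. T (snd p)) G"
    proof (rule sum)
      fix p assume "p \<in> set F"
      then have "snd p \<in> isotypic n (fst p)" using F by (auto simp: isotypic_decomp_def)
      then show "\<exists>G. isotypic_decomp n (T (snd p)) G" using T iso by blast
    qed
    ultimately show ?thesis by simp
  qed
  have star_iso: "fstar a \<in> isotypic n (\<lambda>k. - r k, \<lambda>k. - q k)" if "a \<in> isotypic n (r, q)" for a r q
  proof -
    have "cnj (cis (2 * pi * (\<Sum>k = 1..<n. of_int (r k) * \<phi> k + of_int (q k) * \<psi> k))) =
      cis (2 * pi * (\<Sum>k = 1..<n. of_int (- r k) * \<phi> k + of_int (- q k) * \<psi> k))" for \<phi> \<psi>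
      by (simp add: cis_cnj sum.distrib sum_negf sum_subtractf algebra_simps)
    then have "fstar a (torus n \<phi> * U * torus n \<psi>) = cis (2 * pi *
        (\<Sum>k = 1..<n. of_int (- r k) * \<phi> k + of_int (- q k) * \<psi> k)) * fstar a U"
      if "U \<in> SU n" for \<phi> \<psi> U
      unfolding fstar_def using isotypic_torus[OF \<open>a \<in> _\<close> that] by (simp only: complex_cnj_mult)
    moreover have "a \<in> O_SU n" using that by (simp add: isotypic_def)
    ultimately show ?thesis unfolding isotypic_def prod.case using closed(4) by blast
  qed
  have mult_iso: "a * b \<in> isotypic n (\<lambda>k. r k + r' k, \<lambda>k. q k + q' k)"
    if "a \<in> isotypic n (r, q)" "b \<in> isotypic n (r', q')" for a b r q r' q'
  proof -
    have *: "cis (2 * pi * (\<Sum>k = 1..<n. of_int (r k) * \<phi> k + of_int (q k) * \<psi> k)) *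
      cis (2 * pi * (\<Sum>k = 1..<n. of_int (r' k) * \<phi> k + of_int (q' k) * \<psi> k)) =
      cis (2 * pi * (\<Sum>k = 1..<n. of_int (r k + r' k) * \<phi> k + of_int (q k + q' k) * \<psi> k))" for \<phi> \<psi>
      by (simp add: cis_mult sum.distrib algebra_simps)
    have "(a * b) (torus n \<phi> * U * torus n \<psi>) = cis (2 * pi *
        (\<Sum>k = 1..<n. of_int (r k + r' k) * \<phi> k + of_int (q k + q' k) * \<psi> k)) * (a * b) U"
      if "U \<in> SU n" for \<phi> \<psi> U
      unfolding times_fun_apply *[symmetric] isotypic_torus[OF \<open>a \<in> _\<close> that] isotypic_torus[OF \<open>b \<in> _\<close> that]
      by (simp only: mult_ac)
    moreover have "a \<in> O_SU n" "b \<in> O_SU n" using that by (simp_all add: isotypic_def)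
    ultimately show ?thesis unfolding isotypic_def prod.case using closed(2) by blast
  qed
  have "star_subalgebra (SU_functions n) ?S"
  proof -
    have "SU_one n \<in> isotypic n (\<lambda>_. 0, \<lambda>_. 0)"
      using S torus_SU SU_mult_closed
      by (auto simp: isotypic_def SU_one_def star_subalgebra_def SU_functions_def)
    then have one: "\<exists>F. isotypic_decomp n (SU_one n) F" by (rule iso)
    have "\<exists>F. isotypic_decomp n (f * g) F"
      if f: "\<exists>F. isotypic_decomp n f F" and g: "\<exists>G. isotypic_decomp n g G" for f g
    proof -
      have *: "\<exists>F. isotypic_decomp n (a * g) F" if a: "a \<in> isotypic n w" for a w
      proof (rule lin[OF g, where T = "\<lambda>g. a * g"])
        fix w' b assume "b \<in> isotypic n w'"
        then show "\<exists>w''. a * b \<in> isotypic n w''"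
          using mult_iso a by (cases w; cases w') blast
      qed (auto simp: distrib_left)
      from f obtain F where F: "isotypic_decomp n f F" by blast
      have "f * g = (\<Sum>p\<leftarrow>F. snd p * g)"
        using F by (simp add: isotypic_decomp_def split_def sum_list_mult_const)
      moreover have "\<exists>G. isotypic_decomp n (\<Sum>p\<leftarrow>F. snd p * g) G"
      proof (rule sum)
        fix p assume "p \<in> set F"
        then have "snd p \<in> isotypic n (fst p)" using F by (auto simp: isotypic_decomp_def)
        then show "\<exists>G. isotypic_decomp n (snd p * g) G" using * by blast
      qed
      ultimately show ?thesis by simp
    qed
    moreover have "\<exists>F. isotypic_decomp n (fscale c f) F" if "\<exists>F. isotypic_decomp n f F" for f c
    proof (rule lin[OF that])
      show "\<exists>w'. fscale c a \<in> isotypic n w'" if "a \<in> isotypic n w" for a w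
        using that closed by (intro exI[of _ w]) (auto simp: isotypic_def fscale_def split: prod.splits)
    qed (auto simp: fscale_def fun_eq_iff distrib_left)
    moreover have "\<exists>F. isotypic_decomp n (fstar f) F" if "\<exists>F. isotypic_decomp n f F" for f
    proof (rule lin[OF that])
      show "\<exists>w'. fstar a \<in> isotypic n w'" if "a \<in> isotypic n w" for a w
        using that star_iso by (cases w) blast
    qed (auto simp: fstar_def fun_eq_iff)
    ultimately show ?thesis
      using S one zero add closed unfolding star_subalgebra_def SU_functions_def by auto
  qed
  moreover have "{coord n i j | i j. i \<in> {1..n} \<and> j \<in> {1..n}} \<subseteq> ?S"
  proof clarify
    fix i j assume "i \<in> {1..n}" "j \<in> {1..n}"
    then have "coord n i j \<in> isotypic n (coord_weight n i, coord_weight n j)" by (rule coord_isotypic)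
    then show "coord n i j \<in> O_SU n \<and> (\<exists>F. isotypic_decomp n (coord n i j) F)"
      using iso by (simp add: isotypic_def) blast
  qed
  ultimately have "O_SU n \<subseteq> ?S"
    by (subst O_SU_def) (rule hull_minimal)
  then show ?thesis using assms by blast
qed

definition SU_deformed :: "nat \<Rightarrow> (nat \<Rightarrow> nat \<Rightarrow> real) \<Rightarrow> (complex mat \<Rightarrow> complex) star_algebra" where
  "SU_deformed n K =
     \<lparr> carrier = O_SU n, monoid.mult = deformed_mult n K, one = SU_one n, zero = 0,
       add = (+), module.smult = fscale, star = fstar \<rparr>"

text \<open>
  The deformed algebra depends only on \<open>K\<close> modulo 2. (Changing \<open>K\<close> by an integral antisymmetric
  matrix only rescales isotypic components by signs, which gives an isomorphic algebra.) Equalities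
  between deformation parameters are therefore to be read modulo 1.
\<close>

lemma deform_phase_periodic:
  assumes "\<And>i j. K' i j = K i j + 2 * of_int (N i j)"
  shows "deform_phase n K' = deform_phase n K"
proof (intro ext, clarify)
  fix r q r' q' :: "nat \<Rightarrow> int"
  define M where "M x y = (\<Sum>i = 1..<n. \<Sum>j = 1..<n. x i * N i j * y j)" for x y
  have M: "torus_form n K' x y = torus_form n K x y + 2 * of_int (M x y)" for x y
    by (simp add: torus_form_def M_def assms sum.distrib sum_distrib_left algebra_simps)
  have "pi * (torus_form n K' r r' - torus_form n K' q q') =
      pi * (torus_form n K r r' - torus_form n K q q') + 2 * pi * of_int (M r r' - M q q')"
    unfolding M by (simp add: algebra_simps)
  then have "cis (pi * (torus_form n K' r r' - torus_form n K' q q')) =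
      cis (pi * (torus_form n K r r' - torus_form n K q q')) * cis (2 * pi * of_int (M r r' - M q q'))"
    by (simp only: cis_mult)
  also have "cis (2 * pi * of_int (M r r' - M q q')) = 1"
    by (rule cis_multiple_2pi) (rule Ints_of_int)
  finally show "deform_phase n K' (r, q) (r', q') = deform_phase n K (r, q) (r', q')"
    by (simp add: deform_phase_def)
qed

lemma SU_deformed_periodic:
  assumes "\<And>i j. K' i j = K i j + 2 * of_int (N i j)"
  shows "SU_deformed n K' = SU_deformed n K"
  using deform_phase_periodic[OF assms] by (simp add: SU_deformed_def deformed_mult_def[abs_def])

definition SU3 :: "real \<Rightarrow> (complex mat \<Rightarrow> complex) star_algebra" where
  "SU3 \<theta> = SU_deformed 3 (\<lambda>i j. if (i, j) = (1, 2) then \<theta> else if (i, j) = (2, 1) then - \<theta> else 0)"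

abbreviation SU4 :: "(nat \<Rightarrow> nat \<Rightarrow> real) \<Rightarrow> (complex mat \<Rightarrow> complex) star_algebra" where
  "SU4 lam \<equiv> SU_deformed 4 lam"

definition SU3_action_on_SU4 :: "real \<Rightarrow> (nat \<Rightarrow> nat \<Rightarrow> real) \<Rightarrow>
   ((complex mat \<Rightarrow> complex) \<Rightarrow> (complex mat \<times> complex mat \<Rightarrow> complex)) \<Rightarrow> bool" where
  "SU3_action_on_SU4 \<theta> lam \<rho> \<longleftrightarrow>
     left_action (SU3 \<theta>) (comult 3) (counit 3) (SU4 lam) \<rho> \<and>
     (\<forall>k\<in>{1..3}. \<forall>l\<in>{1..4}. \<rho> (coord 4 k l) = (\<Sum>\<alpha> = 1..3. coord 3 k \<alpha> \<boxtimes> coord 4 \<alpha> l)) \<and>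
     (\<forall>l\<in>{1..4}. \<rho> (coord 4 4 l) = \<one>\<^bsub>SU3 \<theta>\<^esub> \<boxtimes> coord 4 4 l)"

end

theory Submission
  imports Defs
begin

text \<open>
  Applying \<open>\<rho>\<close> to the commutation relation of \<open>v\<^sub>k\<^sub>1\<close> and \<open>v\<^sub>l\<^sub>1\<close> and evaluating at the unit of
  \<open>SU(4)\<close> leaves only \<open>u\<^sub>k\<^sub>1 u\<^sub>l\<^sub>1\<close> and forces \<open>\<lambda>\<^sub>k\<^sub>l\<close> to be, modulo 1, the corresponding parameter of
  \<open>SU(3)\<^sub>\<theta>\<close>. Conversely, if the parameters agree exactly, then the undeformed coaction
  \<open>f \<mapsto> ((U, V) \<mapsto> f (diag(U, 1) V))\<close> respects the deformed products, because the phases of the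
  inner torus weights cancel. If they agree only modulo 1, then the bicharacters differ by a sign
  that is the coboundary of a quadratic sign \<open>\<sigma>\<close> on the weights; multiplication by \<open>\<sigma>\<close> is a
  finite linear combination of torus translations, and conjugating with it repairs the coaction.

  Invariant elements thus correspond to polynomial functions \<open>f\<close> on \<open>SU(4)\<close> that depend only on the
  last row \<open>z\<close>. Completing \<open>z\<close> to a matrix by the projections of three of the unit vectors shows that
  \<open>z\<^sub>j\<^sup>N f\<close> is a polynomial in \<open>z\<close> and its conjugate, for each \<open>j\<close>. This matrix is not unitary, but it
  lies on a rational curve containing infinitely many unitary completions of \<open>z\<close>. As the powers
  \<open>z\<^sub>j\<^sup>N\<close> generate the unit ideal, \<open>f\<close> itself is a polynomial in \<open>z\<close> and its conjugate.
\<close>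

section \<open>Finite sums and generated subalgebras\<close>

text \<open>Two products live on the same functions. On isotypic functions they differ by a nonzero
  scalar, so a set of isotypic functions that is closed under scaling is closed under one product
  exactly when it is closed under the other. Hence most arguments run over finite sums of isotypic
  functions, and the invariants can be computed in the commutative algebra. An action is an algebra
  homomorphism with no condition on the involution. It is still determined by the generators,
  because on \<open>SU n\<close> the conjugate of an entry is a cofactor, hence a polynomial in the
  entries. So every action is the one constructed here. The congruence modulo 1 arises because the
  image of the undeformed product v_k1 v_l1 is an unknown number; it drops out only when the two
  orders of the factors are compared, which leaves exp(2 pi i x) instead of exp(pi i x). For the
  invariants the obstacle is that a polynomial representing f need not be invariant away from
  \<open>SU 4\<close>. Continuation in one complex parameter along a family of completions of z
  takes the place of invariance there.\<close>

inductive_set fsums :: "'a :: comm_monoid_add set \<Rightarrow> 'a set" for S where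
  fsums_zero: "0 \<in> fsums S"
| fsums_add: "a \<in> S \<Longrightarrow> x \<in> fsums S \<Longrightarrow> a + x \<in> fsums S"

lemma fsums_incl: "a \<in> S \<Longrightarrow> a \<in> fsums S"
  using fsums_add[OF _ fsums_zero] by fastforce

lemma fsums_plus: "x \<in> fsums S \<Longrightarrow> y \<in> fsums S \<Longrightarrow> x + y \<in> fsums S"
  by (induction rule: fsums.induct) (auto simp: add.assoc intro: fsums_add)

lemma fsums_additive_image:
  assumes "x \<in> fsums S" "\<And>a. a \<in> S \<Longrightarrow> T a \<in> fsums S'" "T 0 = 0" "\<And>a b. T (a + b) = T a + T b"
  shows "T x \<in> fsums S'"
  using assms(1) by induction (auto simp: assms fsums_zero intro: fsums_plus)

lemma fsums_times:
  fixes S :: "('x \<Rightarrow> complex) set"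
  assumes S: "\<And>a b. a \<in> S \<Longrightarrow> b \<in> S \<Longrightarrow> a * b \<in> S" and x: "x \<in> fsums S" and y: "y \<in> fsums S"
  shows "x * y \<in> fsums S"
proof (rule fsums_additive_image[OF x, where T = "\<lambda>a. a * y"])
  fix a assume "a \<in> S"
  then show "a * y \<in> fsums S"
    by (intro fsums_additive_image[OF y, where T = "\<lambda>b. a * b"])
      (auto simp: S distrib_left simp del: times_fun_apply intro: fsums_incl)
qed (auto simp: distrib_right)

lemma fscale_simps [simp]:
  "fscale c 0 = 0" "fscale 0 f = 0" "fscale 1 f = f" "fscale c (fscale d f) = fscale (c * d) f"
  "fscale c f * fscale d g = fscale (c * d) (f * g)"
  by (auto simp: fscale_def fun_eq_iff)

lemma fscale_add: "fscale c (f + g) = fscale c f + fscale c g" "fscale (c + d) f = fscale c f + fscale d f"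
  by (auto simp: fscale_def fun_eq_iff algebra_simps)

lemma fscale_times: "fscale c f * g = fscale c (f * g)" "f * fscale c g = fscale c (f * g)"
  by (auto simp: fscale_def fun_eq_iff)

lemma fscale_apply: "fscale c f x = c * f x"
  by (simp add: fscale_def)

lemma fscale_sum_list: "fscale c (\<Sum>p\<leftarrow>xs. f p) = (\<Sum>p\<leftarrow>xs. fscale c (f p))"
proof (induction xs)
  case Nil
  show ?case by (simp only: list.map sum_list.Nil fscale_simps)
next
  case (Cons p xs)
  then show ?case by (simp only: list.map sum_list.Cons fscale_add)
qed

lemma fstar_simps [simp]:
  "fstar 0 = 0" "fstar (f + g) = fstar f + fstar g" "fstar (f * g) = fstar f * fstar g"
  "fstar (fscale c f) = fscale (cnj c) (fstar f)" "fstar (fstar f) = f"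
  by (auto simp: fstar_def fscale_def fun_eq_iff)

lemma SU_functions_simps [simp]:
  "carrier (SU_functions n) = {f. \<forall>U. U \<notin> SU n \<longrightarrow> f U = 0}" "a \<otimes>\<^bsub>SU_functions n\<^esub> b = a * b"
  "\<one>\<^bsub>SU_functions n\<^esub> = SU_one n" "\<zero>\<^bsub>SU_functions n\<^esub> = 0" "a \<oplus>\<^bsub>SU_functions n\<^esub> b = a + b"
  "c \<odot>\<^bsub>SU_functions n\<^esub> a = fscale c a" "star (SU_functions n) = fstar"
  by (simp_all add: SU_functions_def)

lemma SU_deformed_simps [simp]:
  "carrier (SU_deformed n K) = O_SU n" "a \<otimes>\<^bsub>SU_deformed n K\<^esub> b = deformed_mult n K a b"
  "\<one>\<^bsub>SU_deformed n K\<^esub> = SU_one n" "\<zero>\<^bsub>SU_deformed n K\<^esub> = 0" "a \<oplus>\<^bsub>SU_deformed n K\<^esub> b = a + b"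
  "c \<odot>\<^bsub>SU_deformed n K\<^esub> a = fscale c a" "star (SU_deformed n K) = fstar"
  by (simp_all add: SU_deformed_def)

text \<open>\<open>S\<close> has to be closed under products, scalars and the involution, but not
  under addition. This fits families of homogeneous elements and reduces questions about a generated
  algebra to them.\<close>

lemma star_generated_subset_sums:
  assumes "X \<subseteq> S" "SU_one n \<in> S" "S \<subseteq> carrier (SU_functions n)"
    and m: "\<And>a b. a \<in> S \<Longrightarrow> b \<in> S \<Longrightarrow> a * b \<in> S"
    and s: "\<And>c a. a \<in> S \<Longrightarrow> fscale c a \<in> S"
    and st: "\<And>a. a \<in> S \<Longrightarrow> fstar a \<in> S"
  shows "star_generated (SU_functions n) X \<subseteq> fsums S"
proof (rule hull_minimal)
  show "X \<subseteq> fsums S" using assms(1) fsums_incl by blast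
  have "fsums S \<subseteq> carrier (SU_functions n)"
  proof
    fix x assume "x \<in> fsums S"
    then show "x \<in> carrier (SU_functions n)"
      by induction (use assms(3) in auto)
  qed
  moreover have "fscale c x \<in> fsums S" if "x \<in> fsums S" for c x
    by (rule fsums_additive_image[OF that, where T = "fscale c"]) (simp_all add: fscale_add s fsums_incl)
  moreover have "fstar x \<in> fsums S" if "x \<in> fsums S" for x
    by (rule fsums_additive_image[OF that, where T = fstar]) (simp_all add: st fsums_incl)
  moreover have "x * y \<in> fsums S" if "x \<in> fsums S" "y \<in> fsums S" for x y
    using m that by (rule fsums_times)
  ultimately show "star_subalgebra (SU_functions n) (fsums S)"
    using fsums_incl[OF assms(2)] by (simp add: star_subalgebra_def fsums_zero fsums_plus)
qed

lemma star_subalgebraD: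
  assumes "star_subalgebra A S"
  shows "S \<subseteq> carrier A" "\<zero>\<^bsub>A\<^esub> \<in> S" "\<one>\<^bsub>A\<^esub> \<in> S"
    "a \<in> S \<Longrightarrow> b \<in> S \<Longrightarrow> a \<oplus>\<^bsub>A\<^esub> b \<in> S" "a \<in> S \<Longrightarrow> b \<in> S \<Longrightarrow> a \<otimes>\<^bsub>A\<^esub> b \<in> S"
    "a \<in> S \<Longrightarrow> c \<odot>\<^bsub>A\<^esub> a \<in> S" "a \<in> S \<Longrightarrow> star A a \<in> S"
  using assms by (auto simp: star_subalgebra_def)

lemma star_generated_subalgebra:
  assumes "X \<subseteq> T" "star_subalgebra A T"
  shows "star_subalgebra A (star_generated A X)"
proof -
  let ?F = "{t. star_subalgebra A t \<and> X \<subseteq> t}"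
  have "star_subalgebra A (\<Inter>?F)"
    unfolding star_subalgebra_def[of A "\<Inter>?F"]
  proof (intro conjI ballI allI)
    \<comment> \<open>An empty family would have the whole type as its intersection, so a subalgebra
      containing \<open>X\<close> must be exhibited.\<close>
    have "T \<in> ?F" using assms by simp
    then show "\<Inter>?F \<subseteq> carrier A"
      using star_subalgebraD(1)[OF assms(2)] by blast
  qed (auto dest: star_subalgebraD)
  then show ?thesis by (simp add: hull_def)
qed

section \<open>Isotypic components and the deformed product\<close>

lemma O_SU_closed:
  "0 \<in> O_SU n" "SU_one n \<in> O_SU n" "f \<in> O_SU n \<Longrightarrow> g \<in> O_SU n \<Longrightarrow> f + g \<in> O_SU n"
  "f \<in> O_SU n \<Longrightarrow> g \<in> O_SU n \<Longrightarrow> f * g \<in> O_SU n" "f \<in> O_SU n \<Longrightarrow> fscale c f \<in> O_SU n"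
  "f \<in> O_SU n \<Longrightarrow> fstar f \<in> O_SU n"
  using O_SU_subalgebra[of n] by (auto simp: star_subalgebra_def)

lemma O_SU_coord: "i \<in> {1..n} \<Longrightarrow> j \<in> {1..n} \<Longrightarrow> coord n i j \<in> O_SU n"
  unfolding O_SU_def by (rule hull_inc) blast

lemma fun_subspace_O_SU: "fun_subspace (O_SU n)"
  by (simp add: fun_subspace_def O_SU_closed)

lemma isotypicD: "a \<in> isotypic n w \<Longrightarrow> a \<in> O_SU n"
  by (cases w) (simp add: isotypic_def)

lemma isotypic_mult:
  assumes "a \<in> isotypic n (r, q)" "b \<in> isotypic n (r', q')"
  shows "a * b \<in> isotypic n (\<lambda>k. r k + r' k, \<lambda>k. q k + q' k)"
proof -
  have *: "cis (2 * pi * (\<Sum>k = 1..<n. of_int (r k) * \<phi> k + of_int (q k) * \<psi> k)) *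
      cis (2 * pi * (\<Sum>k = 1..<n. of_int (r' k) * \<phi> k + of_int (q' k) * \<psi> k)) =
      cis (2 * pi * (\<Sum>k = 1..<n. of_int (r k + r' k) * \<phi> k + of_int (q k + q' k) * \<psi> k))" for \<phi> \<psi>
    by (simp add: cis_mult sum.distrib algebra_simps)
  have "(a * b) (torus n \<phi> * U * torus n \<psi>) = cis (2 * pi *
        (\<Sum>k = 1..<n. of_int (r k + r' k) * \<phi> k + of_int (q k + q' k) * \<psi> k)) * (a * b) U"
    if "U \<in> SU n" for \<phi> \<psi> U
    unfolding times_fun_apply *[symmetric] isotypic_torus[OF assms(1) that] isotypic_torus[OF assms(2) that]
    by (simp only: mult_ac)
  moreover have "a * b \<in> O_SU n" using assms isotypicD O_SU_closed(4) by metis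
  ultimately show ?thesis unfolding isotypic_def prod.case by blast
qed

lemma isotypic_fstar:
  assumes "a \<in> isotypic n (r, q)"
  shows "fstar a \<in> isotypic n (\<lambda>k. - r k, \<lambda>k. - q k)"
proof -
  have "cnj (cis (2 * pi * (\<Sum>k = 1..<n. of_int (r k) * \<phi> k + of_int (q k) * \<psi> k))) =
      cis (2 * pi * (\<Sum>k = 1..<n. of_int (- r k) * \<phi> k + of_int (- q k) * \<psi> k))" for \<phi> \<psi>
    by (simp add: cis_cnj sum.distrib sum_negf sum_subtractf algebra_simps)
  then have "fstar a (torus n \<phi> * U * torus n \<psi>) = cis (2 * pi *
        (\<Sum>k = 1..<n. of_int (- r k) * \<phi> k + of_int (- q k) * \<psi> k)) * fstar a U"
    if "U \<in> SU n" for \<phi> \<psi> U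
    unfolding fstar_def using isotypic_torus[OF assms that] by (simp only: complex_cnj_mult)
  moreover have "fstar a \<in> O_SU n" using assms isotypicD O_SU_closed(6) by metis
  ultimately show ?thesis unfolding isotypic_def prod.case by blast
qed

lemma isotypic_fscale: "a \<in> isotypic n w \<Longrightarrow> fscale c a \<in> isotypic n w"
  by (cases w) (auto simp: isotypic_def O_SU_closed fscale_apply)

lemma isotypic_SU_one: "SU_one n \<in> isotypic n (\<lambda>_. 0, \<lambda>_. 0)"
  using torus_SU SU_mult_closed O_SU_closed(2)[of n] by (auto simp: isotypic_def SU_one_def)

text \<open>Indices are functions on all of \<open>nat\<close>, so one character has many indices.
  This matters for \<open>bar\<close> below: it turns weights of \<open>SU 4\<close> into weights of
  \<open>SU 3\<close> that agree with \<open>coord_weight 3\<close> only on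
  \<open>{1..<3}\<close>.\<close>

lemma isotypic_cong:
  assumes "a \<in> isotypic n (r, q)" "\<And>k. k \<in> {1..<n} \<Longrightarrow> r k = r' k" "\<And>k. k \<in> {1..<n} \<Longrightarrow> q k = q' k"
  shows "a \<in> isotypic n (r', q')"
proof -
  have "(\<Sum>k = 1..<n. of_int (r k) * \<phi> k + of_int (q k) * \<psi> k) =
      (\<Sum>k = 1..<n. of_int (r' k) * \<phi> k + of_int (q' k) * \<psi> k)" for \<phi> \<psi> :: "nat \<Rightarrow> real"
    by (rule sum.cong) (use assms(2,3) in auto)
  then show ?thesis using assms(1) unfolding isotypic_def by (simp only: prod.case)
qed

lemma O_SU_eq_sums: "O_SU n = fsums (\<Union>w. isotypic n w)"
proof
  show "O_SU n \<subseteq> fsums (\<Union>w. isotypic n w)"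
  proof
    fix f assume "f \<in> O_SU n"
    then obtain F where F: "isotypic_decomp n f F" using isotypic_decomp_exists by blast
    have "(\<Sum>(w, a)\<leftarrow>F. a) \<in> fsums (\<Union>w. isotypic n w)" if "\<forall>(w, a)\<in>set F. a \<in> isotypic n w" for F
      using that by (induction F) (auto intro: fsums_zero fsums_add)
    then show "f \<in> fsums (\<Union>w. isotypic n w)" using F unfolding isotypic_decomp_def by blast
  qed
  show "fsums (\<Union>w. isotypic n w) \<subseteq> O_SU n"
  proof
    fix f assume "f \<in> fsums (\<Union>w. isotypic n w)"
    then show "f \<in> O_SU n"
    proof (induction rule: fsums.induct)
      case (fsums_add a x)
      then show ?case using isotypicD O_SU_closed(3) by blast
    qed (rule O_SU_closed(1))
  qed
qed

lemma O_SU_isotypic_induct [consumes 1, case_names zero isotypic add]: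
  assumes "f \<in> O_SU n" and "P 0" and "\<And>r q a. a \<in> isotypic n (r, q) \<Longrightarrow> P a"
    and "\<And>f g. f \<in> O_SU n \<Longrightarrow> g \<in> O_SU n \<Longrightarrow> P f \<Longrightarrow> P g \<Longrightarrow> P (f + g)"
  shows "P f"
proof -
  have "f \<in> O_SU n \<and> P f"
    using assms(1) unfolding O_SU_eq_sums[of n]
  proof (induction rule: fsums.induct)
    case fsums_zero
    show ?case using assms(2) fsums.fsums_zero by blast
  next
    case (fsums_add a x)
    from fsums_add(1) obtain r q where a: "a \<in> isotypic n (r, q)" by auto
    have x: "x \<in> O_SU n" "P x" using fsums_add(3) by (simp_all add: O_SU_eq_sums)
    from assms(4)[OF isotypicD[OF a] x(1) assms(3)[OF a] x(2)] O_SU_closed(3)[OF isotypicD[OF a] x(1)]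
    show ?case unfolding O_SU_eq_sums by (intro conjI)
  qed
  then show ?thesis by blast
qed

lemma deformed_mult_isotypic:
  assumes "a \<in> isotypic n w" "b \<in> isotypic n w'"
  shows "deformed_mult n K a b = fscale (deform_phase n K w w') (a * b)"
  using deformed_mult_eq[of n a "[(w, a)]" b "[(w', b)]" K] assms by (simp add: isotypic_decomp_def)

lemma deformed_mult_add_left:
  assumes "f \<in> O_SU n" "g \<in> O_SU n" "h \<in> O_SU n"
  shows "deformed_mult n K (f + g) h = deformed_mult n K f h + deformed_mult n K g h"
proof -
  obtain F G H where *: "isotypic_decomp n f F" "isotypic_decomp n g G" "isotypic_decomp n h H"
    using assms isotypic_decomp_exists by meson
  moreover from * have "isotypic_decomp n (f + g) (F @ G)" by (auto simp: isotypic_decomp_def)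
  ultimately show ?thesis by (simp add: deformed_mult_eq)
qed

lemma deformed_mult_add_right:
  assumes "f \<in> O_SU n" "g \<in> O_SU n" "h \<in> O_SU n"
  shows "deformed_mult n K h (f + g) = deformed_mult n K h f + deformed_mult n K h g"
proof -
  obtain F G H where *: "isotypic_decomp n f F" "isotypic_decomp n g G" "isotypic_decomp n h H"
    using assms isotypic_decomp_exists by meson
  moreover from * have "isotypic_decomp n (f + g) (F @ G)" by (auto simp: isotypic_decomp_def)
  ultimately show ?thesis by (simp add: deformed_mult_eq split_def sum_list_addf)
qed

lemma isotypic_decomp_fscale:
  assumes "isotypic_decomp n f F"
  shows "isotypic_decomp n (fscale c f) (map (\<lambda>(w, a). (w, fscale c a)) F)"
  using assms
  by (auto simp: isotypic_decomp_def fscale_sum_list split_def comp_def isotypic_fscale)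

lemma deformed_mult_fscale:
  assumes "f \<in> O_SU n" "g \<in> O_SU n"
  shows "deformed_mult n K (fscale c f) g = fscale c (deformed_mult n K f g)"
    and "deformed_mult n K f (fscale c g) = fscale c (deformed_mult n K f g)"
proof -
  obtain F G where *: "isotypic_decomp n f F" "isotypic_decomp n g G"
    using assms isotypic_decomp_exists by meson
  note c = *[THEN isotypic_decomp_fscale, of c]
  show "deformed_mult n K (fscale c f) g = fscale c (deformed_mult n K f g)"
    unfolding deformed_mult_eq[OF c(1) *(2)] deformed_mult_eq[OF *]
    by (simp add: fscale_sum_list split_def comp_def fscale_times mult.commute)
  show "deformed_mult n K f (fscale c g) = fscale c (deformed_mult n K f g)"
    unfolding deformed_mult_eq[OF *(1) c(2)] deformed_mult_eq[OF *]
    by (simp add: fscale_sum_list split_def comp_def fscale_times mult.commute)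
qed

lemma deformed_mult_zero:
  assumes "g \<in> O_SU n"
  shows "deformed_mult n K 0 g = 0" "deformed_mult n K g 0 = 0"
  using deformed_mult_fscale[OF assms assms, of K 0] by simp_all

lemma deformed_mult_closed:
  assumes "f \<in> O_SU n" "g \<in> O_SU n"
  shows "deformed_mult n K f g \<in> O_SU n"
proof -
  have "deformed_mult n K a g \<in> O_SU n" if a: "a \<in> isotypic n w" for a w
    using assms(2)
  proof (induction rule: O_SU_isotypic_induct[where P = "\<lambda>g. deformed_mult n K a g \<in> O_SU n"])
    case zero
    then show ?case using deformed_mult_zero(2)[OF isotypicD[OF a]] O_SU_closed(1) by metis
  next
    case (isotypic r q b)
    then show ?case unfolding deformed_mult_isotypic[OF a isotypic]
      using isotypicD a O_SU_closed(4,5) by blast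
  next
    case (add f g)
    then show ?case using deformed_mult_add_right[OF add(1,2) isotypicD[OF a]] O_SU_closed(3) by metis
  qed
  note iso = this
  show ?thesis using assms(1)
  proof (induction rule: O_SU_isotypic_induct[where P = "\<lambda>f. deformed_mult n K f g \<in> O_SU n"])
    case zero
    then show ?case using deformed_mult_zero(1)[OF assms(2)] O_SU_closed(1) by metis
  next
    case (add f h)
    then show ?case using deformed_mult_add_left[OF add(1,2) assms(2)] O_SU_closed(3) by metis
  qed (rule iso)
qed

section \<open>The tensor product of two deformed algebras\<close>

lemma etensor_apply: "(a \<boxtimes> b) (x, y) = a x * b y"
  by (simp add: etensor_def)

lemma etensor_add: "(a + a') \<boxtimes> b = a \<boxtimes> b + a' \<boxtimes> b" "a \<boxtimes> (b + b') = a \<boxtimes> b + a \<boxtimes> b'"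
  by (auto simp: etensor_def fun_eq_iff algebra_simps)

lemma etensor_fscale: "fscale c a \<boxtimes> b = fscale c (a \<boxtimes> b)" "a \<boxtimes> fscale c b = fscale c (a \<boxtimes> b)"
  by (auto simp: etensor_def fscale_def fun_eq_iff algebra_simps)

lemma tensor_spaceI: "set xs \<subseteq> A \<times> B \<Longrightarrow> (\<Sum>(a, b)\<leftarrow>xs. a \<boxtimes> b) \<in> tensor_space A B"
  by (auto simp: tensor_space_def)

lemma tensor_spaceE:
  assumes "F \<in> tensor_space A B"
  obtains xs where "set xs \<subseteq> A \<times> B" "F = (\<Sum>(a, b)\<leftarrow>xs. a \<boxtimes> b)"
  using assms by (auto simp: tensor_space_def)

lemma zero_in_tensor_space: "0 \<in> tensor_space A B"
  using tensor_spaceI[of "[]" A B] by simp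

lemma tensor_space_add:
  assumes "F \<in> tensor_space A B" "G \<in> tensor_space A B"
  shows "F + G \<in> tensor_space A B"
proof -
  obtain xs ys where *: "set xs \<subseteq> A \<times> B" "F = (\<Sum>(a, b)\<leftarrow>xs. a \<boxtimes> b)"
    "set ys \<subseteq> A \<times> B" "G = (\<Sum>(a, b)\<leftarrow>ys. a \<boxtimes> b)"
    using assms by (auto elim!: tensor_spaceE)
  then have "F + G = (\<Sum>(a, b)\<leftarrow>xs @ ys. a \<boxtimes> b)" by simp
  then show ?thesis using * tensor_spaceI[of "xs @ ys" A B] by auto
qed

context
  fixes m n :: nat and K L :: "nat \<Rightarrow> nat \<Rightarrow> real"
begin

abbreviation "tprod \<equiv> tensor_algebra (SU_deformed m K) (SU_deformed n L)"

lemma tensor_algebra_simps: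
  "carrier tprod = tensor_space (O_SU m) (O_SU n)" "\<one>\<^bsub>tprod\<^esub> = SU_one m \<boxtimes> SU_one n"
  "F \<oplus>\<^bsub>tprod\<^esub> G = F + G" "c \<odot>\<^bsub>tprod\<^esub> F = fscale c F"
  by (simp_all add: tensor_algebra_def)

text \<open>The product is a nested \<open>tensor_lift\<close>. For fixed \<open>a\<close> and
  \<open>b\<close> the inner lift is an explicit sum over \<open>ys\<close>, and this sum is visibly
  bilinear in \<open>a\<close> and \<open>b\<close>, so the outer lift can be evaluated as well. Any
  presentations \<open>xs\<close> and \<open>ys\<close> may be used.\<close>

lemma tensor_algebra_mult:
  assumes xs: "set xs \<subseteq> O_SU m \<times> O_SU n" and ys: "set ys \<subseteq> O_SU m \<times> O_SU n"
  shows "(\<Sum>(a, b)\<leftarrow>xs. a \<boxtimes> b) \<otimes>\<^bsub>tprod\<^esub> (\<Sum>(a, b)\<leftarrow>ys. a \<boxtimes> b) =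
    (\<Sum>(a, b)\<leftarrow>xs. \<Sum>(a', b')\<leftarrow>ys. deformed_mult m K a a' \<boxtimes> deformed_mult n L b b')"
proof -
  let ?A = "O_SU m" and ?B = "O_SU n"
  define \<psi> where "\<psi> a b = (\<lambda>a' b'. deformed_mult m K a a' \<boxtimes> deformed_mult n L b b')" for a b
  define \<phi> where "\<phi> a b = tensor_lift ?A ?B (\<psi> a b) (\<Sum>(a, b)\<leftarrow>ys. a \<boxtimes> b)" for a b
  have "bilinear_on ?A ?B (\<psi> a b)" if "a \<in> ?A" "b \<in> ?B" for a b
    using that unfolding bilinear_on_def \<psi>_def
    by (simp add: deformed_mult_add_right deformed_mult_fscale etensor_add etensor_fscale)
  then have \<phi>: "\<phi> a b = (\<Sum>(a', b')\<leftarrow>ys. \<psi> a b a' b')" if "a \<in> ?A" "b \<in> ?B" for a b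
    unfolding \<phi>_def using that ys by (intro tensor_lift_eq fun_subspace_O_SU)
  have "bilinear_on ?A ?B \<phi>"
    unfolding bilinear_on_def
  proof (intro conjI ballI allI)
    fix a a' b b' c assume ab: "a \<in> ?A" "b \<in> ?B" "a' \<in> ?A" "b' \<in> ?B"
    have "\<psi> (a + a') b u v = \<psi> a b u v + \<psi> a' b u v" "\<psi> a (b + b') u v = \<psi> a b u v + \<psi> a b' u v"
      "\<psi> (fscale c a) b u v = fscale c (\<psi> a b u v)" "\<psi> a (fscale c b) u v = fscale c (\<psi> a b u v)"
      if "u \<in> ?A" "v \<in> ?B" for u v
      using ab that by (simp_all add: \<psi>_def deformed_mult_add_left deformed_mult_fscale etensor_add etensor_fscale)
    then have *: "\<psi> (a + a') b (fst p) (snd p) = \<psi> a b (fst p) (snd p) + \<psi> a' b (fst p) (snd p)"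
      "\<psi> a (b + b') (fst p) (snd p) = \<psi> a b (fst p) (snd p) + \<psi> a b' (fst p) (snd p)"
      "\<psi> (fscale c a) b (fst p) (snd p) = fscale c (\<psi> a b (fst p) (snd p))"
      "\<psi> a (fscale c b) (fst p) (snd p) = fscale c (\<psi> a b (fst p) (snd p))" if "p \<in> set ys" for p
      using that ys by (auto simp del: plus_fun_apply)
    show "\<phi> (a + a') b = \<phi> a b + \<phi> a' b" "\<phi> a (b + b') = \<phi> a b + \<phi> a b'"
      "\<phi> (fscale c a) b = fscale c (\<phi> a b)" "\<phi> a (fscale c b) = fscale c (\<phi> a b)"
      using ab by (simp_all only: \<phi> O_SU_closed split_def fscale_sum_list flip: sum_list_addf)
        (intro arg_cong[where f = sum_list] map_cong refl *; assumption)+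
  qed
  from tensor_lift_eq[OF fun_subspace_O_SU fun_subspace_O_SU this xs]
  have "tensor_lift ?A ?B \<phi> (\<Sum>(a, b)\<leftarrow>xs. a \<boxtimes> b) = (\<Sum>(a, b)\<leftarrow>xs. \<phi> a b)" .
  also have "\<dots> = (\<Sum>(a, b)\<leftarrow>xs. \<Sum>(a', b')\<leftarrow>ys. \<psi> a b a' b')"
    by (intro arg_cong[where f = sum_list] map_cong refl) (use xs \<phi> in auto)
  finally show ?thesis by (simp add: tensor_algebra_def \<phi>_def[abs_def] \<psi>_def)
qed

lemma tensor_algebra_distrib:
  assumes "F \<in> carrier tprod" "G \<in> carrier tprod" "H \<in> carrier tprod"
  shows "(F + G) \<otimes>\<^bsub>tprod\<^esub> H = F \<otimes>\<^bsub>tprod\<^esub> H + G \<otimes>\<^bsub>tprod\<^esub> H"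
    and "H \<otimes>\<^bsub>tprod\<^esub> (F + G) = H \<otimes>\<^bsub>tprod\<^esub> F + H \<otimes>\<^bsub>tprod\<^esub> G"
proof -
  let ?s = "\<lambda>xs. \<Sum>(a, b)\<leftarrow>xs. a \<boxtimes> b"
  obtain xs ys zs where x: "set xs \<subseteq> O_SU m \<times> O_SU n" "F = ?s xs"
    and y: "set ys \<subseteq> O_SU m \<times> O_SU n" "G = ?s ys"
    and z: "set zs \<subseteq> O_SU m \<times> O_SU n" "H = ?s zs"
    using assms unfolding tensor_algebra_simps by (elim tensor_spaceE)
  have xy: "set (xs @ ys) \<subseteq> O_SU m \<times> O_SU n" "F + G = ?s (xs @ ys)" using x y by simp_all
  show "(F + G) \<otimes>\<^bsub>tprod\<^esub> H = F \<otimes>\<^bsub>tprod\<^esub> H + G \<otimes>\<^bsub>tprod\<^esub> H"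
    unfolding xy(2) unfolding x(2) y(2) z(2)
      tensor_algebra_mult[OF xy(1) z(1)] tensor_algebra_mult[OF x(1) z(1)] tensor_algebra_mult[OF y(1) z(1)]
    by (simp only: map_append sum_list_append)
  show "H \<otimes>\<^bsub>tprod\<^esub> (F + G) = H \<otimes>\<^bsub>tprod\<^esub> F + H \<otimes>\<^bsub>tprod\<^esub> G"
    unfolding xy(2) unfolding x(2) y(2) z(2)
      tensor_algebra_mult[OF z(1) xy(1)] tensor_algebra_mult[OF z(1) x(1)] tensor_algebra_mult[OF z(1) y(1)]
    by (simp only: map_append sum_list_append split_def sum_list_addf)
qed

lemma tensor_algebra_mult_zero:
  assumes "H \<in> carrier tprod"
  shows "0 \<otimes>\<^bsub>tprod\<^esub> H = 0" "H \<otimes>\<^bsub>tprod\<^esub> 0 = 0"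
  using tensor_algebra_distrib[OF _ _ assms, of 0 0] zero_in_tensor_space[of "O_SU m" "O_SU n"]
  by (simp_all add: tensor_algebra_simps)

end

section \<open>The block embedding of SU(3) in SU(4)\<close>

definition emb :: "complex mat \<Rightarrow> complex mat" where
  "emb U = four_block_mat U (0\<^sub>m 3 1) (0\<^sub>m 1 3) (1\<^sub>m 1)"

lemma SU_carrier: "U \<in> SU n \<Longrightarrow> U \<in> carrier_mat n n"
  by (simp add: SU_def)

lemma emb_carrier: "U \<in> carrier_mat 3 3 \<Longrightarrow> emb U \<in> carrier_mat 4 4"
  using four_block_carrier_mat[of U 3 3 "1\<^sub>m 1" 1 1] by (simp add: emb_def)

lemma emb_index:
  assumes "U \<in> carrier_mat 3 3" "i < 4" "j < 4"
  shows "emb U $$ (i, j) = (if i < 3 \<and> j < 3 then U $$ (i, j) else if i = j then 1 else 0)"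
  using assms by (auto simp: emb_def)

lemma emb_mult:
  assumes "U \<in> carrier_mat 3 3" "V \<in> carrier_mat 3 3"
  shows "emb U * emb V = emb (U * V)"
  unfolding emb_def using assms
  by (subst mult_four_block_mat[of _ 3 3 _ 1 _ 1 _ _ 3 _ 1]) auto

lemma emb_one: "emb (1\<^sub>m 3) = 1\<^sub>m 4"
  by (rule eq_matI) (auto simp: emb_index carrier_matD[OF emb_carrier])

lemma det_emb: "U \<in> carrier_mat 3 3 \<Longrightarrow> det (emb U) = det U"
  unfolding emb_def by (subst det_four_block_mat_upper_right_zero_col[of _ 3]) auto

lemma emb_adjoint:
  assumes "U \<in> carrier_mat 3 3"
  shows "mat_adjoint (emb U) = emb (mat_adjoint U)"
proof (rule eq_matI)
  note c = emb_carrier[OF assms] emb_carrier[OF mat_adjoint_carrier[OF assms]]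
  note c' = mat_adjoint_carrier[OF c(1)]
  show "dim_row (mat_adjoint (emb U)) = dim_row (emb (mat_adjoint U))"
    "dim_col (mat_adjoint (emb U)) = dim_col (emb (mat_adjoint U))"
    using carrier_matD[OF c(2)] carrier_matD[OF c'] by simp_all
  fix i j assume "i < dim_row (emb (mat_adjoint U))" "j < dim_col (emb (mat_adjoint U))"
  then have ij: "i < 4" "j < 4" using carrier_matD[OF c(2)] by simp_all
  show "mat_adjoint (emb U) $$ (i, j) = emb (mat_adjoint U) $$ (i, j)"
    using ij assms mat_adjoint_carrier[OF assms]
    by (auto simp: mat_adjoint_index[OF c(1)] emb_index mat_adjoint_index)
qed

text \<open>The direction from \<open>SU 4\<close> back to \<open>SU 3\<close> is what identifies
  the block found in \<open>SU4_same_last_row\<close> as special unitary.\<close>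

lemma emb_SU_iff:
  assumes "U \<in> carrier_mat 3 3"
  shows "emb U \<in> SU 4 \<longleftrightarrow> U \<in> SU 3"
proof -
  have "emb A = 1\<^sub>m 4 \<longleftrightarrow> A = 1\<^sub>m 3" if "A \<in> carrier_mat 3 3" for A
  proof
    assume *: "emb A = 1\<^sub>m 4"
    show "A = 1\<^sub>m 3"
    proof (rule eq_matI)
      fix i j assume "i < dim_row (1\<^sub>m 3 :: complex mat)" "j < dim_col (1\<^sub>m 3 :: complex mat)"
      then show "A $$ (i, j) = 1\<^sub>m 3 $$ (i, j)"
        using arg_cong[OF *, of "\<lambda>M. M $$ (i, j)"] that by (simp add: emb_index)
    qed (use that in auto)
  qed (simp add: emb_one)
  moreover have "U * mat_adjoint U \<in> carrier_mat 3 3" using assms mat_adjoint_carrier[OF assms] by simp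
  ultimately show ?thesis using assms mat_adjoint_carrier[OF assms]
    by (simp add: SU_def emb_carrier emb_adjoint emb_mult det_emb)
qed

lemma emb_SU: "U \<in> SU 3 \<Longrightarrow> emb U \<in> SU 4"
  using emb_SU_iff SU_carrier by blast

lemma SU_one_mat: "1\<^sub>m n \<in> SU n"
proof -
  have "mat_adjoint (1\<^sub>m n :: complex mat) = 1\<^sub>m n"
    using mat_adjoint_carrier[of "1\<^sub>m n" n n] by (intro eq_matI) (auto simp: mat_adjoint_index[of _ n n])
  then show ?thesis by (simp add: SU_def)
qed

text \<open>Composition with \<open>emb U * V\<close> is the undeformed coaction; here it is seen to
  give the prescribed formula on the first three rows, as the last column of \<open>emb U\<close>
  contributes nothing to them.\<close>

lemma coord_emb_mult:
  assumes "U \<in> SU 3" "V \<in> SU 4" "k \<in> {1..3}" "l \<in> {1..4}"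
  shows "coord 4 k l (emb U * V) = (\<Sum>\<alpha> = 1..3. coord 3 k \<alpha> U * coord 4 \<alpha> l V)"
proof -
  note c = SU_carrier[OF assms(1)] emb_carrier[OF SU_carrier[OF assms(1)]] SU_carrier[OF assms(2)]
  have k: "k - Suc 0 < 3" "l - Suc 0 < 4" using assms by auto
  have "(emb U * V) $$ (k - 1, l - 1) = (\<Sum>i = 0..<4. emb U $$ (k - 1, i) * V $$ (i, l - 1))"
    using c k by (simp add: scalar_prod_def)
  also have "\<dots> = (\<Sum>i = 0..<3. U $$ (k - 1, i) * V $$ (i, l - 1))"
    using k by (simp add: emb_index[OF c(1)] numeral_eq_Suc)
  also have "\<dots> = (\<Sum>\<alpha> = 1..3. coord 3 k \<alpha> U * coord 4 \<alpha> l V)"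
    using assms by (simp add: coord_def numeral_eq_Suc)
  finally show ?thesis using SU_mult_closed[OF emb_SU[OF assms(1)] assms(2)] by (simp add: coord_def)
qed

lemma coord_emb_mult_last_row:
  assumes "U \<in> SU 3" "V \<in> SU 4" "l \<in> {1..4}"
  shows "coord 4 4 l (emb U * V) = coord 4 4 l V"
proof -
  note c = SU_carrier[OF assms(1)] emb_carrier[OF SU_carrier[OF assms(1)]] SU_carrier[OF assms(2)]
  have k: "l - Suc 0 < 4" using assms by auto
  have "(emb U * V) $$ (3, l - 1) = (\<Sum>i = 0..<4. emb U $$ (3, i) * V $$ (i, l - 1))"
    using c k by (simp add: scalar_prod_def)
  also have "\<dots> = V $$ (3, l - 1)"
    by (simp add: emb_index[OF c(1)] numeral_eq_Suc)
  finally show ?thesis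
    using SU_mult_closed[OF emb_SU[OF assms(1)] assms(2)] assms(2) by (simp add: coord_def)
qed

text \<open>The restriction of characters along the torus of the embedded \<open>SU 3\<close>.\<close>

definition bar :: "(nat \<Rightarrow> int) \<Rightarrow> (nat \<Rightarrow> int)" where
  "bar r = (\<lambda>k. r k - r 3)"

lemma bar_add: "bar (\<lambda>k. r k + s k) = (\<lambda>k. bar r k + bar s k)"
  and bar_minus: "bar (\<lambda>k. - r k) = (\<lambda>k. - bar r k)"
  by (auto simp: bar_def)

lemma coord_isotypic_bar:
  assumes "i \<in> {1..3}" "j \<in> {1..3}"
  shows "coord 3 i j \<in> isotypic 3 (bar (coord_weight 4 i), bar (coord_weight 4 j))"
proof -
  have "i \<in> {1, 2, 3}" "j \<in> {1, 2, 3}" using assms by auto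
  then show ?thesis
    by (intro isotypic_cong[OF coord_isotypic[OF assms]]) (auto simp: bar_def coord_weight_def)
qed

text \<open>The torus of the embedded \<open>SU 3\<close> acts trivially on the last row, in
  accordance with the unit as first tensor factor of the image of v_4l.\<close>

lemma bar_coord_weight_last: "bar (coord_weight 4 4) = (\<lambda>_. 0)"
  by (simp add: bar_def coord_weight_def)

text \<open>
  The two occurrences of the middle weight \<open>s\<close> in an expansion make the two middle phases of a
  product cancel.
\<close>

definition expansion ::
  "(nat \<Rightarrow> int) \<Rightarrow> (nat \<Rightarrow> int) \<Rightarrow> (complex mat \<Rightarrow> complex) \<Rightarrow>
   ((nat \<Rightarrow> int) \<times> (complex mat \<Rightarrow> complex) \<times> (complex mat \<Rightarrow> complex)) list \<Rightarrow> bool" where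
  "expansion r q f L \<longleftrightarrow> f \<in> isotypic 4 (r, q) \<and>
     (\<forall>(s, a, b)\<in>set L. a \<in> isotypic 3 (bar r, bar s) \<and> b \<in> isotypic 4 (s, q)) \<and>
     (\<forall>U\<in>SU 3. \<forall>V\<in>SU 4. f (emb U * V) = (\<Sum>(s, a, b)\<leftarrow>L. a U * b V))"

lemma sum_list_product:
  "(\<Sum>p\<leftarrow>List.product xs ys. f p) = (\<Sum>x\<leftarrow>xs. \<Sum>y\<leftarrow>ys. f (x, y))"
  for f :: "'p \<times> 'q \<Rightarrow> 'b :: comm_monoid_add"
  by (induction xs) (simp_all add: comp_def)

lemma sum_list_mult_sum_list:
  "(\<Sum>x\<leftarrow>xs. f x) * (\<Sum>y\<leftarrow>ys. g y) = (\<Sum>x\<leftarrow>xs. \<Sum>y\<leftarrow>ys. f x * g y)"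
  for f g :: "_ \<Rightarrow> 'b :: semiring_0"
  by (simp add: sum_list_const_mult sum_list_mult_const)

lemma expansion_mult:
  assumes L: "expansion r q f L" and L': "expansion r' q' g L'"
  shows "expansion (\<lambda>k. r k + r' k) (\<lambda>k. q k + q' k) (f * g)
    (map (\<lambda>((s, a, b), (s', a', b')). ((\<lambda>k. s k + s' k), a * a', b * b')) (List.product L L'))"
    (is "expansion ?r ?q _ ?L")
proof -
  have "f * g \<in> isotypic 4 (?r, ?q)" using assms by (auto simp: expansion_def intro: isotypic_mult)
  moreover have "a * a' \<in> isotypic 3 (bar ?r, bar (\<lambda>k. s k + s' k)) \<and> b * b' \<in> isotypic 4 (\<lambda>k. s k + s' k, ?q)"
    if "(s, a, b) \<in> set L" "(s', a', b') \<in> set L'" for s a b s' a' b'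
    using assms that unfolding expansion_def bar_add by (auto intro!: isotypic_mult)
  moreover have "(f * g) (emb U * V) = (\<Sum>(s, a, b)\<leftarrow>?L. a U * b V)" if "U \<in> SU 3" "V \<in> SU 4" for U V
    using L L' that
    by (simp add: expansion_def sum_list_mult_sum_list sum_list_product split_def comp_def mult_ac)
  ultimately show ?thesis unfolding expansion_def by (auto simp: split_def)
qed

lemma expansion_fstar:
  assumes L: "expansion r q f L"
  shows "expansion (\<lambda>k. - r k) (\<lambda>k. - q k) (fstar f) (map (\<lambda>(s, a, b). ((\<lambda>k. - s k), fstar a, fstar b)) L)"
    (is "expansion ?r ?q _ ?L")
proof -
  have "fstar f \<in> isotypic 4 (?r, ?q)" using assms by (auto simp: expansion_def intro: isotypic_fstar)
  moreover have "fstar a \<in> isotypic 3 (bar ?r, bar (\<lambda>k. - s k)) \<and> fstar b \<in> isotypic 4 (\<lambda>k. - s k, ?q)"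
    if "(s, a, b) \<in> set L" for s a b
    using assms that unfolding expansion_def bar_minus by (auto intro!: isotypic_fstar)
  moreover have "cnj (\<Sum>(s, a, b)\<leftarrow>L. a U * b V) = (\<Sum>(s, a, b)\<leftarrow>?L. a U * b V)" for U V
    by (induction L) (auto simp: fstar_def)
  then have "fstar f (emb U * V) = (\<Sum>(s, a, b)\<leftarrow>?L. a U * b V)" if "U \<in> SU 3" "V \<in> SU 4" for U V
    using L that by (simp add: expansion_def fstar_def)
  ultimately show ?thesis unfolding expansion_def by (auto simp: split_def)
qed

lemma expansion_fscale:
  assumes L: "expansion r q f L"
  shows "expansion r q (fscale c f) (map (\<lambda>(s, a, b). (s, fscale c a, b)) L)" (is "expansion _ _ _ ?L")
proof -
  have "fscale c f \<in> isotypic 4 (r, q)" using assms by (auto simp: expansion_def intro: isotypic_fscale)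
  moreover have "fscale c a \<in> isotypic 3 (bar r, bar s) \<and> b \<in> isotypic 4 (s, q)"
    if "(s, a, b) \<in> set L" for s a b
    using assms that unfolding expansion_def by (auto intro!: isotypic_fscale)
  moreover have "c * (\<Sum>(s, a, b)\<leftarrow>L. a U * b V) = (\<Sum>(s, a, b)\<leftarrow>?L. a U * b V)" for U V
    by (induction L) (auto simp: fscale_def algebra_simps)
  then have "fscale c f (emb U * V) = (\<Sum>(s, a, b)\<leftarrow>?L. a U * b V)" if "U \<in> SU 3" "V \<in> SU 4" for U V
    using L that by (simp add: expansion_def fscale_def)
  ultimately show ?thesis unfolding expansion_def by (auto simp: split_def)
qed

lemma expansion_SU_one: "expansion (\<lambda>_. 0) (\<lambda>_. 0) (SU_one 4) [(\<lambda>_. 0, SU_one 3, SU_one 4)]"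
  using isotypic_SU_one[of 3] isotypic_SU_one[of 4]
  by (simp add: expansion_def bar_def) (simp add: SU_one_def SU_mult_closed emb_SU)

lemma expansion_coord:
  assumes "k \<in> {1..3}" "l \<in> {1..4}"
  shows "expansion (coord_weight 4 k) (coord_weight 4 l) (coord 4 k l)
    (map (\<lambda>\<alpha>. (coord_weight 4 \<alpha>, coord 3 k \<alpha>, coord 4 \<alpha> l)) [1..<4])"
proof -
  have "(\<Sum>\<alpha>\<leftarrow>[1..<4]. coord 3 k \<alpha> U * coord 4 \<alpha> l V) = (\<Sum>\<alpha> = 1..3. coord 3 k \<alpha> U * coord 4 \<alpha> l V)"
    for U V
    by (simp add: interv_sum_list_conv_sum_set_nat atLeastLessThanSuc_atLeastAtMost numeral_eq_Suc)
  then show ?thesis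
    using assms coord_emb_mult[OF _ _ assms] by (auto simp: expansion_def comp_def intro!: coord_isotypic coord_isotypic_bar)
qed

lemma expansion_coord_last:
  assumes "l \<in> {1..4}"
  shows "expansion (coord_weight 4 4) (coord_weight 4 l) (coord 4 4 l)
    [(coord_weight 4 4, SU_one 3, coord 4 4 l)]"
  using assms coord_emb_mult_last_row[OF _ _ assms] isotypic_SU_one[of 3]
  by (auto simp: expansion_def bar_coord_weight_last SU_one_def intro!: coord_isotypic)

text \<open>Elements with an expansion contain the generators and are closed under products, scalars
  and the involution, so all of \<open>O_SU 4\<close> consists of finite sums of them. Additive
  statements therefore need checking only where the coaction has an explicit homogeneous
  form.\<close>

lemma O_SU4_expansion_induct [consumes 1, case_names zero expansion add]:
  assumes "f \<in> O_SU 4" and "P 0" and "\<And>r q a L. expansion r q a L \<Longrightarrow> P a"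
    and "\<And>f g. f \<in> O_SU 4 \<Longrightarrow> g \<in> O_SU 4 \<Longrightarrow> P f \<Longrightarrow> P g \<Longrightarrow> P (f + g)"
  shows "P f"
proof -
  let ?S = "{f. \<exists>r q L. expansion r q f L}"
  have S: "f \<in> O_SU 4" if "f \<in> ?S" for f
    using that isotypicD by (auto simp: expansion_def)
  have "O_SU 4 \<subseteq> fsums ?S"
    unfolding O_SU_def
  proof (rule star_generated_subset_sums)
    show "{coord 4 i j |i j. i \<in> {1..4} \<and> j \<in> {1..4}} \<subseteq> ?S"
    proof clarify
      fix i j :: nat assume "i \<in> {1..4}" "j \<in> {1..4}"
      note ij = this
      show "\<exists>r q L. expansion r q (coord 4 i j) L"
      proof (cases "i = 4")
        case True
        from expansion_coord_last[OF ij(2)] show ?thesis unfolding True by (intro exI)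
      next
        case False
        with ij have "i \<in> {1..3}" by simp
        from expansion_coord[OF this ij(2)] show ?thesis by (intro exI)
      qed
    qed
    show "?S \<subseteq> carrier (SU_functions 4)"
    proof (intro subsetI, unfold SU_functions_simps, intro CollectI allI impI)
      fix f U assume "f \<in> ?S" "U \<notin> SU 4"
      then show "f U = 0" by (intro SU_zero_outside[OF S])
    qed
    show "SU_one 4 \<in> ?S" using expansion_SU_one by (intro CollectI exI)
    show "a * b \<in> ?S" if ab: "a \<in> ?S" "b \<in> ?S" for a b
    proof -
      from ab obtain r q L r' q' L' where "expansion r q a L" "expansion r' q' b L'" by fast
      from expansion_mult[OF this] show ?thesis by (intro CollectI exI)
    qed
    show "fscale c a \<in> ?S" if "a \<in> ?S" for c a
    proof -
      from that obtain r q L where "expansion r q a L" by fast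
      from expansion_fscale[OF this] show ?thesis by (intro CollectI exI)
    qed
    show "fstar a \<in> ?S" if "a \<in> ?S" for a
    proof -
      from that obtain r q L where "expansion r q a L" by fast
      from expansion_fstar[OF this] show ?thesis by (intro CollectI exI)
    qed
  qed
  then have "f \<in> fsums ?S" using assms(1) by (rule subsetD)
  then have "f \<in> O_SU 4 \<and> P f"
  proof (induction rule: fsums.induct)
    case fsums_zero
    show ?case using assms(2) O_SU_closed(1) by (intro conjI)
  next
    case (fsums_add a x)
    have a: "a \<in> O_SU 4" using S fsums_add(1) .
    from fsums_add(1) obtain r q L where "expansion r q a L" by fast
    then have "P a" by (rule assms(3))
    then show ?case using a fsums_add(3) assms(4) O_SU_closed(3) by blast
  qed
  then show ?thesis ..
qed

section \<open>The twisted coaction\<close>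

lemma torus_zero: "torus n (\<lambda>_. 0) = 1\<^sub>m n"
  by (rule eq_matI) (auto simp: torus_def mat_diag_def)

lemma isotypic_left_torus:
  assumes "a \<in> isotypic n (r, q)" "V \<in> SU n"
  shows "a (torus n \<phi> * V) = cis (2 * pi * (\<Sum>k = 1..<n. of_int (r k) * \<phi> k)) * a V"
proof -
  have "torus n \<phi> * V * torus n (\<lambda>_. 0) = torus n \<phi> * V"
    unfolding torus_zero by (intro right_mult_one_mat[of _ n] SU_carrier SU_mult_closed torus_SU assms(2))
  then show ?thesis using isotypic_torus[OF assms, of \<phi> "\<lambda>_. 0"] by simp
qed

text \<open>Meant to multiply the component of left weight r by a sign. Writing it with translations
  makes sense for every function, so linearity needs no argument about the choice of a
  decomposition; the coefficients are real so that it commutes with \<open>fstar\<close>.\<close>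

definition tw :: "(real \<times> (nat \<Rightarrow> real)) list \<Rightarrow> (complex mat \<Rightarrow> complex) \<Rightarrow> (complex mat \<Rightarrow> complex)" where
  "tw T f = (\<lambda>V. if V \<in> SU 4 then \<Sum>(c, \<phi>)\<leftarrow>T. of_real c * f (torus 4 \<phi> * V) else 0)"

definition left_translate :: "complex mat \<Rightarrow> (complex mat \<Rightarrow> complex) \<Rightarrow> (complex mat \<Rightarrow> complex)" where
  "left_translate U f = (\<lambda>V. if V \<in> SU 4 then f (emb U * V) else 0)"

text \<open>As \<open>tw T\<close> will be its own inverse on \<open>O_SU 4\<close>, each slice is
  the translation by U conjugated with the twist.\<close>

definition twisted_coaction :: "(real \<times> (nat \<Rightarrow> real)) list \<Rightarrow> (complex mat \<Rightarrow> complex) \<Rightarrow>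
    (complex mat \<times> complex mat \<Rightarrow> complex)" where
  "twisted_coaction T f = (\<lambda>(U, V). if U \<in> SU 3 then tw T (left_translate U (tw T f)) V else 0)"

lemma tw_add: "tw T (f + g) = tw T f + tw T g"
proof
  show "tw T (f + g) V = (tw T f + tw T g) V" for V
    by (simp add: tw_def split_def distrib_left sum_list_addf)
qed

lemma tw_fscale: "tw T (fscale c f) = fscale c (tw T f)"
proof
  show "tw T (fscale c f) V = fscale c (tw T f) V" for V
    by (simp add: tw_def fscale_def split_def mult.left_commute flip: sum_list_const_mult)
qed

lemma tw_zero: "tw T 0 = 0"
  using tw_fscale[of T 0 0] by simp

lemma tw_fstar: "tw T (fstar f) = fstar (tw T f)"
proof
  have "cnj (\<Sum>p\<leftarrow>T. g p) = (\<Sum>p\<leftarrow>T. cnj (g p))" for g :: "real \<times> (nat \<Rightarrow> real) \<Rightarrow> complex"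
    by (induction T) auto
  then show "tw T (fstar f) V = fstar (tw T f) V" for V
    by (simp add: tw_def fstar_def split_def)
qed

lemma left_translate_add: "left_translate U (f + g) = left_translate U f + left_translate U g"
  and left_translate_fscale: "left_translate U (fscale c f) = fscale c (left_translate U f)"
  and left_translate_fstar: "left_translate U (fstar f) = fstar (left_translate U f)"
  by (auto simp: left_translate_def fscale_def fstar_def fun_eq_iff)

lemma left_translate_zero: "left_translate U 0 = 0"
  using left_translate_fscale[of U 0 0] by simp

text \<open>The order of the factors is reversed, which is what coassociativity with
  \<open>comult\<close> requires.\<close>

lemma left_translate_mult:
  assumes "U \<in> SU 3" "U' \<in> SU 3"
  shows "left_translate U' (left_translate U f) = left_translate (U * U') f"
proof
  fix V
  have "emb U * (emb U' * V) = emb (U * U') * V" if "V \<in> SU 4"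
  proof -
    have "emb U * (emb U' * V) = emb U * emb U' * V"
      using that assms by (intro assoc_mult_mat[symmetric, of _ 4 4 _ 4 _ 4] SU_carrier emb_SU)
    then show ?thesis using assms by (simp add: emb_mult SU_carrier)
  qed
  then show "left_translate U' (left_translate U f) V = left_translate (U * U') f V"
    using assms by (simp add: left_translate_def SU_mult_closed emb_SU)
qed

lemma left_translate_expansion:
  assumes "expansion r q f L" "U \<in> SU 3"
  shows "left_translate U f = (\<Sum>(s, a, b)\<leftarrow>L. fscale (a U) b)"
proof
  fix V
  show "left_translate U f V = (\<Sum>(s, a, b)\<leftarrow>L. fscale (a U) b) V"
  proof (cases "V \<in> SU 4")
    case True
    then show ?thesis using assms
      by (simp add: left_translate_def expansion_def sum_list_fun_apply split_def fscale_def)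
  next
    case False
    then have "a U * b V = 0" if "(s, a, b) \<in> set L" for s a b
      using that assms SU_zero_outside[of b 4 V] by (auto simp: expansion_def dest!: isotypicD)
    then have "(\<Sum>(s, a, b)\<leftarrow>L. a U * b V) = (\<Sum>(s, a, b)\<leftarrow>L. 0)"
      by (intro arg_cong[where f = sum_list] map_cong) auto
    then show ?thesis using False
      by (simp add: left_translate_def sum_list_fun_apply split_def fscale_def)
  qed
qed

lemma sum_list_O_SU: "(\<And>p. p \<in> set xs \<Longrightarrow> f p \<in> O_SU n) \<Longrightarrow> (\<Sum>p\<leftarrow>xs. f p) \<in> O_SU n"
  by (rule fun_subspace_sum_list[OF fun_subspace_O_SU])

lemma left_translate_O_SU:
  assumes "f \<in> O_SU 4" "U \<in> SU 3"
  shows "left_translate U f \<in> O_SU 4"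
  using assms(1)
proof (induction rule: O_SU4_expansion_induct[where P = "\<lambda>f. left_translate U f \<in> O_SU 4"])
  case zero
  show ?case unfolding left_translate_zero by (rule O_SU_closed)
next
  case (expansion r q a L)
  show ?case unfolding left_translate_expansion[OF expansion assms(2)]
    using expansion by (intro sum_list_O_SU) (auto simp: expansion_def intro!: O_SU_closed dest: isotypicD)
next
  case (add f g)
  then show ?case unfolding left_translate_add by (intro O_SU_closed)
qed

lemma twisted_coaction_add: "twisted_coaction T (f + g) = twisted_coaction T f + twisted_coaction T g"
proof (rule ext, clarify)
  show "twisted_coaction T (f + g) (U, V) = (twisted_coaction T f + twisted_coaction T g) (U, V)" for U V
    unfolding twisted_coaction_def tw_add left_translate_add by simp
qed

lemma twisted_coaction_fscale: "twisted_coaction T (fscale c f) = fscale c (twisted_coaction T f)"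
proof (rule ext, clarify)
  show "twisted_coaction T (fscale c f) (U, V) = fscale c (twisted_coaction T f) (U, V)" for U V
    unfolding twisted_coaction_def tw_fscale left_translate_fscale by (simp add: fscale_def)
qed

lemma twisted_coaction_zero: "twisted_coaction T 0 = 0"
  using twisted_coaction_fscale[of T 0 0] by simp

lemma twisted_coaction_fstar: "twisted_coaction T (fstar f) = fstar (twisted_coaction T f)"
proof (rule ext, clarify)
  show "twisted_coaction T (fstar f) (U, V) = fstar (twisted_coaction T f) (U, V)" for U V
    unfolding twisted_coaction_def tw_fstar left_translate_fstar by (simp add: fstar_def)
qed

lemma linear_sum_list:
  assumes "h 0 = 0" "\<And>f g. h (f + g) = h f + h g"
  shows "h (\<Sum>p\<leftarrow>xs. f p) = (\<Sum>p\<leftarrow>xs. h (f p))"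
proof (induction xs)
  case Nil
  show ?case by (simp only: list.map sum_list.Nil assms)
next
  case (Cons p xs)
  then show ?case by (simp only: list.map sum_list.Cons assms)
qed

section \<open>The sign twist and the action built from it\<close>

abbreviation SU3_form :: "real \<Rightarrow> nat \<Rightarrow> nat \<Rightarrow> real" where
  "SU3_form \<theta> \<equiv> (\<lambda>i j. if (i, j) = (1, 2) then \<theta> else if (i, j) = (2, 1) then - \<theta> else 0)"

text \<open>By \<open>phase\<close>, the bicharacter of \<open>lam\<close> and that of \<theta>
  pulled back along \<open>bar\<close> differ by the coboundary of \<sigma>; \<open>T_sum\<close>
  realises \<sigma> by torus translations. \<open>\<sigma>_coord_weight\<close> preserves the
  formula for the first three rows. On the weight of the last row the sign may be -1, but there it
  occurs twice and cancels.\<close>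

locale SU_twist =
  fixes \<theta> :: real and lam :: "nat \<Rightarrow> nat \<Rightarrow> real"
    and T :: "(real \<times> (nat \<Rightarrow> real)) list" and \<sigma> :: "(nat \<Rightarrow> int) \<Rightarrow> real"
  assumes T_sum: "(\<Sum>(c, \<phi>)\<leftarrow>T. of_real c * cis (2 * pi * (\<Sum>k = 1..<4. of_int (r k) * \<phi> k))) = of_real (\<sigma> r)"
    and \<sigma>_square: "\<sigma> r * \<sigma> r = 1"
    and \<sigma>_coord_weight: "i \<in> {1..3} \<Longrightarrow> \<sigma> (coord_weight 4 i) = 1"
    and phase: "cis (pi * torus_form 4 lam r r') * of_real (\<sigma> (\<lambda>k. r k + r' k)) =
      of_real (\<sigma> r * \<sigma> r') * cis (pi * torus_form 3 (SU3_form \<theta>) (bar r) (bar r'))"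
begin

abbreviation "\<rho> \<equiv> twisted_coaction T"

lemma tw_isotypic:
  assumes "a \<in> isotypic 4 (r, q)"
  shows "tw T a = fscale (of_real (\<sigma> r)) a"
proof
  fix V
  show "tw T a V = fscale (of_real (\<sigma> r)) a V"
  proof (cases "V \<in> SU 4")
    case True
    have "tw T a V = (\<Sum>(c, \<phi>)\<leftarrow>T. of_real c * cis (2 * pi * (\<Sum>k = 1..<4. of_int (r k) * \<phi> k))) * a V"
      using True by (simp add: tw_def isotypic_left_torus[OF assms] split_def mult.assoc flip: sum_list_mult_const)
    then show ?thesis unfolding T_sum by (simp add: fscale_def)
  next
    case False
    then show ?thesis using SU_zero_outside[OF isotypicD[OF assms]] by (simp add: tw_def fscale_def)
  qed
qed

lemma tw_O_SU: "f \<in> O_SU 4 \<Longrightarrow> tw T f \<in> O_SU 4"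
proof (induction rule: O_SU_isotypic_induct[where P = "\<lambda>f. tw T f \<in> O_SU 4"])
  case zero
  show ?case unfolding tw_zero by (rule O_SU_closed)
next
  case (isotypic r q a)
  then show ?case unfolding tw_isotypic[OF isotypic] by (intro O_SU_closed isotypicD)
next
  case (add f g)
  then show ?case unfolding tw_add by (intro O_SU_closed)
qed

lemma tw_tw: "f \<in> O_SU 4 \<Longrightarrow> tw T (tw T f) = f"
proof (induction rule: O_SU_isotypic_induct[where P = "\<lambda>f. tw T (tw T f) = f"])
  case zero
  show ?case by (simp only: tw_zero)
next
  case (isotypic r q a)
  show ?case unfolding tw_isotypic[OF isotypic] tw_fscale
    by (simp add: \<sigma>_square flip: of_real_mult)
next
  case (add f g)
  then show ?case by (simp only: tw_add)
qed

text \<open>The inner twist acts on f and sees its left weight r; the outer one acts on the factors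
  b and sees their left weights s.\<close>

lemma \<rho>_expansion:
  assumes L: "expansion r q f L"
  shows "\<rho> f = (\<Sum>(s, a, b)\<leftarrow>L. fscale (of_real (\<sigma> r * \<sigma> s)) a \<boxtimes> b)"
proof (rule ext, clarify)
  fix U V
  have f: "f \<in> isotypic 4 (r, q)" using L by (simp add: expansion_def)
  show "\<rho> f (U, V) = (\<Sum>(s, a, b)\<leftarrow>L. fscale (of_real (\<sigma> r * \<sigma> s)) a \<boxtimes> b) (U, V)"
  proof (cases "U \<in> SU 3")
    case True
    have b: "b \<in> isotypic 4 (s, q)" if "(s, a, b) \<in> set L" for s a b
      using L that by (auto simp: expansion_def)
    have "tw T (left_translate U (tw T f)) =
        tw T (fscale (of_real (\<sigma> r)) (\<Sum>p\<leftarrow>L. fscale (fst (snd p) U) (snd (snd p))))"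
      unfolding tw_isotypic[OF f] left_translate_fscale left_translate_expansion[OF L True] split_def ..
    also have "\<dots> = fscale (of_real (\<sigma> r)) (\<Sum>p\<leftarrow>L. tw T (fscale (fst (snd p) U) (snd (snd p))))"
      unfolding tw_fscale[of T "of_real (\<sigma> r)"] by (subst linear_sum_list[of "tw T", OF tw_zero tw_add]) (rule refl)
    also have "\<dots> = fscale (of_real (\<sigma> r)) (\<Sum>p\<leftarrow>L. fscale (fst (snd p) U * of_real (\<sigma> (fst p))) (snd (snd p)))"
      using b by (intro arg_cong[where f = "fscale _"] arg_cong[where f = sum_list] map_cong refl)
        (clarsimp simp: tw_fscale tw_isotypic[OF b])
    finally have *: "tw T (left_translate U (tw T f)) =
      fscale (of_real (\<sigma> r)) (\<Sum>p\<leftarrow>L. fscale (fst (snd p) U * of_real (\<sigma> (fst p))) (snd (snd p)))" .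
    show ?thesis using True
      by (simp add: twisted_coaction_def * sum_list_fun_apply fscale_def etensor_def split_def mult_ac
          flip: sum_list_const_mult)
  next
    case False
    then have "a U = 0" if "(s, a, b) \<in> set L" for s a b
      using that L SU_zero_outside[of a 3 U] by (auto simp: expansion_def dest!: isotypicD)
    then have "(\<Sum>(s, a, b)\<leftarrow>L. of_real (\<sigma> r * \<sigma> s) * a U * b V) = (\<Sum>(s, a, b)\<leftarrow>L. 0)"
      by (intro arg_cong[where f = sum_list] map_cong) auto
    then show ?thesis using False
      by (simp add: twisted_coaction_def sum_list_fun_apply fscale_def etensor_def split_def)
  qed
qed

lemma \<rho>_expansion_list:
  assumes L: "expansion r q f L"
  defines "xs \<equiv> map (\<lambda>(s, a, b). (fscale (of_real (\<sigma> r * \<sigma> s)) a, b)) L"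
  shows "\<rho> f = (\<Sum>(a, b)\<leftarrow>xs. a \<boxtimes> b)" and "set xs \<subseteq> O_SU 3 \<times> O_SU 4"
proof -
  show "\<rho> f = (\<Sum>(a, b)\<leftarrow>xs. a \<boxtimes> b)"
    unfolding \<rho>_expansion[OF L] xs_def by (simp only: map_map split_def comp_def fst_conv snd_conv)
  show "set xs \<subseteq> O_SU 3 \<times> O_SU 4"
    using L unfolding xs_def expansion_def by (auto intro!: O_SU_closed dest: isotypicD)
qed

lemma \<rho>_tensor_space: "f \<in> O_SU 4 \<Longrightarrow> \<rho> f \<in> tensor_space (O_SU 3) (O_SU 4)"
proof (induction rule: O_SU4_expansion_induct[where P = "\<lambda>f. \<rho> f \<in> tensor_space (O_SU 3) (O_SU 4)"])
  case zero
  show ?case unfolding twisted_coaction_zero by (rule zero_in_tensor_space)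
next
  case (expansion r q a L)
  show ?case unfolding \<rho>_expansion_list(1)[OF expansion] by (rule tensor_spaceI, rule \<rho>_expansion_list(2)[OF expansion])
next
  case (add f g)
  then show ?case unfolding twisted_coaction_add by (intro tensor_space_add)
qed

text \<open>Each phase is a row bicharacter divided by a column bicharacter. The column weights q,
  q' contribute the same factor on both sides. The middle weights are column weights for
  \<open>SU 3\<close> and row weights for \<open>SU 4\<close>, so their bicharacters appear as a
  quotient, which \<open>phase\<close> reduces to signs; \<open>phase\<close> for r, r' accounts for
  the rest.\<close>

lemma phase_balance:
  "deform_phase 4 lam (r, q) (r', q') * of_real (\<sigma> (\<lambda>k. r k + r' k) * \<sigma> (\<lambda>k. s k + s' k)) =
   of_real (\<sigma> r * \<sigma> s) * of_real (\<sigma> r' * \<sigma> s') *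
   (deform_phase 3 (SU3_form \<theta>) (bar r, bar s) (bar r', bar s') * deform_phase 4 lam (s, q) (s', q'))"
proof -
  define F4 where "F4 x y = cis (pi * torus_form 4 lam x y)" for x y
  define F3 where "F3 x y = cis (pi * torus_form 3 (SU3_form \<theta>) (bar x) (bar y))" for x y
  let ?\<sigma> = "\<lambda>r. complex_of_real (\<sigma> r)"
  have nz: "F4 x y \<noteq> 0" "F3 x y \<noteq> 0" for x y by (simp_all add: F4_def F3_def)
  have sq: "?\<sigma> x * ?\<sigma> x = 1" for x by (simp add: \<sigma>_square flip: of_real_mult)
  have cis_diff: "cis (pi * (x - y)) = cis (pi * x) / cis (pi * y)" for x y
    by (simp add: cis_divide right_diff_distrib)
  have dp4: "deform_phase 4 lam (x, z) (x', z') = F4 x x' / F4 z z'" for x x' z z'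
    by (simp add: deform_phase_def F4_def cis_diff)
  have dp3: "deform_phase 3 (SU3_form \<theta>) (bar x, bar z) (bar x', bar z') = F3 x x' / F3 z z'" for x x' z z'
    by (simp only: deform_phase_def prod.case F3_def cis_diff)
  have p: "F4 x y * ?\<sigma> (\<lambda>k. x k + y k) = ?\<sigma> x * ?\<sigma> y * F3 x y" for x y
    using phase[of x y] by (simp add: F4_def F3_def)
  \<comment> \<open>This is \<open>phase\<close> at (s, s') read in the other direction, which is
    possible because the signs are their own inverses.\<close>
  have "F3 s s' * ?\<sigma> (\<lambda>k. s k + s' k) = ?\<sigma> s * ?\<sigma> s' * F4 s s'"
  proof -
    have "F3 s s' * ?\<sigma> (\<lambda>k. s k + s' k) =
        (?\<sigma> s * ?\<sigma> s) * (?\<sigma> s' * ?\<sigma> s') * F3 s s' * ?\<sigma> (\<lambda>k. s k + s' k)" by (simp add: sq)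
    also have "\<dots> = ?\<sigma> s * ?\<sigma> s' * (?\<sigma> s * ?\<sigma> s' * F3 s s') * ?\<sigma> (\<lambda>k. s k + s' k)" by (simp only: mult_ac)
    also have "\<dots> = ?\<sigma> s * ?\<sigma> s' * F4 s s' * (?\<sigma> (\<lambda>k. s k + s' k) * ?\<sigma> (\<lambda>k. s k + s' k))"
      unfolding p[symmetric] by (simp only: mult_ac)
    finally show ?thesis by (simp add: sq)
  qed
  then have s: "?\<sigma> (\<lambda>k. s k + s' k) = ?\<sigma> s * ?\<sigma> s' * F4 s s' / F3 s s'" using nz by (simp add: field_simps)
  have r: "?\<sigma> (\<lambda>k. r k + r' k) = ?\<sigma> r * ?\<sigma> r' * F3 r r' / F4 r r'" using p[of r r'] nz by (simp add: field_simps)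
  show ?thesis unfolding dp4 dp3 of_real_mult r s using nz by (simp add: field_simps)
qed

lemma \<rho>_mult_expansion:
  assumes L: "expansion r q f L" and L': "expansion r' q' g L'"
  shows "\<rho> (deformed_mult 4 lam f g) =
    \<rho> f \<otimes>\<^bsub>tensor_algebra (SU3 \<theta>) (SU4 lam)\<^esub> \<rho> g"
proof -
  let ?xs = "\<lambda>r L. map (\<lambda>(s, a, b). (fscale (of_real (\<sigma> r * \<sigma> s)) a, b)) L"
  have fg: "f \<in> isotypic 4 (r, q)" "g \<in> isotypic 4 (r', q')" using L L' by (auto simp: expansion_def)
  let ?p = "deform_phase 4 lam (r, q) (r', q')"
  have "\<rho> (deformed_mult 4 lam f g) = fscale ?p (\<rho> (f * g))"
    unfolding deformed_mult_isotypic[OF fg] twisted_coaction_fscale ..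
  also have "\<dots> = (\<Sum>(s, a, b)\<leftarrow>L. \<Sum>(s', a', b')\<leftarrow>L'.
      fscale (?p * of_real (\<sigma> (\<lambda>k. r k + r' k) * \<sigma> (\<lambda>k. s k + s' k))) ((a * a') \<boxtimes> (b * b')))"
    unfolding \<rho>_expansion[OF expansion_mult[OF L L']]
    by (simp add: sum_list_product fscale_sum_list split_def comp_def etensor_fscale)
  also have "\<dots> = (\<Sum>(s, a, b)\<leftarrow>L. \<Sum>(s', a', b')\<leftarrow>L'.
      deformed_mult 3 (SU3_form \<theta>) (fscale (of_real (\<sigma> r * \<sigma> s)) a) (fscale (of_real (\<sigma> r' * \<sigma> s')) a') \<boxtimes>
      deformed_mult 4 lam b b')"
  proof -
    have *: "fscale (?p * of_real (\<sigma> (\<lambda>k. r k + r' k) * \<sigma> (\<lambda>k. s k + s' k))) ((a * a') \<boxtimes> (b * b')) =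
      deformed_mult 3 (SU3_form \<theta>) (fscale (of_real (\<sigma> r * \<sigma> s)) a) (fscale (of_real (\<sigma> r' * \<sigma> s')) a') \<boxtimes>
      deformed_mult 4 lam b b'" if "(s, a, b) \<in> set L" "(s', a', b') \<in> set L'" for s a b s' a' b'
    proof -
      have m: "a \<in> isotypic 3 (bar r, bar s)" "b \<in> isotypic 4 (s, q)"
        "a' \<in> isotypic 3 (bar r', bar s')" "b' \<in> isotypic 4 (s', q')"
        using that L L' by (auto simp: expansion_def)
      show ?thesis unfolding phase_balance
          deformed_mult_isotypic[OF isotypic_fscale[OF m(1)] isotypic_fscale[OF m(3)]]
          deformed_mult_isotypic[OF m(2) m(4)]
        by (simp only: etensor_fscale fscale_simps mult_ac)
    qed
    show ?thesis
      by (intro arg_cong[where f = sum_list] map_cong refl) (auto simp only: split: prod.splits intro!: arg_cong[where f = sum_list] map_cong *)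
  qed
  also have "\<dots> = (\<Sum>(a, b)\<leftarrow>?xs r L. \<Sum>(a', b')\<leftarrow>?xs r' L'.
      deformed_mult 3 (SU3_form \<theta>) a a' \<boxtimes> deformed_mult 4 lam b b')"
    by (simp only: map_map split_def comp_def fst_conv snd_conv)
  also have "\<dots> = \<rho> f \<otimes>\<^bsub>tensor_algebra (SU3 \<theta>) (SU4 lam)\<^esub> \<rho> g"
    unfolding \<rho>_expansion_list(1)[OF L] \<rho>_expansion_list(1)[OF L'] SU3_def
    by (rule tensor_algebra_mult[OF \<rho>_expansion_list(2)[OF L] \<rho>_expansion_list(2)[OF L'], symmetric])
  finally show ?thesis .
qed

lemma \<rho>_mult:
  assumes "f \<in> O_SU 4" "g \<in> O_SU 4"
  shows "\<rho> (deformed_mult 4 lam f g) = \<rho> f \<otimes>\<^bsub>tensor_algebra (SU3 \<theta>) (SU4 lam)\<^esub> \<rho> g"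
proof -
  let ?m = "\<lambda>F G. F \<otimes>\<^bsub>tensor_algebra (SU3 \<theta>) (SU4 lam)\<^esub> G"
  have c: "\<rho> f \<in> carrier (tensor_algebra (SU3 \<theta>) (SU4 lam))" if "f \<in> O_SU 4" for f
    using \<rho>_tensor_space[OF that] by (simp add: tensor_algebra_simps SU3_def)
  note distrib = tensor_algebra_distrib[of _ 3 "SU3_form \<theta>" 4 lam, folded SU3_def]
  note mult_zero = tensor_algebra_mult_zero[of _ 3 "SU3_form \<theta>" 4 lam, folded SU3_def]
  have 1: "\<rho> (deformed_mult 4 lam a g) = ?m (\<rho> a) (\<rho> g)" if a: "expansion r q a L" for r q a L
    using assms(2)
  proof (induction rule: O_SU4_expansion_induct[where P = "\<lambda>g. \<rho> (deformed_mult 4 lam a g) = ?m (\<rho> a) (\<rho> g)"])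
    case zero
    have "a \<in> O_SU 4" using a isotypicD by (auto simp: expansion_def)
    then show ?case unfolding twisted_coaction_zero deformed_mult_zero(2)[OF \<open>a \<in> O_SU 4\<close>] mult_zero(2)[OF c[OF \<open>a \<in> O_SU 4\<close>]] by simp
  next
    case (expansion r' q' b L')
    show ?case by (rule \<rho>_mult_expansion[OF a expansion])
  next
    case (add g h)
    have a': "a \<in> O_SU 4" using a isotypicD by (auto simp: expansion_def)
    show ?case unfolding deformed_mult_add_right[OF add(1,2) a'] twisted_coaction_add
        distrib(2)[OF c[OF add(1)] c[OF add(2)] c[OF a']] add(3,4) ..
  qed
  show ?thesis using assms(1)
  proof (induction rule: O_SU4_expansion_induct[where P = "\<lambda>f. \<rho> (deformed_mult 4 lam f g) = ?m (\<rho> f) (\<rho> g)"])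
    case zero
    show ?case unfolding twisted_coaction_zero deformed_mult_zero(1)[OF assms(2)] mult_zero(1)[OF c[OF assms(2)]] by (rule refl)
  next
    case (expansion r q a L)
    show ?case by (rule 1[OF expansion])
  next
    case (add f h)
    show ?case unfolding deformed_mult_add_left[OF add(1,2) assms(2)] twisted_coaction_add
        distrib(1)[OF c[OF add(1)] c[OF add(2)] c[OF assms(2)]] add(3,4) ..
  qed
qed

lemma of_real_\<sigma>_square: "complex_of_real (\<sigma> r) * of_real (\<sigma> r) = 1"
  by (simp add: \<sigma>_square flip: of_real_mult)

lemma \<rho>_SU_one: "\<rho> (SU_one 4) = SU_one 3 \<boxtimes> SU_one 4"
  unfolding \<rho>_expansion[OF expansion_SU_one] by (simp add: of_real_\<sigma>_square)

lemma \<rho>_coord: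
  assumes "k \<in> {1..3}" "l \<in> {1..4}"
  shows "\<rho> (coord 4 k l) = (\<Sum>\<alpha> = 1..3. coord 3 k \<alpha> \<boxtimes> coord 4 \<alpha> l)"
proof -
  have "\<rho> (coord 4 k l) = (\<Sum>\<alpha>\<leftarrow>[1..<4]. coord 3 k \<alpha> \<boxtimes> coord 4 \<alpha> l)"
    unfolding \<rho>_expansion[OF expansion_coord[OF assms]] map_map comp_def prod.case
    by (intro arg_cong[where f = sum_list] map_cong refl) (use assms in \<open>simp add: \<sigma>_coord_weight\<close>)
  also have "\<dots> = (\<Sum>\<alpha> = 1..3. coord 3 k \<alpha> \<boxtimes> coord 4 \<alpha> l)"
    using atLeastLessThanSuc_atLeastAtMost[of 1 3] by (simp only: interv_sum_list_conv_sum_set_nat set_upt) simp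
  finally show ?thesis .
qed

lemma \<rho>_coord_last: "l \<in> {1..4} \<Longrightarrow> \<rho> (coord 4 4 l) = SU_one 3 \<boxtimes> coord 4 4 l"
  unfolding \<rho>_expansion[OF expansion_coord_last] by (simp add: of_real_\<sigma>_square)

lemma \<rho>_slice:
  assumes "f \<in> O_SU 4" "U \<in> SU 3"
  shows "(\<lambda>V. \<rho> f (U, V)) = tw T (left_translate U (tw T f))"
  using assms by (simp add: twisted_coaction_def)

text \<open>Between the two translations the outer twist of the first coaction meets the inner twist
  of the second, and they cancel by \<open>tw_tw\<close>.\<close>

lemma \<rho>_coassoc:
  assumes f: "f \<in> O_SU 4" and U: "U \<in> SU 3" "U' \<in> SU 3"
  shows "\<rho> (\<lambda>X. \<rho> f (U, X)) (U', V) = \<rho> f (U * U', V)"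
proof -
  have "tw T (tw T (left_translate U (tw T f))) = left_translate U (tw T f)"
    by (intro tw_tw left_translate_O_SU tw_O_SU f U)
  then show ?thesis
    unfolding \<rho>_slice[OF f U(1)] unfolding twisted_coaction_def
    by (simp add: U SU_mult_closed left_translate_mult)
qed

lemma \<rho>_counit:
  assumes "f \<in> O_SU 4"
  shows "\<rho> f (1\<^sub>m 3, V) = f V"
proof -
  have "left_translate (1\<^sub>m 3) (tw T f) = tw T f"
  proof
    fix V
    have "1\<^sub>m 4 * V = V" if "V \<in> SU 4" using SU_carrier[OF that] by simp
    then show "left_translate (1\<^sub>m 3) (tw T f) V = tw T f V"
      by (auto simp: left_translate_def emb_one tw_def)
  qed
  then show ?thesis using tw_tw[OF assms] by (simp add: twisted_coaction_def SU_one_mat)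
qed

text \<open>Elements of the tensor product are genuine functions of (U, V). Once the lifts are
  evaluated on some presentation of \<rho> f, the axioms become the pointwise identities
  \<open>\<rho>_coassoc\<close> and \<open>\<rho>_counit\<close>.\<close>

lemma left_action_\<rho>: "left_action (SU3 \<theta>) (comult 3) (counit 3) (SU4 lam) \<rho>"
proof -
  let ?H = "O_SU 3" and ?A = "O_SU 4"
  have sub: "fun_subspace ?H" "fun_subspace ?A" by (rule fun_subspace_O_SU)+
  have car: "carrier (SU3 \<theta>) = ?H" "carrier (SU4 lam) = ?A" by (simp_all add: SU3_def)
  have "\<rho> \<in> alg_hom (SU4 lam) (tensor_algebra (SU3 \<theta>) (SU4 lam))"
  proof -
    note t = tensor_algebra_simps[of 3 "SU3_form \<theta>" 4 lam, folded SU3_def]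
    have "\<rho> \<in> Ring.ring_hom (SU4 lam) (tensor_algebra (SU3 \<theta>) (SU4 lam))"
    proof (rule ring_hom_memI; unfold t SU_deformed_simps)
      fix f g assume "f \<in> ?A" "g \<in> ?A"
      then show "\<rho> (deformed_mult 4 lam f g) = \<rho> f \<otimes>\<^bsub>tensor_algebra (SU3 \<theta>) (SU4 lam)\<^esub> \<rho> g"
        by (rule \<rho>_mult)
    qed (rule \<rho>_tensor_space \<rho>_SU_one twisted_coaction_add; assumption?)+
    then show ?thesis
      unfolding alg_hom_def t SU_deformed_simps by (simp add: twisted_coaction_fscale)
  qed
  moreover have "tensor_map ?H ?A (comult 3) (\<lambda>b. b) (\<rho> f) = tensor_assoc (tensor_map ?H ?A (\<lambda>h. h) \<rho> (\<rho> f))"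
    if f: "f \<in> ?A" for f
  proof -
    obtain xs where xs: "set xs \<subseteq> ?H \<times> ?A" and F: "\<rho> f = (\<Sum>(a, b)\<leftarrow>xs. a \<boxtimes> b)"
      using \<rho>_tensor_space[OF f] by (elim tensor_spaceE)
    have "bilinear_on ?H ?A (\<lambda>a b. comult 3 a \<boxtimes> b)"
      unfolding bilinear_on_def
      by (auto simp: comult_def etensor_def fscale_def fun_eq_iff algebra_simps)
    then have 1: "tensor_map ?H ?A (comult 3) (\<lambda>b. b) (\<rho> f) = (\<Sum>(a, b)\<leftarrow>xs. comult 3 a \<boxtimes> b)"
      unfolding tensor_map_def F using xs by (intro tensor_lift_eq sub)
    have "bilinear_on ?H ?A (\<lambda>a b. a \<boxtimes> \<rho> b)"
      unfolding bilinear_on_def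
      by (simp add: twisted_coaction_add twisted_coaction_fscale etensor_add etensor_fscale)
    then have 2: "tensor_map ?H ?A (\<lambda>h. h) \<rho> (\<rho> f) = (\<Sum>(a, b)\<leftarrow>xs. a \<boxtimes> \<rho> b)"
      unfolding tensor_map_def F using xs by (intro tensor_lift_eq sub)
    \<comment> \<open>By linearity, applying \<rho> in the second factor and evaluating the first
      factor at U amounts to applying \<rho> to the slice at U.\<close>
    have slice: "(\<Sum>p\<leftarrow>xs. fst p U * \<rho> (snd p) W) = \<rho> (\<lambda>X. \<rho> f (U, X)) W" for U W
    proof -
      have "(\<lambda>X. \<rho> f (U, X)) = (\<Sum>p\<leftarrow>xs. fscale (fst p U) (snd p))"
        by (rule ext) (simp add: F sum_list_fun_apply split_def etensor_apply fscale_def)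
      then have "\<rho> (\<lambda>X. \<rho> f (U, X)) = \<rho> (\<Sum>p\<leftarrow>xs. fscale (fst p U) (snd p))" by (rule arg_cong)
      also have "\<dots> = (\<Sum>p\<leftarrow>xs. fscale (fst p U) (\<rho> (snd p)))"
        by (subst linear_sum_list[of \<rho>, OF twisted_coaction_zero twisted_coaction_add])
          (simp only: twisted_coaction_fscale)
      finally show ?thesis by (simp add: sum_list_fun_apply fscale_def)
    qed
    show ?thesis
    proof (rule ext, clarify)
      fix U U' V
      have L: "tensor_map ?H ?A (comult 3) (\<lambda>b. b) (\<rho> f) ((U, U'), V) =
          (if U \<in> SU 3 \<and> U' \<in> SU 3 then \<rho> f (U * U', V) else 0)"
        unfolding 1 unfolding F by (auto simp: sum_list_fun_apply split_def etensor_apply comult_def)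
      have R: "tensor_assoc (tensor_map ?H ?A (\<lambda>h. h) \<rho> (\<rho> f)) ((U, U'), V) =
          \<rho> (\<lambda>X. \<rho> f (U, X)) (U', V)"
        unfolding 2 slice[symmetric] by (simp add: tensor_assoc_def sum_list_fun_apply split_def etensor_apply)
      \<comment> \<open>Functions are extended by zero, so arguments outside the group are compared
        separately.\<close>
      have "\<rho> (\<lambda>X. \<rho> f (U, X)) = 0" if "U \<notin> SU 3"
      proof -
        have "(\<lambda>X. \<rho> f (U, X)) = 0" using that by (auto simp: twisted_coaction_def)
        then show ?thesis by (simp only: twisted_coaction_zero)
      qed
      moreover have "\<rho> g (U', V) = 0" if "U' \<notin> SU 3" for g
        using that by (simp add: twisted_coaction_def)
      ultimately show "tensor_map ?H ?A (comult 3) (\<lambda>b. b) (\<rho> f) ((U, U'), V) =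
          tensor_assoc (tensor_map ?H ?A (\<lambda>h. h) \<rho> (\<rho> f)) ((U, U'), V)"
        unfolding L R using \<rho>_coassoc[OF f] by auto
    qed
  qed
  moreover have "tensor_lift ?H ?A (\<lambda>h b. fscale (counit 3 h) b) (\<rho> f) = f" if f: "f \<in> ?A" for f
  proof -
    obtain xs where xs: "set xs \<subseteq> ?H \<times> ?A" and F: "\<rho> f = (\<Sum>(a, b)\<leftarrow>xs. a \<boxtimes> b)"
      using \<rho>_tensor_space[OF f] by (elim tensor_spaceE)
    have "bilinear_on ?H ?A (\<lambda>h b. fscale (counit 3 h) b)"
      unfolding bilinear_on_def
      by (auto simp: counit_def fscale_def fun_eq_iff algebra_simps)
    then have "tensor_lift ?H ?A (\<lambda>h b. fscale (counit 3 h) b) (\<rho> f) = (\<Sum>(a, b)\<leftarrow>xs. fscale (counit 3 a) b)"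
      unfolding F using xs by (intro tensor_lift_eq sub)
    also have "\<dots> = (\<lambda>V. \<rho> f (1\<^sub>m 3, V))"
      by (rule ext) (simp add: F sum_list_fun_apply split_def etensor_apply fscale_def counit_def)
    finally show ?thesis using \<rho>_counit[OF f] by simp
  qed
  ultimately show ?thesis unfolding left_action_def car by blast
qed

lemma SU3_action_\<rho>: "SU3_action_on_SU4 \<theta> lam \<rho>"
  unfolding SU3_action_on_SU4_def using left_action_\<rho> \<rho>_coord \<rho>_coord_last
  by (simp add: SU3_def)

text \<open>A fixed element of the conjugated coaction becomes, after the twist, a fixed element of
  the plain one, that is, a function invariant under all translations.\<close>

lemma tw_fixed_invariant:
  assumes f: "f \<in> O_SU 4" and fixed: "\<rho> f = SU_one 3 \<boxtimes> f" and U: "U \<in> SU 3"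
  shows "left_translate U (tw T f) = tw T f"
proof -
  have "tw T (left_translate U (tw T f)) = f"
    unfolding \<rho>_slice[OF f U, symmetric] fixed using U by (simp add: etensor_apply SU_one_def)
  then show ?thesis using tw_tw[OF left_translate_O_SU[OF tw_O_SU[OF f] U]] by simp
qed

end

section \<open>Existence of the twist\<close>

definition parity :: "int \<Rightarrow> real" where
  "parity m = (if even m then 1 else - 1)"

lemma parity_mult: "parity (x + y) = parity x * parity y"
  by (auto simp: parity_def)

lemma parity_cong: "even (x - y) \<Longrightarrow> parity x = parity y"
  by (auto simp: parity_def)

lemma parity_square: "parity x * parity x = 1"
  by (simp add: parity_def)

lemma cis_pi_of_int: "cis (pi * of_int m) = of_real (parity m)"
proof (cases "even m")
  case True
  then obtain k where "m = 2 * k" by (elim evenE)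
  then have "cis (pi * of_int m) = cis (2 * pi * of_int k)" by (simp add: mult_ac)
  then show ?thesis using True by (simp add: cis_multiple_2pi parity_def)
next
  case False
  then obtain k where k: "m = 2 * k + 1" by (elim oddE)
  have "pi * real_of_int (2 * k + 1) = 2 * pi * of_int k + pi" by (simp add: algebra_simps)
  then have "cis (pi * of_int m) = cis (2 * pi * of_int k) * cis pi" unfolding k by (simp only: cis_mult)
  then show ?thesis using False by (simp add: cis_multiple_2pi parity_def)
qed

lemma sum_1_4: "(\<Sum>k = 1..<4. f k) = f 1 + f 2 + f (3::nat)"
  for f :: "nat \<Rightarrow> 'b :: comm_monoid_add"
  by (simp add: numeral_eq_Suc add.assoc)

lemma sum_1_3: "(\<Sum>k = 1..<3. f k) = f 1 + f (2::nat)"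
  for f :: "nat \<Rightarrow> 'b :: comm_monoid_add"
  by (simp add: numeral_eq_Suc)

definition twist_sum :: "(real \<times> (nat \<Rightarrow> real)) list \<Rightarrow> (nat \<Rightarrow> int) \<Rightarrow> complex" where
  "twist_sum T r = (\<Sum>(c, \<phi>)\<leftarrow>T. of_real c * cis (2 * pi * (\<Sum>k = 1..<4. of_int (r k) * \<phi> k)))"

text \<open>Composing two combinations of translations adds the translations and multiplies the
  coefficients; so a product of realisable signs is realisable.\<close>

lemma twist_sum_mult:
  "twist_sum (map (\<lambda>((c, \<phi>), (c', \<phi>')). (c * c', \<lambda>k. \<phi> k + \<phi>' k)) (List.product T T')) r =
   twist_sum T r * twist_sum T' r"
proof -
  have "of_real (c * c') * cis (2 * pi * (\<Sum>k = 1..<4. of_int (r k) * (\<phi> k + \<phi>' k))) =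
    (of_real c * cis (2 * pi * (\<Sum>k = 1..<4. of_int (r k) * \<phi> k))) *
    (of_real c' * cis (2 * pi * (\<Sum>k = 1..<4. of_int (r k) * \<phi>' k)))" for c c' \<phi> \<phi>'
  proof -
    have "2 * pi * (\<Sum>k = 1..<4. of_int (r k) * (\<phi> k + \<phi>' k)) =
      2 * pi * (\<Sum>k = 1..<4. of_int (r k) * \<phi> k) + 2 * pi * (\<Sum>k = 1..<4. of_int (r k) * \<phi>' k)"
      by (simp add: sum.distrib distrib_left)
    then have "cis (2 * pi * (\<Sum>k = 1..<4. of_int (r k) * (\<phi> k + \<phi>' k))) =
      cis (2 * pi * (\<Sum>k = 1..<4. of_int (r k) * \<phi> k)) * cis (2 * pi * (\<Sum>k = 1..<4. of_int (r k) * \<phi>' k))"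
      by (simp only: cis_mult)
    then show ?thesis by (simp only: of_real_mult mult_ac)
  qed
  then show ?thesis
    unfolding twist_sum_def sum_list_mult_sum_list by (simp only: map_map comp_def split_def sum_list_product fst_conv snd_conv)
qed

text \<open>A sign quadratic in the weights is not a character, hence not a single translation. The
  identity (-1)^(a b) = (1 + (-1)^a + (-1)^b - (-1)^(a + b)) / 2 writes it as a combination of
  four.\<close>

lemma twist_sum_parity:
  assumes "i \<in> {1..3}" "j \<in> {1..3}"
  shows "\<exists>T. \<forall>r. twist_sum T r = of_real (parity (n * r i * r j))"
proof (cases "even n")
  case True
  then have "twist_sum [(1, \<lambda>_. 0)] r = of_real (parity (n * r i * r j))" for r
    by (simp add: twist_sum_def parity_def)
  then show ?thesis by blast
next
  case False
  \<comment> \<open>Translation by half a period in coordinate i acts on weight r as (-1)^(r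
    i).\<close>
  define e :: "nat \<Rightarrow> nat \<Rightarrow> real" where "e i k = (if k = i then 1 / 2 else 0)" for i k
  let ?T = "[(1 / 2, \<lambda>_. 0), (1 / 2, e i), (1 / 2, e j), (- 1 / 2, \<lambda>k. e i k + e j k)]"
  have e: "cis (2 * pi * (\<Sum>k = 1..<4. of_int (r k) * e i k)) = of_real (parity (r i))"
    if "i \<in> {1..3}" for r i
  proof -
    have "i = 1 \<or> i = 2 \<or> i = 3" using that by auto
    then have "2 * pi * (\<Sum>k = 1..<4. of_int (r k) * e i k) = pi * of_int (r i)"
      unfolding sum_1_4 e_def by auto
    then show ?thesis by (simp only: cis_pi_of_int)
  qed
  have ee: "cis (2 * pi * (\<Sum>k = 1..<4. of_int (r k) * (e i k + e j k))) = of_real (parity (r i) * parity (r j))" for r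
  proof -
    have "2 * pi * (\<Sum>k = 1..<4. of_int (r k) * (e i k + e j k)) =
      2 * pi * (\<Sum>k = 1..<4. of_int (r k) * e i k) + 2 * pi * (\<Sum>k = 1..<4. of_int (r k) * e j k)"
      by (simp add: sum.distrib distrib_left)
    then show ?thesis using e[OF assms(1)] e[OF assms(2)] by (simp only: cis_mult[symmetric] of_real_mult)
  qed
  have "twist_sum ?T r = of_real (parity (n * r i * r j))" for r
    unfolding twist_sum_def list.map sum_list.Cons sum_list.Nil prod.case e[OF assms(1)] e[OF assms(2)] ee
    using False by (simp add: parity_def)
  then show ?thesis by blast
qed

lemma antisym_entries:
  fixes lam :: "nat \<Rightarrow> nat \<Rightarrow> real"
  assumes "\<forall>i\<in>{1..3}. \<forall>j\<in>{1..3}. lam i j = - lam j i"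
  shows "lam 1 1 = 0" "lam 2 2 = 0" "lam 3 3 = 0"
    "lam 2 1 = - lam 1 2" "lam 3 1 = - lam 1 3" "lam 3 2 = - lam 2 3"
proof -
  have *: "lam i j = - lam j i" if "i \<in> {1..3}" "j \<in> {1..3}" for i j using assms that by blast
  from *[of 1 1] *[of 2 2] *[of 3 3] show "lam 1 1 = 0" "lam 2 2 = 0" "lam 3 3 = 0" by simp_all
  show "lam 2 1 = - lam 1 2" "lam 3 1 = - lam 1 3" "lam 3 2 = - lam 2 3" by (rule *; simp)+
qed

lemma torus_form_antisym:
  assumes "\<forall>i\<in>{1..3}. \<forall>j\<in>{1..3}. lam i j = - lam j i"
  shows "torus_form 4 lam x y = lam 1 2 * (x 1 * y 2 - x 2 * y 1) + lam 1 3 * (x 1 * y 3 - x 3 * y 1) +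
    lam 2 3 * (x 2 * y 3 - x 3 * y 2)"
  unfolding torus_form_def sum_1_4 antisym_entries[OF assms] by (simp add: algebra_simps)

lemma torus_form_SU3:
  "torus_form 3 (SU3_form \<theta>) x y = \<theta> * (x 1 * y 2 - x 2 * y 1)"
  unfolding torus_form_def sum_1_3 by (simp add: algebra_simps)

lemma SU_twist_exists:
  assumes antisym: "\<forall>i\<in>{1..3}. \<forall>j\<in>{1..3}. lam i j = - lam j i"
    and "[\<theta> = lam 1 2] (rmod 1)" "[lam 1 2 = - lam 1 3] (rmod 1)" "[- lam 1 3 = lam 2 3] (rmod 1)"
  shows "\<exists>T \<sigma>. SU_twist \<theta> lam T \<sigma>"
proof -
  have ex: "\<exists>n :: int. y = x + of_int n" if "[x = y] (rmod 1)" for x y :: real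
    using that by (simp add: rcong_altdef)
  obtain a b c :: int where abc: "lam 1 2 = \<theta> + a" "- lam 1 3 = lam 1 2 + b" "lam 2 3 = - lam 1 3 + c"
    using ex[OF assms(2)] ex[OF assms(3)] ex[OF assms(4)] by (elim exE) (rule that)
  \<comment> \<open>The form of \<theta> pulled back along \<open>bar\<close> has entries \<theta>,
    -\<theta>, \<theta> at 12, 13, 23; these integers measure how far \<open>lam\<close> is from
    it.\<close>
  define N12 N13 N23 where N: "N12 = a" "N13 = - a - b" "N23 = a + b + c"
  have lam: "lam 1 2 = \<theta> + N12" "lam 1 3 = - \<theta> + N13" "lam 2 3 = \<theta> + N23"
    using abc by (simp_all add: N)
  \<comment> \<open>A quadratic form whose polarisation agrees modulo 2 with the alternating form
    \<open>M\<close> below, so that its parity trivialises the sign of \<open>M\<close>.\<close>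
  define Q where "Q r = N12 * r 1 * r 2 + N13 * r 1 * r 3 + N23 * r 2 * r 3" for r :: "nat \<Rightarrow> int"
  obtain T12 T13 T23 where T: "\<forall>r. twist_sum T12 r = of_real (parity (N12 * r 1 * r 2))"
    "\<forall>r. twist_sum T13 r = of_real (parity (N13 * r 1 * r 3))"
    "\<forall>r. twist_sum T23 r = of_real (parity (N23 * r 2 * r 3))"
    using twist_sum_parity[of 1 2 N12] twist_sum_parity[of 1 3 N13] twist_sum_parity[of 2 3 N23] by auto
  let ?prod = "\<lambda>T T'. map (\<lambda>((c, \<phi>), (c', \<phi>')). (c * c', \<lambda>k. \<phi> k + \<phi>' k)) (List.product T T')"
  let ?T = "?prod (?prod T12 T13) T23"
  have "SU_twist \<theta> lam ?T (\<lambda>r. parity (Q r))"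
  proof
    show "(\<Sum>(c, \<phi>)\<leftarrow>?T. of_real c * cis (2 * pi * (\<Sum>k = 1..<4. of_int (r k) * \<phi> k))) = of_real (parity (Q r))" for r
      using twist_sum_mult[of "?prod T12 T13" T23 r] twist_sum_mult[of T12 T13 r] T
      unfolding twist_sum_def by (simp add: Q_def parity_mult)
    show "parity (Q r) * parity (Q r) = 1" for r by (rule parity_square)
    \<comment> \<open>\<open>Q\<close> has no square terms, and these weights have a single nonzero
      coordinate.\<close>
    show "parity (Q (coord_weight 4 i)) = 1" if "i \<in> {1..3}" for i
    proof -
      have "i = 1 \<or> i = 2 \<or> i = 3" using that by auto
      then show ?thesis by (auto simp: Q_def coord_weight_def parity_def)
    qed
    fix r r' :: "nat \<Rightarrow> int"
    define M where "M = N12 * (r 1 * r' 2 - r 2 * r' 1) + N13 * (r 1 * r' 3 - r 3 * r' 1) + N23 * (r 2 * r' 3 - r 3 * r' 2)"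
    have "torus_form 4 lam r r' = torus_form 3 (SU3_form \<theta>) (bar r) (bar r') + of_int M"
      unfolding torus_form_antisym[OF antisym] torus_form_SU3 lam
      by (simp add: M_def bar_def algebra_simps)
    then have "cis (pi * torus_form 4 lam r r') =
        cis (pi * torus_form 3 (SU3_form \<theta>) (bar r) (bar r')) * of_real (parity M)"
      by (simp only: distrib_left cis_mult[symmetric] cis_pi_of_int)
    moreover have "parity M * parity (Q (\<lambda>k. r k + r' k)) = parity (Q r) * parity (Q r')"
    proof -
      \<comment> \<open>Modulo 2 an alternating form is symmetric: the terms with minus signs in
        \<open>M\<close> combine with the polarisation of \<open>Q\<close> to zero, the others to
        even numbers.\<close>
      have "M + Q (\<lambda>k. r k + r' k) - (Q r + Q r') = 2 * (N12 * r 1 * r' 2 + N13 * r 1 * r' 3 + N23 * r 2 * r' 3)"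
        by (simp add: M_def Q_def algebra_simps)
      then have "even (M + Q (\<lambda>k. r k + r' k) - (Q r + Q r'))" by simp
      from parity_cong[OF this] show ?thesis by (simp only: parity_mult)
    qed
    ultimately show "cis (pi * torus_form 4 lam r r') * of_real (parity (Q (\<lambda>k. r k + r' k))) =
      of_real (parity (Q r) * parity (Q r')) * cis (pi * torus_form 3 (SU3_form \<theta>) (bar r) (bar r'))"
      by (simp add: mult.assoc flip: of_real_mult)
  qed
  then show ?thesis by blast
qed

section \<open>Necessity of the conditions on the parameters\<close>

lemma det_2:
  assumes "A \<in> carrier_mat 2 2"
  shows "det A = A $$ (0, 0) * A $$ (1, 1) - A $$ (0, 1) * A $$ (1, 0)"
  using assms unfolding laplace_expansion_row[OF assms, of 0, simplified] cofactor_def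
  by (simp add: numeral_eq_Suc det_single mat_delete_def)

lemma det_3:
  assumes "A \<in> carrier_mat 3 3"
  shows "det A = A $$ (0, 0) * (A $$ (1, 1) * A $$ (2, 2) - A $$ (1, 2) * A $$ (2, 1))
    - A $$ (0, 1) * (A $$ (1, 0) * A $$ (2, 2) - A $$ (1, 2) * A $$ (2, 0))
    + A $$ (0, 2) * (A $$ (1, 0) * A $$ (2, 1) - A $$ (1, 1) * A $$ (2, 0))"
proof -
  have c: "mat_delete A 0 j \<in> carrier_mat 2 2" for j using assms by (auto simp: mat_delete_def)
  show ?thesis using assms unfolding laplace_expansion_row[OF assms, of 0, simplified] cofactor_def
    by (simp add: numeral_eq_Suc det_2[OF c, unfolded numeral_eq_Suc, simplified]) (simp add: mat_delete_def algebra_simps)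
qed

text \<open>What counts is that the first column has no zero, so that no product u_k1 u_l1 vanishes
  here. The entries come from 2^2 + 1^2 + 2^2 = 3^2.\<close>

definition full_column :: "complex mat" where
  "full_column = mat_of_rows_list 3 [[2 / 3, - 2 / 3, - 1 / 3], [1 / 3, 2 / 3, - 2 / 3], [2 / 3, 1 / 3, 2 / 3]]"

lemma full_column_SU: "full_column \<in> SU 3"
proof -
  have c: "full_column \<in> carrier_mat 3 3" unfolding full_column_def mat_of_rows_list_def by (rule carrier_matI) simp_all
  note a = mat_adjoint_carrier[OF c]
  have i: "full_column $$ (i, j) =
      [[2 / 3, - 2 / 3, - 1 / 3], [1 / 3, 2 / 3, - 2 / 3], [2 / 3, 1 / 3, 2 / 3]] ! i ! j" if "i < 3" "j < 3" for i j
    using that by (simp add: full_column_def mat_of_rows_list_def)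
  have "full_column * mat_adjoint full_column = 1\<^sub>m 3"
  proof (rule eq_matI)
    fix i j assume "i < dim_row (1\<^sub>m 3 :: complex mat)" "j < dim_col (1\<^sub>m 3 :: complex mat)"
    then have ij: "i < 3" "j < 3" by simp_all
    then have "(full_column * mat_adjoint full_column) $$ (i, j) =
        (\<Sum>k = 0..<3. full_column $$ (i, k) * cnj (full_column $$ (j, k)))"
      using c a by (simp add: scalar_prod_def mat_adjoint_index[OF c])
    also have "\<dots> = full_column $$ (i, 0) * cnj (full_column $$ (j, 0)) +
        full_column $$ (i, 1) * cnj (full_column $$ (j, 1)) + full_column $$ (i, 2) * cnj (full_column $$ (j, 2))"
      by (simp add: numeral_eq_Suc)
    also have "\<dots> = 1\<^sub>m 3 $$ (i, j)"
    proof -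
      have "i = 0 \<or> i = 1 \<or> i = 2" "j = 0 \<or> j = 1 \<or> j = 2" using ij by auto
      then show ?thesis by (elim disjE) (simp_all add: i)
    qed
    finally show "(full_column * mat_adjoint full_column) $$ (i, j) = 1\<^sub>m 3 $$ (i, j)" .
  qed (use c a in auto)
  moreover have "det full_column = 1" unfolding det_3[OF c] by (simp add: i)
  ultimately show ?thesis using c by (simp add: SU_def)
qed

lemma coord_full_column: "k \<in> {1..3} \<Longrightarrow> coord 3 k 1 full_column \<noteq> 0"
proof -
  assume "k \<in> {1..3}"
  then have "k = 1 \<or> k = 2 \<or> k = 3" by auto
  then show ?thesis using full_column_SU
    by (auto simp: coord_def full_column_def mat_of_rows_list_def)
qed

section \<open>Consequences of the existence of an action\<close>

lemma SU3_actionD: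
  assumes "SU3_action_on_SU4 \<theta> lam \<rho>"
  shows "f \<in> O_SU 4 \<Longrightarrow> g \<in> O_SU 4 \<Longrightarrow>
      \<rho> (deformed_mult 4 lam f g) = \<rho> f \<otimes>\<^bsub>tensor_algebra (SU3 \<theta>) (SU4 lam)\<^esub> \<rho> g"
    and "f \<in> O_SU 4 \<Longrightarrow> g \<in> O_SU 4 \<Longrightarrow> \<rho> (f + g) = \<rho> f + \<rho> g"
    and "f \<in> O_SU 4 \<Longrightarrow> \<rho> (fscale c f) = fscale c (\<rho> f)"
    and "\<rho> (SU_one 4) = SU_one 3 \<boxtimes> SU_one 4"
    and "k \<in> {1..3} \<Longrightarrow> l \<in> {1..4} \<Longrightarrow> \<rho> (coord 4 k l) = (\<Sum>\<alpha> = 1..3. coord 3 k \<alpha> \<boxtimes> coord 4 \<alpha> l)"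
    and "l \<in> {1..4} \<Longrightarrow> \<rho> (coord 4 4 l) = SU_one 3 \<boxtimes> coord 4 4 l"
proof -
  note t = tensor_algebra_simps[of 3 "SU3_form \<theta>" 4 lam, folded SU3_def]
  have h: "\<rho> \<in> Ring.ring_hom (SU4 lam) (tensor_algebra (SU3 \<theta>) (SU4 lam))"
    and s: "\<forall>c. \<forall>f\<in>O_SU 4. \<rho> (fscale c f) = fscale c (\<rho> f)"
    using assms unfolding SU3_action_on_SU4_def left_action_def alg_hom_def t SU_deformed_simps by auto
  show "f \<in> O_SU 4 \<Longrightarrow> g \<in> O_SU 4 \<Longrightarrow>
      \<rho> (deformed_mult 4 lam f g) = \<rho> f \<otimes>\<^bsub>tensor_algebra (SU3 \<theta>) (SU4 lam)\<^esub> \<rho> g"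
    using ring_hom_mult[OF h, of f g] unfolding SU_deformed_simps .
  show "f \<in> O_SU 4 \<Longrightarrow> g \<in> O_SU 4 \<Longrightarrow> \<rho> (f + g) = \<rho> f + \<rho> g"
    using ring_hom_add[OF h, of f g] unfolding t SU_deformed_simps .
  show "f \<in> O_SU 4 \<Longrightarrow> \<rho> (fscale c f) = fscale c (\<rho> f)" using s by blast
  show "\<rho> (SU_one 4) = SU_one 3 \<boxtimes> SU_one 4" using ring_hom_one[OF h] unfolding t SU_deformed_simps .
  show "k \<in> {1..3} \<Longrightarrow> l \<in> {1..4} \<Longrightarrow> \<rho> (coord 4 k l) = (\<Sum>\<alpha> = 1..3. coord 3 k \<alpha> \<boxtimes> coord 4 \<alpha> l)"
    using assms unfolding SU3_action_on_SU4_def by blast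
  show "l \<in> {1..4} \<Longrightarrow> \<rho> (coord 4 4 l) = SU_one 3 \<boxtimes> coord 4 4 l"
    using assms unfolding SU3_action_on_SU4_def SU3_def by simp
qed

text \<open>Both generators lie in the first column, so only row phases survive. The image of the
  pointwise product is left as an unknown value; it is symmetric in k and k', whereas both phases
  are inverted by the exchange, so the two instances together eliminate it.\<close>

lemma action_commutation:
  assumes antisym: "\<forall>i\<in>{1..3}. \<forall>j\<in>{1..3}. lam i j = - lam j i"
    and act: "SU3_action_on_SU4 \<theta> lam \<rho>" and k: "k \<in> {1..3}" "k' \<in> {1..3}"
  shows "cis (pi * lam k k') * \<rho> (coord 4 k 1 * coord 4 k' 1) (full_column, 1\<^sub>m 4) =
    cis (pi * torus_form 3 (SU3_form \<theta>) (coord_weight 3 k) (coord_weight 3 k')) *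
      (coord 3 k 1 full_column * coord 3 k' 1 full_column)"
proof -
  let ?U = full_column and ?x = "coord 4 k 1" and ?y = "coord 4 k' 1"
  let ?xs = "\<lambda>k. map (\<lambda>\<alpha>. (coord 3 k \<alpha>, coord 4 \<alpha> 1)) [1, 2, 3]"
  have one: "(1::nat) \<in> {1, 2, 3}" by simp
  have K: "k \<in> {1, 2, 3}" "k' \<in> {1, 2, 3}" using k by auto
  have iso: "coord 4 i 1 \<in> isotypic 4 (coord_weight 4 i, coord_weight 4 1)" if "i \<in> {1, 2, 3}" for i
    using that by (intro coord_isotypic) auto
  have iso3: "coord 3 i j \<in> isotypic 3 (coord_weight 3 i, coord_weight 3 j)" if "i \<in> {1, 2, 3}" "j \<in> {1, 2, 3}" for i j
    using that by (intro coord_isotypic) auto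
  have form4: "torus_form 4 lam (coord_weight 4 i) (coord_weight 4 j) = lam i j" if "i \<in> {1, 2, 3}" "j \<in> {1, 2, 3}" for i j
    using that antisym_entries[OF antisym] unfolding torus_form_antisym[OF antisym]
    by (auto simp: coord_weight_def)
  have \<rho>xs: "\<rho> (coord 4 i 1) = (\<Sum>(a, b)\<leftarrow>?xs i. a \<boxtimes> b)" if "i \<in> {1..3}" for i
    using SU3_actionD(5)[OF act that, of 1] by (simp add: numeral_eq_Suc add.assoc)
  have xs: "set (?xs i) \<subseteq> O_SU 3 \<times> O_SU 4" if "i \<in> {1..3}" for i
    using that by (auto intro!: O_SU_coord)
  have "cis (pi * lam k k') * \<rho> (?x * ?y) (?U, 1\<^sub>m 4) = \<rho> (deformed_mult 4 lam ?x ?y) (?U, 1\<^sub>m 4)"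
    unfolding deformed_mult_isotypic[OF iso[OF K(1)] iso[OF K(2)]]
    using SU3_actionD(3)[OF act O_SU_closed(4), of ?x ?y] k form4[OF K] form4[of 1 1] antisym_entries(1)[OF antisym]
    by (simp add: O_SU_coord deform_phase_def fscale_apply)
  also have "\<dots> = (\<rho> ?x \<otimes>\<^bsub>tensor_algebra (SU3 \<theta>) (SU4 lam)\<^esub> \<rho> ?y) (?U, 1\<^sub>m 4)"
    using SU3_actionD(1)[OF act, of ?x ?y] k by (simp add: O_SU_coord)
  also have "\<dots> = (\<Sum>(a, b)\<leftarrow>?xs k. \<Sum>(a', b')\<leftarrow>?xs k'.
      deformed_mult 3 (SU3_form \<theta>) a a' \<boxtimes> deformed_mult 4 lam b b') (?U, 1\<^sub>m 4)"
    unfolding \<rho>xs[OF k(1)] \<rho>xs[OF k(2)] SU3_def tensor_algebra_mult[OF xs[OF k(1)] xs[OF k(2)]] ..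
  also have "\<dots> = (\<Sum>\<alpha>\<leftarrow>[1, 2, 3]. \<Sum>\<beta>\<leftarrow>[1, 2, 3].
      deformed_mult 3 (SU3_form \<theta>) (coord 3 k \<alpha>) (coord 3 k' \<beta>) ?U *
      deformed_mult 4 lam (coord 4 \<alpha> 1) (coord 4 \<beta> 1) (1\<^sub>m 4))"
    by (simp only: sum_list_fun_apply split_def map_map comp_def etensor_apply fst_conv snd_conv)
  also have "\<dots> = (\<Sum>\<alpha>\<leftarrow>[1, 2, 3]. \<Sum>\<beta>\<leftarrow>[1, 2, 3].
      if \<alpha> = 1 \<and> \<beta> = 1 then deformed_mult 3 (SU3_form \<theta>) (coord 3 k \<alpha>) (coord 3 k' \<beta>) ?U else 0)"
  proof (intro arg_cong[where f = sum_list] map_cong refl)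
    fix \<alpha> \<beta> :: nat assume "\<alpha> \<in> set [1, 2, 3]" "\<beta> \<in> set [1, 2, 3]"
    then have ab: "\<alpha> \<in> {1, 2, 3}" "\<beta> \<in> {1, 2, 3}" by simp_all
    \<comment> \<open>At the identity matrix v_\<alpha>1 is 1 for \<alpha> = 1 and 0 otherwise, and
      the phase that remains involves only \<open>lam 1 1\<close>, which is 0.\<close>
    have "deformed_mult 4 lam (coord 4 \<alpha> 1) (coord 4 \<beta> 1) (1\<^sub>m 4) = (if \<alpha> = 1 \<and> \<beta> = 1 then 1 else 0)"
      unfolding deformed_mult_isotypic[OF iso[OF ab(1)] iso[OF ab(2)]] using ab SU_one_mat[of 4] form4[of 1 1] antisym_entries(1)[OF antisym]
      by (auto simp: fscale_apply coord_def deform_phase_def)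
    then show "deformed_mult 3 (SU3_form \<theta>) (coord 3 k \<alpha>) (coord 3 k' \<beta>) ?U *
      deformed_mult 4 lam (coord 4 \<alpha> 1) (coord 4 \<beta> 1) (1\<^sub>m 4) =
      (if \<alpha> = 1 \<and> \<beta> = 1 then deformed_mult 3 (SU3_form \<theta>) (coord 3 k \<alpha>) (coord 3 k' \<beta>) ?U else 0)" by simp
  qed
  also have "\<dots> = deformed_mult 3 (SU3_form \<theta>) (coord 3 k 1) (coord 3 k' 1) ?U" by simp
  also have "\<dots> = cis (pi * torus_form 3 (SU3_form \<theta>) (coord_weight 3 k) (coord_weight 3 k')) *
      (coord 3 k 1 ?U * coord 3 k' 1 ?U)"
    unfolding deformed_mult_isotypic[OF iso3[OF K(1) one] iso3[OF K(2) one]]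
    unfolding fscale_apply deform_phase_def prod.case torus_form_SU3 by simp
  finally show ?thesis .
qed

text \<open>Dividing the two equations removes g and u and leaves exp(2 pi i (x - y)) = 1. The
  phases themselves depend on x and y modulo 2, but no more than this congruence modulo 1 can be
  extracted.\<close>

lemma cis_square_eq:
  assumes "cis (pi * x) * g = cis (pi * y) * u" "cis (- (pi * x)) * g = cis (- (pi * y)) * u" "u \<noteq> 0"
  shows "[y = x] (rmod 1)"
proof -
  have c: "cis (pi * x) * cis (- (pi * x)) = 1" "cis (pi * y) * cis (- (pi * y)) = 1" by (simp_all add: cis_mult)
  have "g = cis (- (pi * x)) * cis (pi * y) * u" using assms(1) c(1)
    by (metis mult.assoc mult.commute mult.left_neutral)
  moreover have "g = cis (pi * x) * cis (- (pi * y)) * u" using assms(2) c(1)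
    by (metis mult.assoc mult.commute mult.left_neutral)
  ultimately have "cis (- (pi * x)) * cis (pi * y) = cis (pi * x) * cis (- (pi * y))" using assms(3) by simp
  then have "cis (pi * x) * (cis (- (pi * x)) * cis (pi * y)) * cis (- (pi * y)) =
      cis (pi * x) * (cis (pi * x) * cis (- (pi * y))) * cis (- (pi * y))" by simp
  then have "1 = cis (2 * pi * (x - y))" by (simp add: cis_mult algebra_simps)
  then have "cos (2 * pi * (x - y)) = 1" by (metis cis.simps(1) one_complex.simps(1))
  then obtain n :: int where "2 * pi * (x - y) = of_int n * 2 * pi"
    by (auto simp: cos_one_2pi_int)
  then have "2 * pi * (x - y - of_int n) = 0" by (simp add: algebra_simps)
  then have "x = y + of_int n * 1" by simp
  then show ?thesis unfolding rcong_altdef by blast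
qed

lemma action_conditions:
  assumes antisym: "\<forall>i\<in>{1..3}. \<forall>j\<in>{1..3}. lam i j = - lam j i"
    and act: "SU3_action_on_SU4 \<theta> lam \<rho>"
  shows "[\<theta> = lam 1 2] (rmod 1)" "[lam 1 2 = - lam 1 3] (rmod 1)" "[- lam 1 3 = lam 2 3] (rmod 1)"
proof -
  let ?F = "\<lambda>k k'. torus_form 3 (SU3_form \<theta>) (coord_weight 3 k) (coord_weight 3 k')"
  have *: "[?F k k' = lam k k'] (rmod 1)" if k: "k \<in> {1..3}" "k' \<in> {1..3}" for k k'
  proof (rule cis_square_eq)
    show "cis (pi * lam k k') * \<rho> (coord 4 k 1 * coord 4 k' 1) (full_column, 1\<^sub>m 4) =
        cis (pi * ?F k k') * (coord 3 k 1 full_column * coord 3 k' 1 full_column)"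
      by (rule action_commutation[OF antisym act k])
    have "lam k' k = - lam k k'" "?F k' k = - ?F k k'"
      using antisym k unfolding torus_form_SU3 by (blast, simp add: algebra_simps)
    then show "cis (- (pi * lam k k')) * \<rho> (coord 4 k 1 * coord 4 k' 1) (full_column, 1\<^sub>m 4) =
        cis (- (pi * ?F k k')) * (coord 3 k 1 full_column * coord 3 k' 1 full_column)"
      using action_commutation[OF antisym act k(2) k(1)] by (simp add: mult.commute)
    show "coord 3 k 1 full_column * coord 3 k' 1 full_column \<noteq> 0"
      using coord_full_column k by simp
  qed
  \<comment> \<open>The third weight of \<open>SU 3\<close> is minus the sum of the other two; this
    is the origin of the sign at 13.\<close>
  have F: "?F 1 2 = \<theta>" "?F 1 3 = - \<theta>" "?F 2 3 = \<theta>"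
    unfolding torus_form_SU3 by (simp_all add: coord_weight_def)
  have 1: "[\<theta> = lam 1 2] (rmod 1)" using *[of 1 2] unfolding F by simp
  have 2: "[- \<theta> = lam 1 3] (rmod 1)" using *[of 1 3] unfolding F by simp
  have 3: "[\<theta> = lam 2 3] (rmod 1)" using *[of 2 3] unfolding F by simp
  have neg: "[\<theta> = - lam 1 3] (rmod 1)" using 2 by (simp add: rcong_uminus_left_iff)
  show "[\<theta> = lam 1 2] (rmod 1)" using 1 .
  show "[lam 1 2 = - lam 1 3] (rmod 1)" using rcong_trans[OF rcong_sym[OF 1] neg] .
  show "[- lam 1 3 = lam 2 3] (rmod 1)" using rcong_trans[OF rcong_sym[OF neg] 3] .
qed

section \<open>Polynomials in the matrix entries\<close>

text \<open>Conjugates of entries are left out and functions live on all matrices. Thus a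
  homomorphism is controlled without reference to the involution, and values at non-unitary matrices
  make sense.\<close>

inductive_set mat_poly :: "nat \<Rightarrow> (complex mat \<Rightarrow> complex) set" for n where
  const: "(\<lambda>_. c) \<in> mat_poly n"
| entry: "i < n \<Longrightarrow> j < n \<Longrightarrow> (\<lambda>A. A $$ (i, j)) \<in> mat_poly n"
| add: "P \<in> mat_poly n \<Longrightarrow> Q \<in> mat_poly n \<Longrightarrow> (\<lambda>A. P A + Q A) \<in> mat_poly n"
| mult: "P \<in> mat_poly n \<Longrightarrow> Q \<in> mat_poly n \<Longrightarrow> (\<lambda>A. P A * Q A) \<in> mat_poly n"

lemma mat_poly_sum: "(\<And>i. i \<in> I \<Longrightarrow> P i \<in> mat_poly n) \<Longrightarrow> (\<lambda>A. \<Sum>i\<in>I. P i A) \<in> mat_poly n"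
  by (induction I rule: infinite_finite_induct) (simp_all add: mat_poly.intros)

lemma mat_poly_prod: "(\<And>i. i \<in> I \<Longrightarrow> P i \<in> mat_poly n) \<Longrightarrow> (\<lambda>A. \<Prod>i\<in>I. P i A) \<in> mat_poly n"
  by (induction I rule: infinite_finite_induct) (simp_all add: mat_poly.intros)

lemma mat_poly_det:
  assumes "\<And>i j. i < m \<Longrightarrow> j < m \<Longrightarrow> (\<lambda>A. M i j A) \<in> mat_poly n"
  shows "(\<lambda>A. det (mat m m (\<lambda>(i, j). M i j A))) \<in> mat_poly n"
proof -
  have "(\<lambda>A. det (mat m m (\<lambda>(i, j). M i j A))) =
    (\<lambda>A. \<Sum>p | p permutes {0..<m}. signof p * (\<Prod>i = 0..<m. M i (p i) A))"
  proof
    fix A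
    have "(\<Prod>i = 0..<m. mat m m (\<lambda>(i, j). M i j A) $$ (i, p i)) = (\<Prod>i = 0..<m. M i (p i) A)"
      if "p permutes {0..<m}" for p
      using permutes_in_image[OF that] by (intro prod.cong) auto
    then show "det (mat m m (\<lambda>(i, j). M i j A)) =
        (\<Sum>p | p permutes {0..<m}. signof p * (\<Prod>i = 0..<m. M i (p i) A))"
      by (subst det_def'[of _ m]) (auto intro!: sum.cong)
  qed
  also have "\<dots> \<in> mat_poly n"
    using assms permutes_in_image
    by (intro mat_poly_sum mat_poly.mult mat_poly.const mat_poly_prod) fastforce
  finally show ?thesis .
qed

lemma SU_adjoint_mult:
  assumes "V \<in> SU n"
  shows "V * mat_adjoint V = 1\<^sub>m n" "mat_adjoint V * V = 1\<^sub>m n"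
proof -
  have c: "V \<in> carrier_mat n n" "mat_adjoint V \<in> carrier_mat n n"
    using assms SU_carrier mat_adjoint_carrier by blast+
  show 1: "V * mat_adjoint V = 1\<^sub>m n" using assms by (simp add: SU_def)
  show "mat_adjoint V * V = 1\<^sub>m n" by (rule mat_mult_left_right_inverse[OF c 1])
qed

lemma mat_delete_carrier_eq:
  assumes "A \<in> carrier_mat n n"
  shows "mat_delete A i j =
    mat (n - 1) (n - 1) (\<lambda>(k, l). A $$ (if k < i then k else Suc k, if l < j then l else Suc l))"
  using assms by (simp add: mat_delete_def)

text \<open>On \<open>SU n\<close> the inverse is both the adjoint and the adjugate matrix.\<close>

lemma SU_cnj_entry:
  assumes V: "V \<in> SU n" and ij: "i < n" "j < n"
  shows "cnj (V $$ (i, j)) = cofactor V i j"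
proof -
  have c: "V \<in> carrier_mat n n" using V by (rule SU_carrier)
  note a = mat_adjoint_carrier[OF c] and b = adj_mat[OF c]
  have "det V = 1" using V by (simp add: SU_def)
  then have "adj_mat V = adj_mat V * (V * mat_adjoint V)" using SU_adjoint_mult(1)[OF V] b(1) by simp
  also have "\<dots> = adj_mat V * V * mat_adjoint V" using a b(1) c by (intro assoc_mult_mat[symmetric]) auto
  also have "adj_mat V * V = 1\<^sub>m n" unfolding b(3) \<open>det V = 1\<close> by auto
  also have "1\<^sub>m n * mat_adjoint V = mat_adjoint V" using a by (rule left_mult_one_mat)
  finally have "adj_mat V $$ (j, i) = mat_adjoint V $$ (j, i)" by simp
  then show ?thesis using ij c by (simp add: adj_mat_def mat_adjoint_index[OF c])
qed

lemma mat_poly_cofactor: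
  assumes "i < n" "j < n"
  shows "\<exists>P\<in>mat_poly n. \<forall>V\<in>carrier_mat n n. cofactor V i j = P V"
proof -
  let ?M = "\<lambda>k l A. A $$ (if k < i then k else Suc k, if l < j then l else Suc l)"
  let ?P = "\<lambda>A. (-1) ^ (i + j) * det (mat (n - 1) (n - 1) (\<lambda>(k, l). ?M k l A))"
  have "(\<lambda>A. det (mat (n - 1) (n - 1) (\<lambda>(k, l). ?M k l A))) \<in> mat_poly n"
    by (rule mat_poly_det[where M = ?M], rule mat_poly.entry) (use assms in auto)
  then have "?P \<in> mat_poly n" by (rule mat_poly.mult[OF mat_poly.const])
  moreover have "cofactor V i j = ?P V" if "V \<in> carrier_mat n n" for V
    unfolding cofactor_def mat_delete_carrier_eq[OF that] ..
  ultimately show ?thesis by (intro bexI[of _ ?P] ballI)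
qed

lemma mat_poly_cnj:
  assumes "P \<in> mat_poly n"
  shows "\<exists>Q\<in>mat_poly n. \<forall>V\<in>SU n. cnj (P V) = Q V"
  using assms
proof induction
  case (const c)
  show ?case using mat_poly.const[of "cnj c" n] by auto
next
  case (entry i j)
  then obtain Q where "Q \<in> mat_poly n" "\<forall>V\<in>carrier_mat n n. cofactor V i j = Q V"
    using mat_poly_cofactor by blast
  then show ?case using SU_cnj_entry[OF _ entry] SU_carrier by (intro bexI[of _ Q]) auto
next
  case (add P Q)
  then obtain P' Q' where "P' \<in> mat_poly n" "Q' \<in> mat_poly n"
    "\<forall>V\<in>SU n. cnj (P V) = P' V" "\<forall>V\<in>SU n. cnj (Q V) = Q' V" by blast
  then show ?case using mat_poly.add[of P' n Q'] by (intro bexI[of _ "\<lambda>A. P' A + Q' A"]) auto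
next
  case (mult P Q)
  then obtain P' Q' where "P' \<in> mat_poly n" "Q' \<in> mat_poly n"
    "\<forall>V\<in>SU n. cnj (P V) = P' V" "\<forall>V\<in>SU n. cnj (Q V) = Q' V" by blast
  then show ?case using mat_poly.mult[of P' n Q'] by (intro bexI[of _ "\<lambda>A. P' A * Q' A"]) auto
qed

text \<open>The involution adds nothing to the algebra generated by the entries, since on
  \<open>SU n\<close> conjugation of a polynomial can be undone by cofactors.\<close>

lemma O_SU_mat_poly:
  assumes "f \<in> O_SU n"
  shows "\<exists>P\<in>mat_poly n. \<forall>V\<in>SU n. f V = P V"
proof -
  define S where "S = {f. (\<forall>U. U \<notin> SU n \<longrightarrow> f U = 0) \<and> (\<exists>P\<in>mat_poly n. \<forall>V\<in>SU n. f V = P V)}"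
  have I: "f \<in> S" if "\<And>U. U \<notin> SU n \<Longrightarrow> f U = 0" "P \<in> mat_poly n" "\<And>V. V \<in> SU n \<Longrightarrow> f V = P V" for f P
    unfolding S_def using that by (intro CollectI conjI allI impI bexI[of _ P] ballI)
  have E: "\<exists>P\<in>mat_poly n. \<forall>V\<in>SU n. f V = P V" "U \<notin> SU n \<Longrightarrow> f U = 0" if "f \<in> S" for f U
    using that unfolding S_def by simp_all
  have "O_SU n \<subseteq> S"
    unfolding O_SU_def
  proof (rule hull_minimal)
    show "{coord n i j |i j. i \<in> {1..n} \<and> j \<in> {1..n}} \<subseteq> S"
    proof clarify
      fix i j assume "i \<in> {1..n}" "j \<in> {1..n}"
      then have "i - 1 < n" "j - 1 < n" by auto
      then have "(\<lambda>A. A $$ (i - 1, j - 1)) \<in> mat_poly n" by (rule mat_poly.entry)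
      then show "coord n i j \<in> S" by (rule I[rotated]) (simp_all add: coord_def)
    qed
    have "0 \<in> S" by (rule I[of _ "\<lambda>_. 0"]) (simp_all add: mat_poly.const)
    moreover have "SU_one n \<in> S" by (rule I[of _ "\<lambda>_. 1"]) (simp_all add: mat_poly.const SU_one_def)
    moreover have "f + g \<in> S" "f * g \<in> S" if fg: "f \<in> S" "g \<in> S" for f g
    proof -
      obtain P Q where PQ: "P \<in> mat_poly n" "\<forall>V\<in>SU n. f V = P V" "Q \<in> mat_poly n" "\<forall>V\<in>SU n. g V = Q V"
        using E(1)[OF fg(1)] E(1)[OF fg(2)] by (elim bexE) (rule that)
      show "f + g \<in> S" by (rule I[OF _ mat_poly.add[OF PQ(1,3)]]) (simp_all add: E(2)[OF fg(1)] E(2)[OF fg(2)] PQ)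
      show "f * g \<in> S" by (rule I[OF _ mat_poly.mult[OF PQ(1,3)]]) (simp_all add: E(2)[OF fg(1)] E(2)[OF fg(2)] PQ)
    qed
    moreover have "fscale c f \<in> S" if f: "f \<in> S" for f c
    proof -
      obtain P where P: "P \<in> mat_poly n" "\<forall>V\<in>SU n. f V = P V" using E(1)[OF f] by (elim bexE) (rule that)
      show ?thesis
        by (rule I[OF _ mat_poly.mult[OF mat_poly.const[of c] P(1)]]) (simp_all add: fscale_def E(2)[OF f] P)
    qed
    moreover have "fstar f \<in> S" if f: "f \<in> S" for f
    proof -
      obtain P where P: "P \<in> mat_poly n" "\<forall>V\<in>SU n. f V = P V" using E(1)[OF f] by (elim bexE) (rule that)
      obtain Q where Q: "Q \<in> mat_poly n" "\<forall>V\<in>SU n. cnj (P V) = Q V"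
        using mat_poly_cnj[OF P(1)] by (elim bexE) (rule that)
      show ?thesis by (rule I[OF _ Q(1)]) (simp_all add: fstar_def E(2)[OF f] P Q)
    qed
    moreover have "S \<subseteq> {f. \<forall>U. U \<notin> SU n \<longrightarrow> f U = 0}" by (simp add: S_def Collect_mono)
    ultimately show "star_subalgebra (SU_functions n) S"
      unfolding star_subalgebra_def SU_functions_simps by simp
  qed
  then show ?thesis using assms E(1) by blast
qed

section \<open>Uniqueness of the action with given values on the generators\<close>

definition restrict_SU :: "nat \<Rightarrow> (complex mat \<Rightarrow> complex) \<Rightarrow> (complex mat \<Rightarrow> complex)" where
  "restrict_SU n h = (\<lambda>V. if V \<in> SU n then h V else 0)"

lemma restrict_SU_O_SU: "f \<in> O_SU n \<Longrightarrow> (\<And>V. V \<in> SU n \<Longrightarrow> f V = h V) \<Longrightarrow> restrict_SU n h = f"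
  using SU_zero_outside by (auto simp: restrict_SU_def fun_eq_iff)

lemma restrict_SU_simps:
  "restrict_SU n (\<lambda>_. c) = fscale c (SU_one n)"
  "restrict_SU n (\<lambda>V. g V + h V) = restrict_SU n g + restrict_SU n h"
  "restrict_SU n (\<lambda>V. g V * h V) = restrict_SU n g * restrict_SU n h"
  "restrict_SU n (\<lambda>V. cnj (h V)) = fstar (restrict_SU n h)"
  "restrict_SU n (\<lambda>V. V $$ (i, j)) = coord n (Suc i) (Suc j)"
  by (auto simp: restrict_SU_def fscale_def SU_one_def fstar_def coord_def fun_eq_iff)

text \<open>The counterpart of \<open>star_generated_subset_sums\<close> for sets that are not known
  to be closed under \<open>fstar\<close>, such as the set on which two actions agree.\<close>

lemma restrict_SU_mat_poly:
  assumes "P \<in> mat_poly n" and S: "\<And>a b. a \<in> S \<Longrightarrow> b \<in> S \<Longrightarrow> a * b \<in> S"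
    "\<And>i j. i \<in> {1..n} \<Longrightarrow> j \<in> {1..n} \<Longrightarrow> coord n i j \<in> S" "\<And>c. fscale c (SU_one n) \<in> S"
  shows "restrict_SU n P \<in> fsums S"
  using assms(1)
proof induction
  case (const c)
  show ?case unfolding restrict_SU_simps by (intro fsums_incl S)
next
  case (entry i j)
  then show ?case unfolding restrict_SU_simps by (intro fsums_incl S) auto
next
  case (add P Q)
  then show ?case unfolding restrict_SU_simps by (intro fsums_plus)
next
  case (mult P Q)
  then show ?case unfolding restrict_SU_simps by (intro fsums_times S)
qed

text \<open>Two actions agree on deformed products of elements on which they agree. Restricted to
  isotypic elements this holds for pointwise products too, because the nonzero phase can be divided
  out. The commutative polynomial description then covers everything.\<close>

lemma SU3_action_unique:
  assumes 1: "SU3_action_on_SU4 \<theta> lam \<rho>" and 2: "SU3_action_on_SU4 \<theta> lam \<rho>'" and f: "f \<in> O_SU 4"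
  shows "\<rho> f = \<rho>' f"
proof -
  let ?S = "{f. (\<exists>r q. f \<in> isotypic 4 (r, q)) \<and> \<rho> f = \<rho>' f}"
  have S: "f \<in> O_SU 4" if "f \<in> ?S" for f using that isotypicD by blast
  have scale: "fscale c a \<in> ?S" if "a \<in> ?S" for c a
  proof -
    from that obtain r q where a: "a \<in> isotypic 4 (r, q)" "\<rho> a = \<rho>' a" by blast
    then have "\<rho> (fscale c a) = \<rho>' (fscale c a)"
      by (simp add: SU3_actionD(3)[OF 1] SU3_actionD(3)[OF 2] isotypicD)
    then show ?thesis using isotypic_fscale[OF a(1)] by blast
  qed
  have one: "SU_one 4 \<in> ?S"
    using isotypic_SU_one[of 4] SU3_actionD(4)[OF 1] SU3_actionD(4)[OF 2] by auto
  have mult: "a * b \<in> ?S" if ab: "a \<in> ?S" "b \<in> ?S" for a b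
  proof -
    from ab obtain r q r' q' where iso: "a \<in> isotypic 4 (r, q)" "b \<in> isotypic 4 (r', q')"
      and eq: "\<rho> a = \<rho>' a" "\<rho> b = \<rho>' b" by blast
    let ?p = "deform_phase 4 lam (r, q) (r', q')"
    have p: "?p \<noteq> 0" by (simp add: deform_phase_def)
    have m: "fscale (1 / ?p) (deformed_mult 4 lam a b) = a * b"
      unfolding deformed_mult_isotypic[OF iso] using p by simp
    have c: "a \<in> O_SU 4" "b \<in> O_SU 4" "deformed_mult 4 lam a b \<in> O_SU 4"
      using iso isotypicD deformed_mult_closed by blast+
    have "\<rho> (a * b) = \<rho>' (a * b)"
      unfolding m[symmetric] SU3_actionD(3)[OF 1 c(3)] SU3_actionD(3)[OF 2 c(3)]
        SU3_actionD(1)[OF 1 c(1,2)] SU3_actionD(1)[OF 2 c(1,2)] eq ..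
    then show ?thesis using isotypic_mult[OF iso] by blast
  qed
  have coord: "coord 4 i j \<in> ?S" if ij: "i \<in> {1..4}" "j \<in> {1..4}" for i j
  proof (cases "i = 4")
    case True
    then show ?thesis using coord_isotypic[OF ij] SU3_actionD(6)[OF 1 ij(2)] SU3_actionD(6)[OF 2 ij(2)] by auto
  next
    case False
    with ij have i: "i \<in> {1..3}" by auto
    show ?thesis using coord_isotypic[OF ij] SU3_actionD(5)[OF 1 i ij(2)] SU3_actionD(5)[OF 2 i ij(2)] by auto
  qed
  obtain P where P: "P \<in> mat_poly 4" "\<And>V. V \<in> SU 4 \<Longrightarrow> f V = P V" using O_SU_mat_poly[OF f] by blast
  have "restrict_SU 4 P \<in> fsums ?S"
    by (rule restrict_SU_mat_poly[OF P(1) mult coord scale[OF one]])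
  moreover have "restrict_SU 4 P = f" using f P(2) by (rule restrict_SU_O_SU)
  ultimately have "f \<in> fsums ?S" by (simp only:)
  then have "f \<in> O_SU 4 \<and> \<rho> f = \<rho>' f"
  proof (induction rule: fsums.induct)
    case fsums_zero
    have "\<rho> (fscale 0 (SU_one 4)) = \<rho>' (fscale 0 (SU_one 4))"
      unfolding SU3_actionD(3)[OF 1 O_SU_closed(2)] SU3_actionD(3)[OF 2 O_SU_closed(2)]
        SU3_actionD(4)[OF 1] SU3_actionD(4)[OF 2] ..
    then show ?case using O_SU_closed(1)[of 4] unfolding fscale_simps by (intro conjI)
  next
    case (fsums_add a x)
    then have c: "a \<in> O_SU 4" "x \<in> O_SU 4" and eq: "\<rho> a = \<rho>' a" "\<rho> x = \<rho>' x" using S by blast+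
    have "\<rho> (a + x) = \<rho>' (a + x)"
      unfolding SU3_actionD(2)[OF 1 c] SU3_actionD(2)[OF 2 c] eq ..
    then show ?case using O_SU_closed(3)[OF c] by (intro conjI)
  qed
  then show ?thesis ..
qed

section \<open>Left invariant functions\<close>

text \<open>Serves two algebras: polynomials in the parameter c of a frame, and functions polynomial
  in the last row and its conjugate.\<close>

definition fun_algebra :: "('x \<Rightarrow> complex) set \<Rightarrow> bool" where
  "fun_algebra R \<longleftrightarrow> (\<forall>c. (\<lambda>_. c) \<in> R) \<and>
     (\<forall>g\<in>R. \<forall>h\<in>R. (\<lambda>x. g x + h x) \<in> R \<and> (\<lambda>x. g x * h x) \<in> R)"

lemma fun_algebraD:
  assumes "fun_algebra R"
  shows "(\<lambda>_. c) \<in> R" "g \<in> R \<Longrightarrow> h \<in> R \<Longrightarrow> (\<lambda>x. g x + h x) \<in> R"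
    "g \<in> R \<Longrightarrow> h \<in> R \<Longrightarrow> (\<lambda>x. g x * h x) \<in> R"
  using assms by (auto simp: fun_algebra_def)

lemma fun_algebra_diff:
  assumes "fun_algebra R" "g \<in> R" "h \<in> R"
  shows "(\<lambda>x. g x - h x) \<in> R"
  using fun_algebraD(2)[OF assms(1,2) fun_algebraD(3)[OF assms(1) fun_algebraD(1)[OF assms(1), of "-1"] assms(3)]]
  by simp

lemma fun_algebra_power:
  assumes "fun_algebra R" "g \<in> R"
  shows "(\<lambda>x. g x ^ n) \<in> R"
  by (induction n) (simp_all add: fun_algebraD(1)[OF assms(1)] fun_algebraD(3)[OF assms])

lemma fun_algebra_sum:
  assumes "fun_algebra R" "\<And>i. i \<in> I \<Longrightarrow> g i \<in> R"
  shows "(\<lambda>x. \<Sum>i\<in>I. g i x) \<in> R"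
  using assms(2)
  by (induction I rule: infinite_finite_induct) (simp_all add: fun_algebraD[OF assms(1)])

lemma fun_algebra_prod:
  assumes "fun_algebra R" "\<And>i. i \<in> I \<Longrightarrow> g i \<in> R"
  shows "(\<lambda>x. \<Prod>i\<in>I. g i x) \<in> R"
  using assms(2)
  by (induction I rule: infinite_finite_induct) (simp_all add: fun_algebraD[OF assms(1)])

text \<open>A polynomial in entries with common denominator s has a power of s as denominator:
  exponents are 0 for constants, 1 for entries, and add up under sums and products. Both s =
  \<open>frame_det\<close> and s = z_j will be used.\<close>

lemma mat_poly_clear_denominators:
  assumes P: "P \<in> mat_poly n" and R: "fun_algebra R" and s: "s \<in> R"
    and G: "\<And>i j. i < n \<Longrightarrow> j < n \<Longrightarrow> \<exists>h\<in>R. \<forall>x\<in>D. s x * G x $$ (i, j) = h x"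
  shows "\<exists>N. \<exists>h\<in>R. \<forall>x\<in>D. s x ^ N * P (G x) = h x"
  using P
proof induction
  case (const c)
  show ?case using fun_algebraD(1)[OF R, of c] by (intro exI[of _ 0] bexI[of _ "\<lambda>_. c"]) simp_all
next
  case (entry i j)
  from G[OF this] obtain h where "h \<in> R" "\<forall>x\<in>D. s x * G x $$ (i, j) = h x" by (elim bexE)
  then show ?case by (intro exI[of _ 1] bexI[of _ h]) simp_all
next
  case (add P Q)
  then obtain N M g h where *: "g \<in> R" "\<forall>x\<in>D. s x ^ N * P (G x) = g x" "h \<in> R" "\<forall>x\<in>D. s x ^ M * Q (G x) = h x"
    by (elim exE bexE)
  have "(\<lambda>x. s x ^ M * g x + s x ^ N * h x) \<in> R"
    by (intro fun_algebraD[OF R] fun_algebra_power[OF R] s *)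
  moreover have "\<forall>x\<in>D. s x ^ (N + M) * (P (G x) + Q (G x)) = s x ^ M * g x + s x ^ N * h x"
    using * by (auto simp: power_add algebra_simps)
  ultimately show ?case by (intro exI[of _ "N + M"] bexI)
next
  case (mult P Q)
  then obtain N M g h where *: "g \<in> R" "\<forall>x\<in>D. s x ^ N * P (G x) = g x" "h \<in> R" "\<forall>x\<in>D. s x ^ M * Q (G x) = h x"
    by (elim exE bexE)
  have "(\<lambda>x. g x * h x) \<in> R" by (intro fun_algebraD[OF R] *)
  moreover have "\<forall>x\<in>D. s x ^ (N + M) * (P (G x) * Q (G x)) = g x * h x"
  proof
    fix x assume "x \<in> D"
    have "s x ^ (N + M) * (P (G x) * Q (G x)) = (s x ^ N * P (G x)) * (s x ^ M * Q (G x))"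
      by (simp add: power_add mult_ac)
    then show "s x ^ (N + M) * (P (G x) * Q (G x)) = g x * h x" using * \<open>x \<in> D\<close> by simp
  qed
  ultimately show ?case by (intro exI[of _ "N + M"] bexI)
qed

section \<open>Orbits of the embedded SU(3) and the last row\<close>

lemma mat_adjoint_SU:
  assumes "V \<in> SU n"
  shows "mat_adjoint V \<in> SU n"
proof -
  have c: "V \<in> carrier_mat n n" using assms by (rule SU_carrier)
  note a = mat_adjoint_carrier[OF c] and aa = mat_adjoint_carrier[OF mat_adjoint_carrier[OF c]]
  have "mat_adjoint (mat_adjoint V) = V"
    using c a aa by (intro eq_matI) (auto simp: mat_adjoint_index[OF a] mat_adjoint_index[OF c])
  moreover have "det (mat_adjoint V) = 1"
  proof -
    have "det V * det (mat_adjoint V) = 1"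
      unfolding det_mult[OF c a, symmetric] SU_adjoint_mult(1)[OF assms] by simp
    then show ?thesis using assms by (simp add: SU_def)
  qed
  ultimately show ?thesis using a SU_adjoint_mult(2)[OF assms] by (simp add: SU_def)
qed

lemma SU_row_scalar:
  assumes "V \<in> SU n" "i < n" "k < n"
  shows "(\<Sum>l<n. V $$ (i, l) * cnj (V $$ (k, l))) = (if i = k then 1 else 0)"
proof -
  have c: "V \<in> carrier_mat n n" using assms(1) by (rule SU_carrier)
  have "(V * mat_adjoint V) $$ (i, k) = (\<Sum>l<n. V $$ (i, l) * cnj (V $$ (k, l)))"
    using assms(2,3) c mat_adjoint_carrier[OF c]
    by (simp add: scalar_prod_def mat_adjoint_index[OF c] atLeast0LessThan)
  then show ?thesis using SU_adjoint_mult(1)[OF assms(1)] assms(2,3) by simp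
qed

text \<open>In X times the adjoint of V, the last row consists of scalar products of rows of V and
  the last column of scalar products of rows of X. Both are unit vectors, so the matrix is block
  diagonal with corner 1.\<close>

lemma SU4_same_last_row:
  assumes X: "X \<in> SU 4" and V: "V \<in> SU 4" and row: "\<And>l. l < 4 \<Longrightarrow> X $$ (3, l) = V $$ (3, l)"
  shows "\<exists>U\<in>SU 3. X = emb U * V"
proof -
  note c = SU_carrier[OF X] SU_carrier[OF V] mat_adjoint_carrier[OF SU_carrier[OF V]]
  let ?W = "X * mat_adjoint V"
  define U where "U = mat 3 3 (\<lambda>(i, j). ?W $$ (i, j))"
  have W: "?W \<in> SU 4" by (intro SU_mult_closed mat_adjoint_SU X V)
  note cW = SU_carrier[OF W]
  have U: "U \<in> carrier_mat 3 3" by (simp add: U_def)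
  have e: "?W $$ (i, k) = (\<Sum>l<4. X $$ (i, l) * cnj (V $$ (k, l)))" if "i < 4" "k < 4" for i k
    using c that by (simp add: scalar_prod_def mat_adjoint_index[OF c(2)] atLeast0LessThan)
  have r: "?W $$ (3, k) = (if k = 3 then 1 else 0)" if "k < 4" for k
  proof -
    have "?W $$ (3, k) = (\<Sum>l<4. V $$ (3, l) * cnj (V $$ (k, l)))"
      using that row by (subst e) (auto intro!: sum.cong)
    then show ?thesis using SU_row_scalar[OF V _ that, of 3] by auto
  qed
  have l: "?W $$ (k, 3) = (if k = 3 then 1 else 0)" if "k < 4" for k
  proof -
    have "?W $$ (k, 3) = (\<Sum>l<4. X $$ (k, l) * cnj (X $$ (3, l)))"
      using that row by (subst e) (auto intro!: sum.cong)
    then show ?thesis using SU_row_scalar[OF X that, of 3] by auto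
  qed
  have "?W = emb U"
  proof (rule eq_matI)
    show "dim_row ?W = dim_row (emb U)" "dim_col ?W = dim_col (emb U)"
      using cW emb_carrier[OF U] by (metis carrier_matD)+
    fix i j assume "i < dim_row (emb U)" "j < dim_col (emb U)"
    then have ij: "i < 4" "j < 4" using emb_carrier[OF U] by (metis carrier_matD)+
    consider "i < 3" "j < 3" | "i = 3" | "j = 3" using ij by linarith
    then show "?W $$ (i, j) = emb U $$ (i, j)"
    proof cases
      case 1
      then show ?thesis unfolding emb_index[OF U ij] by (simp add: U_def)
    next
      case 2
      then show ?thesis unfolding emb_index[OF U ij] using r[OF ij(2)] by auto
    next
      case 3
      then show ?thesis unfolding emb_index[OF U ij] using l[OF ij(1)] by auto
    qed
  qed
  moreover have "X = ?W * V"
  proof -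
    have "?W * V = X * (mat_adjoint V * V)" using c by (intro assoc_mult_mat) auto
    then show ?thesis using SU_adjoint_mult(2)[OF V] c by simp
  qed
  ultimately show ?thesis using W emb_SU_iff[OF U] by (intro bexI[of _ U]) simp_all
qed

lemma left_invariant_last_row:
  assumes inv: "\<And>U. U \<in> SU 3 \<Longrightarrow> left_translate U f = f"
    and XV: "X \<in> SU 4" "V \<in> SU 4" "\<And>l. l < 4 \<Longrightarrow> X $$ (3, l) = V $$ (3, l)"
  shows "f X = f V"
proof -
  obtain U where U: "U \<in> SU 3" "X = emb U * V" using SU4_same_last_row[OF XV(1,2)] XV(3) by blast
  have "f X = left_translate U f V" using XV by (simp add: left_translate_def U)
  then show ?thesis unfolding inv[OF U(1)] .
qed

section \<open>Explicit completions of a unit vector\<close>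

definition skip :: "nat \<Rightarrow> nat \<Rightarrow> nat" where
  "skip j i = (if i < j then i else Suc i)"

text \<open>For a unit vector z this is the projection of e_a - c * cnj (z a) * e_j to the
  orthogonal complement of z. Projections of the e_a alone are not orthonormal; the multiple of e_j
  is there to correct their Gram matrix.\<close>

definition frame_row :: "nat \<Rightarrow> (nat \<Rightarrow> complex) \<Rightarrow> complex \<Rightarrow> nat \<Rightarrow> nat \<Rightarrow> complex" where
  "frame_row j z c a l = (if a = l then 1 else 0) - (if j = l then c * cnj (z a) else 0) -
     cnj (z a) * (1 - c * cnj (z j)) * z l"

text \<open>Up to the sign (-1)^(j + 1), the determinant of the completed matrix before its first
  row is rescaled.\<close>

definition frame_det :: "nat \<Rightarrow> (nat \<Rightarrow> complex) \<Rightarrow> complex \<Rightarrow> complex" where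
  "frame_det j z c = z j + c * (1 - z j * cnj (z j))"

text \<open>
  A completion of the unit row vector \<open>z\<close> to a matrix with determinant 1. For \<open>c = 0\<close> the first
  three rows are, up to the scaling of the first one, the projections of the unit vectors other
  than the \<open>j\<close>-th to the complement of \<open>z\<close>; for \<open>c\<close> on the circle where \<open>frame_det\<close> has modulus 1
  the matrix is unitary.
\<close>

definition frame :: "nat \<Rightarrow> (nat \<Rightarrow> complex) \<Rightarrow> complex \<Rightarrow> complex mat" where
  "frame j z c = mat 4 4 (\<lambda>(i, l). if i = 3 then z l
     else (if i = 0 then (-1) ^ (j + 1) / frame_det j z c else 1) * frame_row j z c (skip j i) l)"

lemma sum_delta_mult:
  fixes x :: complex and j n :: nat
  assumes "j < n"
  shows "(\<Sum>l<n. (if j = l then x else 0) * y l) = x * y j" "(\<Sum>l<n. y l * (if j = l then x else 0)) = y j * x"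
proof -
  have "(if j = l then x else 0) * y l = (if j = l then x * y l else 0)"
    "y l * (if j = l then x else 0) = (if j = l then y l * x else 0)" for l by simp_all
  then show "(\<Sum>l<n. (if j = l then x else 0) * y l) = x * y j"
    "(\<Sum>l<n. y l * (if j = l then x else 0)) = y j * x"
    using assms by (simp_all add: sum.delta)
qed

lemma frame_row_last:
  assumes z: "(\<Sum>l<4. z l * cnj (z l)) = 1" and "j < 4" "a < 4"
  shows "(\<Sum>l<4. frame_row j z c a l * cnj (z l)) = 0"
proof -
  have "(\<Sum>l<4. frame_row j z c a l * cnj (z l)) =
      (\<Sum>l<4. (if a = l then 1 else 0) * cnj (z l)) - (\<Sum>l<4. (if j = l then c * cnj (z a) else 0) * cnj (z l)) -
      cnj (z a) * (1 - c * cnj (z j)) * (\<Sum>l<4. z l * cnj (z l))"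
    unfolding frame_row_def left_diff_distrib sum_subtractf sum_distrib_left mult.assoc ..
  also have "\<dots> = 0" unfolding sum_delta_mult(1)[OF assms(2)] sum_delta_mult(1)[OF assms(3)] z
    by (simp add: algebra_simps)
  finally show ?thesis .
qed

text \<open>The Gram matrix differs from the identity by cnj (z a) * E * z b, and n * E is 1 minus
  the squared modulus of \<open>frame_det\<close>, hence 0. If n is nonzero then E = 0. If n = 0
  then z is concentrated in coordinate j, and z a = 0.\<close>

lemma frame_row_scalar:
  assumes z: "(\<Sum>l<4. z l * cnj (z l)) = 1" and j: "j < 4" and ab: "a < 4" "b < 4" "a \<noteq> j" "b \<noteq> j"
    and c: "frame_det j z c * cnj (frame_det j z c) = 1"
  shows "(\<Sum>l<4. frame_row j z c a l * cnj (frame_row j z c b l)) = (if a = b then 1 else 0)"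
proof -
  define n where "n = 1 - z j * cnj (z j)"
  define E where "E = 1 - c * cnj (z j) - cnj c * z j - c * cnj c * n"
  have n: "cnj n = n" by (simp add: n_def mult.commute)
  have "n * E = 1 - frame_det j z c * cnj (frame_det j z c)"
    by (simp add: E_def frame_det_def n_def algebra_simps)
  then have "n * E = 0" using c by simp
  have zE: "cnj (z a) * E = 0"
  proof (cases "n = 0")
    case True
    have "of_real (\<Sum>l<4. (cmod (z l))\<^sup>2) = (1::complex)"
      using z unfolding complex_norm_square[symmetric] of_real_sum .
    then have s: "(\<Sum>l<4. (cmod (z l))\<^sup>2) = 1" using of_real_eq_1_iff by blast
    have "of_real ((cmod (z j))\<^sup>2) = (1::complex)" using True unfolding complex_norm_square n_def by simp
    then have "(cmod (z j))\<^sup>2 = 1" using of_real_eq_1_iff by blast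
    moreover have "(\<Sum>l\<in>{a, j}. (cmod (z l))\<^sup>2) \<le> (\<Sum>l<4. (cmod (z l))\<^sup>2)"
      using j ab by (intro sum_mono2) auto
    ultimately have "(cmod (z a))\<^sup>2 \<le> 0" using s ab by simp
    then show ?thesis by simp
  next
    case False
    then show ?thesis using \<open>n * E = 0\<close> by simp
  qed
  have cr: "cnj (frame_row j z c b l) = (if b = l then 1 else 0) - (if j = l then cnj c * z b else 0) -
      z b * (1 - cnj c * z j) * cnj (z l)" for l
    by (simp add: frame_row_def)
  have "(\<Sum>l<4. frame_row j z c a l * cnj (frame_row j z c b l)) =
      (\<Sum>l<4. frame_row j z c a l * (if b = l then 1 else 0)) -
      (\<Sum>l<4. frame_row j z c a l * (if j = l then cnj c * z b else 0)) -
      z b * (1 - cnj c * z j) * (\<Sum>l<4. frame_row j z c a l * cnj (z l))"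
    unfolding cr right_diff_distrib sum_subtractf sum_distrib_left by (simp add: algebra_simps)
  also have "\<dots> = frame_row j z c a b - frame_row j z c a j * (cnj c * z b)"
    unfolding sum_delta_mult(2)[OF j] sum_delta_mult(2)[OF ab(2)] frame_row_last[OF z j ab(1)] by simp
  also have "\<dots> = (if a = b then 1 else 0) - cnj (z a) * E * z b"
    using ab by (simp add: frame_row_def E_def n_def algebra_simps)
  finally show ?thesis unfolding zE by simp
qed

lemma det_4:
  assumes "A \<in> carrier_mat 4 4"
  shows "det A = (\<Sum>j<4. A $$ (0, j) * ((-1) ^ j * det (mat 3 3 (\<lambda>(k, l). A $$ (Suc k, skip j l)))))"
  unfolding laplace_expansion_row[OF assms, of 0, simplified] cofactor_def mat_delete_carrier_eq[OF assms] skip_def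
  by simp

text \<open>Adding \<open>p i\<close> times column \<open>skip j i\<close> to column j leaves a
  single nonzero entry in that column, at the bottom; this explains the value. The four cases of j
  are verified by explicit expansion.\<close>

lemma det_sparse_frame:
  fixes z p :: "nat \<Rightarrow> complex"
  assumes "j < 4"
  shows "det (mat 4 4 (\<lambda>(i, l). if i = 3 then z l else (if skip j i = l then 1 else 0) - (if j = l then p i else 0))) =
    (-1) ^ (j + 1) * (z j + (\<Sum>i<3. p i * z (skip j i)))"
proof -
  have j: "j = 0 \<or> j = 1 \<or> j = 2 \<or> j = 3" using assms by auto
  have s3: "(\<Sum>i<3. g i) = g 0 + g 1 + g (2::nat)" for g :: "nat \<Rightarrow> complex" by (simp add: numeral_eq_Suc)
  have s4: "(\<Sum>i<4. g i) = g 0 + g 1 + g 2 + g (3::nat)" for g :: "nat \<Rightarrow> complex" by (simp add: numeral_eq_Suc)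
  have d3: "det (mat 3 3 (\<lambda>(k, l). M k l)) = M 0 0 * (M 1 1 * M 2 2 - M 1 2 * M 2 1)
    - M 0 1 * (M 1 0 * M 2 2 - M 1 2 * M 2 0) + M 0 2 * (M 1 0 * M 2 1 - M 1 1 * M 2 0)" for M :: "nat \<Rightarrow> nat \<Rightarrow> complex"
    by (subst det_3) simp_all
  from j show ?thesis
  proof (elim disjE)
    assume j: "j = 0"
    show ?thesis unfolding j det_4[OF mat_carrier] unfolding s4 s3 unfolding d3
      by (simp add: skip_def) (simp add: numeral_2_eq_2)
  next
    assume j: "j = 1"
    show ?thesis unfolding j det_4[OF mat_carrier] unfolding s4 s3 unfolding d3
      by (simp add: skip_def) (simp add: numeral_2_eq_2)
  next
    assume j: "j = 2"
    show ?thesis unfolding j det_4[OF mat_carrier] unfolding s4 s3 unfolding d3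
      by (simp add: skip_def) (simp add: numeral_2_eq_2)
  next
    assume j: "j = 3"
    show ?thesis unfolding j det_4[OF mat_carrier] unfolding s4 s3 unfolding d3
      by (simp add: skip_def) (simp add: numeral_2_eq_2)
  qed
qed

text \<open>Projecting to the complement of z subtracts multiples of the last row. So the frame is a
  triangular matrix \<open>?L\<close>, holding those multiples and the scaling of the first row,
  times the sparse matrix \<open>?M\<close>.\<close>

lemma det_frame:
  assumes z: "(\<Sum>l<4. z l * cnj (z l)) = 1" and j: "j < 4" and c: "frame_det j z c \<noteq> 0"
  shows "det (frame j z c) = 1"
proof -
  define s where "s i = (if i = 0 then (-1) ^ (j + 1) / frame_det j z c else 1)" for i :: nat
  define \<alpha> where "\<alpha> i = cnj (z (skip j i)) * (1 - c * cnj (z j))" for i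
  let ?L = "mat 4 4 (\<lambda>(i, l). if i = l then s i else if l = 3 then - s i * \<alpha> i else 0)"
  let ?M = "mat 4 4 (\<lambda>(i, l). if i = 3 then z l else (if skip j i = l then 1 else 0) -
    (if j = l then c * cnj (z (skip j i)) else 0))"
  have "frame j z c = ?L * ?M"
  proof (rule eq_matI)
    fix i l assume "i < dim_row (?L * ?M)" "l < dim_col (?L * ?M)"
    then have il: "i < 4" "l < 4" by simp_all
    have "(?L * ?M) $$ (i, l) = (\<Sum>k<4. ?L $$ (i, k) * ?M $$ (k, l))"
      using il by (simp add: scalar_prod_def atLeast0LessThan)
    also have "\<dots> = ?L $$ (i, 0) * ?M $$ (0, l) + ?L $$ (i, 1) * ?M $$ (1, l) + ?L $$ (i, 2) * ?M $$ (2, l) + ?L $$ (i, 3) * ?M $$ (3, l)"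
      by (simp add: numeral_eq_Suc)
    also have "\<dots> = frame j z c $$ (i, l)"
    proof -
      have "i = 0 \<or> i = 1 \<or> i = 2 \<or> i = 3" using il by auto
      then show ?thesis using il
        by (elim disjE) (simp_all add: frame_def s_def \<alpha>_def frame_row_def algebra_simps)
    qed
    finally show "frame j z c $$ (i, l) = (?L * ?M) $$ (i, l)" by simp
  qed (simp_all add: frame_def)
  moreover have "det ?L = s 0"
  proof -
    have "det ?L = prod_list (diag_mat ?L)"
      by (rule det_upper_triangular[of _ 4]) (auto simp: upper_triangular_def)
    also have "\<dots> = s 0" by (simp add: diag_mat_def s_def numeral_eq_Suc)
    finally show ?thesis .
  qed
  moreover have "det ?M = (-1) ^ (j + 1) * frame_det j z c"
  proof -
    have s4: "(\<Sum>l<4. g l) = g j + (\<Sum>i<3. g (skip j i))" for g :: "nat \<Rightarrow> complex"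
    proof -
      have "j = 0 \<or> j = 1 \<or> j = 2 \<or> j = 3" using j by auto
      then show ?thesis by (elim disjE) (simp_all add: numeral_eq_Suc skip_def)
    qed
    have "(\<Sum>i<3. z (skip j i) * cnj (z (skip j i))) = 1 - z j * cnj (z j)"
      using z unfolding s4 by (simp add: algebra_simps)
    then have "z j + (\<Sum>i<3. c * cnj (z (skip j i)) * z (skip j i)) = frame_det j z c"
      unfolding frame_det_def by (simp add: mult_ac flip: sum_distrib_left)
    then show ?thesis unfolding det_sparse_frame[OF j] by simp
  qed
  ultimately have "det (frame j z c) = s 0 * ((-1) ^ (j + 1) * frame_det j z c)"
    by (simp add: det_mult[of _ 4])
  also have "\<dots> = 1" using c by (simp add: s_def flip: power_mult_distrib)
  finally show ?thesis .
qed

lemma frame_SU: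
  assumes z: "(\<Sum>l<4. z l * cnj (z l)) = 1" and j: "j < 4"
    and c: "frame_det j z c * cnj (frame_det j z c) = 1"
  shows "frame j z c \<in> SU 4"
proof -
  have f: "frame j z c \<in> carrier_mat 4 4" by (simp add: frame_def)
  note a = mat_adjoint_carrier[OF f]
  define s where "s i = (if i = 0 then (-1) ^ (j + 1) / frame_det j z c else 1)" for i :: nat
  have s: "s i * cnj (s i) = 1" for i
    using c by (simp add: s_def flip: power_mult_distrib)
  have e: "frame j z c $$ (i, l) = (if i = 3 then z l else s i * frame_row j z c (skip j i) l)"
    if "i < 4" "l < 4" for i l using that by (simp add: frame_def s_def)
  have sk: "skip j i < 4" "skip j i \<noteq> j" "skip j i = skip j k \<longleftrightarrow> i = k" if "i < 3" "k < 3" for i k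
    using that by (auto simp: skip_def)
  have "frame j z c * mat_adjoint (frame j z c) = 1\<^sub>m 4"
  proof (rule eq_matI)
    fix i k assume "i < dim_row (1\<^sub>m 4 :: complex mat)" "k < dim_col (1\<^sub>m 4 :: complex mat)"
    then have ik: "i < 4" "k < 4" by simp_all
    have "(frame j z c * mat_adjoint (frame j z c)) $$ (i, k) = (\<Sum>l<4. frame j z c $$ (i, l) * cnj (frame j z c $$ (k, l)))"
      using ik f a by (simp add: scalar_prod_def mat_adjoint_index[OF f] atLeast0LessThan)
    also have "\<dots> = (if i = k then 1 else 0)"
    proof -
      consider "i = 3" "k = 3" | "i = 3" "k < 3" | "i < 3" "k = 3" | "i < 3" "k < 3" using ik by linarith
      then show ?thesis
      proof cases
        case 1
        then show ?thesis using z by (simp add: e)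
      next
        case 2
        have "(\<Sum>l<4. frame j z c $$ (i, l) * cnj (frame j z c $$ (k, l))) =
            cnj (s k) * cnj (\<Sum>l<4. frame_row j z c (skip j k) l * cnj (z l))"
          using 2 by (simp add: e sum_distrib_left mult_ac)
        then show ?thesis using frame_row_last[OF z j sk(1)[OF 2(2) 2(2)]] 2 by simp
      next
        case 3
        have "(\<Sum>l<4. frame j z c $$ (i, l) * cnj (frame j z c $$ (k, l))) =
            s i * (\<Sum>l<4. frame_row j z c (skip j i) l * cnj (z l))"
          using 3 by (simp add: e sum_distrib_left mult_ac)
        then show ?thesis using frame_row_last[OF z j sk(1)[OF 3(1) 3(1)]] 3 by simp
      next
        case 4
        have "(\<Sum>l<4. frame j z c $$ (i, l) * cnj (frame j z c $$ (k, l))) =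
            s i * cnj (s k) * (\<Sum>l<4. frame_row j z c (skip j i) l * cnj (frame_row j z c (skip j k) l))"
          using 4 by (simp add: e sum_distrib_left mult_ac)
        also have "\<dots> = s i * cnj (s k) * (if i = k then 1 else 0)"
          using frame_row_scalar[OF z j _ _ _ _ c, of "skip j i" "skip j k"] sk 4 by simp
        also have "\<dots> = (if i = k then 1 else 0)" using s by simp
        finally show ?thesis .
      qed
    qed
    finally show "(frame j z c * mat_adjoint (frame j z c)) $$ (i, k) = 1\<^sub>m 4 $$ (i, k)" using ik by simp
  qed (use f a in auto)
  moreover have "det (frame j z c) = 1" using c by (intro det_frame z j) auto
  ultimately show ?thesis using f by (simp add: SU_def)
qed

text \<open>If 1 - z_j * cnj z_j is nonzero, \<open>frame_det\<close> is a bijective affine map in c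
  and the set is the preimage of the unit circle. Otherwise \<open>frame_det\<close> is constant of
  modulus 1, and every c is admissible.\<close>

lemma infinite_frame_circle: "infinite {c. frame_det j z c * cnj (frame_det j z c) = 1}"
proof (cases "1 - z j * cnj (z j) = 0")
  case True
  then have "{c. frame_det j z c * cnj (frame_det j z c) = 1} = UNIV" by (auto simp: frame_det_def)
  then show ?thesis by (simp add: infinite_UNIV_char_0)
next
  case False
  let ?n = "1 - z j * cnj (z j)"
  \<comment> \<open>An arc of the unit circle, parametrised by its real part to make injectivity
    evident; \<open>?g\<close> solves \<open>frame_det j z c = ?w t\<close> for c.\<close>
  let ?w = "\<lambda>t. Complex t (sqrt (1 - t\<^sup>2))"
  let ?g = "\<lambda>t. (?w t - z j) / ?n"
  have "inj_on ?g {0..1}"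
    using False by (auto simp: inj_on_def)
  moreover have "infinite {0..1::real}" by simp
  ultimately have "infinite (?g ` {0..1})" using finite_imageD by blast
  moreover have "?g ` {0..1} \<subseteq> {c. frame_det j z c * cnj (frame_det j z c) = 1}"
  proof clarify
    fix t :: real assume "t \<in> {0..1}"
    then have t: "t\<^sup>2 \<le> 1" by (simp add: power_le_one)
    have "frame_det j z (?g t) = ?w t" using False by (simp add: frame_det_def)
    moreover have "?w t * cnj (?w t) = 1"
      using t by (simp add: complex_eq_iff power2_eq_square flip: real_sqrt_mult)
    ultimately show "frame_det j z (?g t) * cnj (frame_det j z (?g t)) = 1" by (simp only:)
  qed
  ultimately show ?thesis using finite_subset by blast
qed

section \<open>Continuation from unitary frames to c = 0\<close>

lemma fun_algebra_poly: "fun_algebra (range poly :: (complex \<Rightarrow> complex) set)"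
  unfolding fun_algebra_def
proof (intro conjI allI ballI)
  show "(\<lambda>_. c) \<in> range poly" for c :: complex by (rule range_eqI[of _ _ "[:c:]"]) (simp add: fun_eq_iff)
  fix g h :: "complex \<Rightarrow> complex" assume "g \<in> range poly" "h \<in> range poly"
  then obtain p q where "g = poly p" "h = poly q" by (elim rangeE)
  then have "(\<lambda>x. g x + h x) = poly (p + q)" "(\<lambda>x. g x * h x) = poly (p * q)" by (simp_all add: fun_eq_iff)
  then show "(\<lambda>x. g x + h x) \<in> range poly" "(\<lambda>x. g x * h x) \<in> range poly" by (simp_all only: rangeI)
qed

text \<open>
  The frames on the circle are in the orbit of \<open>V\<close>, and \<open>P\<close> is, up to a denominator, polynomial in
  the parameter of the frame.
\<close>

lemma left_invariant_frame:
  assumes P: "P \<in> mat_poly 4" "\<And>V. V \<in> SU 4 \<Longrightarrow> f V = P V"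
    and inv: "\<And>U. U \<in> SU 3 \<Longrightarrow> left_translate U f = f"
    and V: "V \<in> SU 4" and j: "j < 4" "V $$ (3, j) \<noteq> 0"
  shows "P (frame j (\<lambda>l. V $$ (3, l)) 0) = f V"
proof -
  define z where "z l = V $$ (3, l)" for l
  have z: "(\<Sum>l<4. z l * cnj (z l)) = 1" using SU_row_scalar[OF V, of 3 3] by (simp add: z_def)
  define n where "n = 1 - z j * cnj (z j)"
  \<comment> \<open>The determinant and the unscaled rows are affine in c, so
    \<open>frame_det\<close> is a common denominator of all entries.\<close>
  have det: "frame_det j z = poly [:z j, n:]" by (rule ext) (simp add: frame_det_def n_def)
  define A where "A a l = (if a = l then 1 else 0) - cnj (z a) * z l" for a l
  define B where "B a l = cnj (z a) * cnj (z j) * z l - (if j = l then cnj (z a) else 0)" for a l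
  have row: "frame_row j z c a l = poly [:A a l, B a l:] c" for c a l
    by (simp add: frame_row_def A_def B_def algebra_simps)
  have "\<exists>h\<in>range poly. \<forall>c\<in>{c. frame_det j z c \<noteq> 0}. frame_det j z c * frame j z c $$ (i, l) = h c"
    if il: "i < 4" "l < 4" for i l
  proof -
    have I: ?thesis if "\<And>c. frame_det j z c \<noteq> 0 \<Longrightarrow> frame_det j z c * frame j z c $$ (i, l) = poly q c" for q
      using that by (intro bexI[of _ "poly q"]) auto
    let ?q = "[:A (skip j i) l, B (skip j i) l:]"
    consider "i = 3" | "i = 0" | "i \<noteq> 3" "i \<noteq> 0" by blast
    then show ?thesis
    proof cases
      case 1
      then show ?thesis using il by (intro I[of "[:z j, n:] * [:z l:]"]) (simp add: frame_def det algebra_simps)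
    next
      case 2
      then show ?thesis using il by (intro I[of "[:(-1) ^ (j + 1):] * ?q"]) (simp add: frame_def row algebra_simps)
    next
      case 3
      then show ?thesis using il by (intro I[of "[:z j, n:] * ?q"]) (simp add: frame_def row det algebra_simps)
    qed
  qed
  note entries = this
  have "frame_det j z \<in> range poly" unfolding det by (rule rangeI)
  with P(1) fun_algebra_poly have "\<exists>N. \<exists>h\<in>range poly. \<forall>c\<in>{c. frame_det j z c \<noteq> 0}. frame_det j z c ^ N * P (frame j z c) = h c"
    by (rule mat_poly_clear_denominators) (rule entries)
  then obtain N h where h: "h \<in> range poly" "\<forall>c\<in>{c. frame_det j z c \<noteq> 0}. frame_det j z c ^ N * P (frame j z c) = h c"
    by (elim exE bexE) (rule that)
  then obtain p where p: "h = poly p" by (elim rangeE)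
  let ?q = "[:z j, n:] ^ N * [:f V:] - p"
  have "poly ?q c = 0" if c: "frame_det j z c * cnj (frame_det j z c) = 1" for c
  proof -
    have "frame j z c \<in> SU 4" by (rule frame_SU[OF z j(1) c])
    moreover from this have "f (frame j z c) = f V"
      using V by (rule left_invariant_last_row[where f = f, rotated]) (simp_all add: inv frame_def z_def)
    ultimately have "P (frame j z c) = f V" using P(2) by simp
    moreover have "frame_det j z c \<noteq> 0" using c by auto
    ultimately have "frame_det j z c ^ N * f V = poly p c" using h(2) p by auto
    then show ?thesis unfolding det by (simp add: poly_power mult.commute)
  qed
  then have "{c. frame_det j z c * cnj (frame_det j z c) = 1} \<subseteq> {c. poly ?q c = 0}" by blast
  then have "infinite {c. poly ?q c = 0}"
    using infinite_frame_circle by (rule infinite_super)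
  then have "?q = 0" using poly_roots_finite by blast
  then have "poly ?q 0 = 0" by simp
  then have "z j ^ N * f V = poly p 0" by (simp add: poly_power mult.commute)
  moreover have "z j ^ N * P (frame j z 0) = poly p 0"
    using bspec[OF h(2), of 0] j(2) unfolding p by (simp add: frame_det_def) (simp add: z_def)
  ultimately have "z j ^ N * P (frame j z 0) = z j ^ N * f V" by simp
  then have "P (frame j z 0) = f V" using j(2) by (simp add: z_def)
  then show ?thesis by (simp add: z_def [abs_def])
qed

text \<open>Generated with the pointwise product; \<open>last_row_subset_deformed\<close> makes the
  passage to the deformed one.\<close>

abbreviation last_row_algebra :: "(complex mat \<Rightarrow> complex) set" where
  "last_row_algebra \<equiv> star_generated (SU_functions 4) {coord 4 4 l | l. l \<in> {1..4}}"

lemma last_row_subalgebra: "star_subalgebra (SU_functions 4) last_row_algebra"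
  by (rule star_generated_subalgebra[OF _ O_SU_subalgebra[of 4]]) (auto intro!: O_SU_coord)

text \<open>Functions on all matrices judged by their restriction, so that constants and entries can
  be used without being cut off outside the group.\<close>

definition last_row_functions :: "(complex mat \<Rightarrow> complex) set" where
  "last_row_functions = {h. restrict_SU 4 h \<in> last_row_algebra}"

lemma fun_algebra_last_row: "fun_algebra last_row_functions"
  unfolding fun_algebra_def last_row_functions_def mem_Collect_eq restrict_SU_simps
  using star_subalgebraD[OF last_row_subalgebra] by simp

lemma last_row_functions_entry:
  assumes "l < 4"
  shows "(\<lambda>V. V $$ (3, l)) \<in> last_row_functions" "(\<lambda>V. cnj (V $$ (3, l))) \<in> last_row_functions"
proof -
  have *: "coord 4 4 (Suc l) \<in> last_row_algebra" by (rule hull_inc) (use assms in auto)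
  have eq: "restrict_SU 4 (\<lambda>V. V $$ (3, l)) = coord 4 4 (Suc l)" using restrict_SU_simps(5)[of 4 3 l] by simp
  show "(\<lambda>V. V $$ (3, l)) \<in> last_row_functions" unfolding last_row_functions_def mem_Collect_eq eq by (rule *)
  show "(\<lambda>V. cnj (V $$ (3, l))) \<in> last_row_functions"
    unfolding last_row_functions_def mem_Collect_eq restrict_SU_simps(4) eq
    using star_subalgebraD(7)[OF last_row_subalgebra *] by simp
qed

lemma last_row_functions_cong:
  assumes "g \<in> last_row_functions" "\<And>V. V \<in> SU 4 \<Longrightarrow> h V = g V"
  shows "h \<in> last_row_functions"
proof -
  have "restrict_SU 4 h = restrict_SU 4 g" using assms(2) by (auto simp: restrict_SU_def)
  then show ?thesis using assms(1) by (simp add: last_row_functions_def)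
qed

text \<open>By \<open>left_invariant_frame\<close>, f is P at the frame with c = 0, whose entries
  are polynomial in the last row and its conjugate except for the denominator z_j.\<close>

lemma left_invariant_times_power:
  assumes f: "f \<in> O_SU 4" and inv: "\<And>U. U \<in> SU 3 \<Longrightarrow> left_translate U f = f" and j: "j < 4"
  shows "\<exists>N. (\<lambda>V. V $$ (3, j) ^ N * f V) \<in> last_row_functions"
proof -
  let ?D = "{V \<in> SU 4. V $$ (3, j) \<noteq> 0}" and ?R = last_row_functions
  let ?z = "\<lambda>V l. V $$ (3, l)"
  note R = fun_algebra_last_row
  obtain P where P: "P \<in> mat_poly 4" "\<And>V. V \<in> SU 4 \<Longrightarrow> f V = P V" using O_SU_mat_poly[OF f] by blast
  have "\<exists>h\<in>?R. \<forall>V\<in>?D. V $$ (3, j) * frame j (?z V) 0 $$ (i, l) = h V" if il: "i < 4" "l < 4" for i l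
  proof -
    have row: "(\<lambda>V. (if skip j i = l then 1 else 0) - cnj (V $$ (3, skip j i)) * V $$ (3, l)) \<in> ?R" if "i < 3"
      by (intro fun_algebra_diff[OF R] fun_algebraD[OF R] last_row_functions_entry)
        (use that il in \<open>auto simp: skip_def\<close>)
    consider "i = 3" | "i = 0" | "i \<noteq> 3" "i \<noteq> 0" by blast
    then show ?thesis
    proof cases
      case 1
      then have "(\<lambda>V. V $$ (3, j) * V $$ (3, l)) \<in> ?R"
        by (intro fun_algebraD[OF R] last_row_functions_entry il j)
      then show ?thesis by (rule bexI[rotated]) (use 1 il in \<open>simp add: frame_def\<close>)
    next
      case 2
      then have "(\<lambda>V. (-1) ^ (j + 1) * ((if skip j i = l then 1 else 0) - cnj (V $$ (3, skip j i)) * V $$ (3, l))) \<in> ?R"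
        by (intro fun_algebraD(3)[OF R] fun_algebraD(1)[OF R] row) simp
      then show ?thesis
        by (rule bexI[rotated]) (use 2 il in \<open>simp add: frame_def frame_det_def frame_row_def\<close>)
    next
      case 3
      then have "(\<lambda>V. V $$ (3, j) * ((if skip j i = l then 1 else 0) - cnj (V $$ (3, skip j i)) * V $$ (3, l))) \<in> ?R"
        using il by (intro fun_algebraD(3)[OF R] last_row_functions_entry j row) simp
      then show ?thesis
        by (rule bexI[rotated]) (use 3 il in \<open>simp add: frame_def frame_row_def\<close>)
    qed
  qed
  note entries = this
  from P(1) R last_row_functions_entry(1)[OF j]
  have "\<exists>N. \<exists>h\<in>?R. \<forall>V\<in>?D. V $$ (3, j) ^ N * P (frame j (?z V) 0) = h V"
    by (rule mat_poly_clear_denominators) (rule entries)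
  then obtain N h where h: "h \<in> ?R" "\<forall>V\<in>?D. V $$ (3, j) ^ N * P (frame j (?z V) 0) = h V"
    by (elim exE bexE) (rule that)
  \<comment> \<open>One more factor z_j makes the identity true where z_j = 0 as well, since
    \<open>h\<close> is not controlled there and N may be 0.\<close>
  have "(\<lambda>V. V $$ (3, j) * h V) \<in> ?R" by (intro fun_algebraD(3)[OF R] last_row_functions_entry j h)
  moreover have "V $$ (3, j) ^ Suc N * f V = V $$ (3, j) * h V" if V: "V \<in> SU 4" for V
  proof (cases "V $$ (3, j) = 0")
    case False
    then have "V $$ (3, j) ^ N * f V = h V"
      using h(2) V left_invariant_frame[OF P inv V j False] by auto
    then show ?thesis by (simp add: mult.assoc)
  qed simp
  ultimately show ?thesis by (intro exI[of _ "Suc N"]) (rule last_row_functions_cong)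
qed

text \<open>Since \<open>z\<^sub>1 z\<^sub>1\<^sup>* + \<dots> + z\<^sub>4 z\<^sub>4\<^sup>* = 1\<close>, the powers \<open>z\<^sub>j\<^sup>N\<close> generate the unit ideal.\<close>

lemma left_invariant_last_row_algebra:
  assumes f: "f \<in> O_SU 4" and inv: "\<And>U. U \<in> SU 3 \<Longrightarrow> left_translate U f = f"
  shows "f \<in> last_row_algebra"
proof -
  let ?R = last_row_functions
  note R = fun_algebra_last_row
  have "\<forall>j\<in>{..<4}. \<exists>N. (\<lambda>V. V $$ (3, j) ^ N * f V) \<in> ?R"
    using left_invariant_times_power[OF f inv] by blast
  then obtain M where M: "\<And>j. j < 4 \<Longrightarrow> (\<lambda>V. V $$ (3, j) ^ M j * f V) \<in> ?R"
    unfolding bchoice_iff by blast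
  \<comment> \<open>Generalised to all exponents e, with e = 0 as the goal. If some e_j reaches M_j,
    the choice of \<open>M\<close> applies. Otherwise multiplication by the sum of z_i * cnj z_i,
    which is 1, raises one exponent in each summand and so brings the total closer to the sum of the
    M_j.\<close>
  have "(\<lambda>V. (\<Prod>j<4. V $$ (3, j) ^ e j) * f V) \<in> ?R" for e :: "nat \<Rightarrow> nat"
  proof (induction "(\<Sum>j<4. M j) - (\<Sum>j<4. e j)" arbitrary: e rule: less_induct)
    case less
    show ?case
    proof (cases "\<exists>j<4. M j \<le> e j")
      case True
      then obtain j where j: "j < 4" "M j \<le> e j" by blast
      let ?g = "\<lambda>V. (\<Prod>i\<in>{..<4} - {j}. V $$ (3, i) ^ e i) * V $$ (3, j) ^ (e j - M j) * (V $$ (3, j) ^ M j * f V)"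
      have "?g \<in> ?R"
        by (intro fun_algebraD(3)[OF R] fun_algebra_prod[OF R] fun_algebra_power[OF R] last_row_functions_entry M j) auto
      moreover have "(\<Prod>i<4. V $$ (3, i) ^ e i) * f V = ?g V" for V
      proof -
        have "(\<Prod>i<4. V $$ (3, i) ^ e i) = V $$ (3, j) ^ e j * (\<Prod>i\<in>{..<4} - {j}. V $$ (3, i) ^ e i)"
          using j by (intro prod.remove) auto
        also have "V $$ (3, j) ^ e j = V $$ (3, j) ^ (e j - M j) * V $$ (3, j) ^ M j"
          using j(2) by (simp flip: power_add)
        finally show ?thesis by (simp only: mult_ac)
      qed
      ultimately show ?thesis by (rule last_row_functions_cong)
    next
      case False
      then have lt: "(\<Sum>j<4. e j) < (\<Sum>j<4. M j)" by (intro sum_strict_mono) (auto simp: lessThan_empty_iff)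
      let ?e = "\<lambda>i. e(i := Suc (e i))"
      have se: "(\<Sum>j<4. ?e i j) = Suc (\<Sum>j<4. e j)" if "i < 4" for i
        using that sum.remove[of "{..<4}" i "?e i"] sum.remove[of "{..<4}" i e] by simp
      have pe: "(\<Prod>j<4. V $$ (3, j) ^ ?e i j) = V $$ (3, i) * (\<Prod>j<4. V $$ (3, j) ^ e j)" if "i < 4" for i V
      proof -
        have "(\<Prod>j<4. V $$ (3, j) ^ ?e i j) = V $$ (3, i) ^ ?e i i * (\<Prod>j\<in>{..<4} - {i}. V $$ (3, j) ^ ?e i j)"
          by (rule prod.remove) (use that in auto)
        also have "(\<Prod>j\<in>{..<4} - {i}. V $$ (3, j) ^ ?e i j) = (\<Prod>j\<in>{..<4} - {i}. V $$ (3, j) ^ e j)"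
          by (rule prod.cong) auto
        also have "V $$ (3, i) ^ ?e i i * \<dots> = V $$ (3, i) * (V $$ (3, i) ^ e i * \<dots>)"
          by (simp add: mult.assoc)
        also have "V $$ (3, i) ^ e i * (\<Prod>j\<in>{..<4} - {i}. V $$ (3, j) ^ e j) = (\<Prod>j<4. V $$ (3, j) ^ e j)"
          by (rule prod.remove[symmetric]) (use that in auto)
        finally show ?thesis .
      qed
      let ?g = "\<lambda>V. \<Sum>i<4. cnj (V $$ (3, i)) * ((\<Prod>j<4. V $$ (3, j) ^ ?e i j) * f V)"
      have IH: "(\<lambda>V. (\<Prod>j<4. V $$ (3, j) ^ ?e i j) * f V) \<in> ?R" if "i < 4" for i
        by (rule less) (use se[OF that] lt in linarith)
      have "?g \<in> ?R"
      proof (rule fun_algebra_sum[OF R])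
        fix i :: nat assume "i \<in> {..<4}"
        then have i: "i < 4" by simp
        show "(\<lambda>V. cnj (V $$ (3, i)) * ((\<Prod>j<4. V $$ (3, j) ^ ?e i j) * f V)) \<in> ?R"
          by (rule fun_algebraD(3)[OF R last_row_functions_entry(2)[OF i] IH[OF i]])
      qed
      moreover have "(\<Prod>j<4. V $$ (3, j) ^ e j) * f V = ?g V" if V: "V \<in> SU 4" for V
      proof -
        have "?g V = (\<Sum>i<4. V $$ (3, i) * cnj (V $$ (3, i)) * ((\<Prod>j<4. V $$ (3, j) ^ e j) * f V))"
          by (rule sum.cong[OF refl]) (simp only: pe lessThan_iff mult_ac)
        also have "\<dots> = (\<Sum>i<4. V $$ (3, i) * cnj (V $$ (3, i))) * ((\<Prod>j<4. V $$ (3, j) ^ e j) * f V)"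
          by (rule sum_distrib_right[symmetric])
        also have "(\<Sum>i<4. V $$ (3, i) * cnj (V $$ (3, i))) = 1" using SU_row_scalar[OF V, of 3 3] by simp
        finally show ?thesis by simp
      qed
      ultimately show ?thesis by (rule last_row_functions_cong)
    qed
  qed
  from this[of "\<lambda>_. 0"] have "f \<in> ?R" by simp
  then have "restrict_SU 4 f \<in> last_row_algebra" by (simp add: last_row_functions_def)
  moreover have "restrict_SU 4 f = f" by (rule restrict_SU_O_SU[OF f]) (rule refl)
  ultimately show ?thesis by (simp only:)
qed

section \<open>The algebra of invariant elements\<close>

lemma isotypic_unphase:
  assumes "a \<in> isotypic n (r, q)" "b \<in> isotypic n (r', q')"
  shows "a * b = fscale (1 / deform_phase n K (r, q) (r', q')) (deformed_mult n K a b)"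
proof -
  have "deform_phase n K (r, q) (r', q') \<noteq> 0" by (simp add: deform_phase_def)
  then show ?thesis unfolding deformed_mult_isotypic[OF assms] by simp
qed

lemma SU_deformed_subalgebra: "star_subalgebra (SU_deformed n K) (O_SU n)"
  unfolding star_subalgebra_def SU_deformed_simps by (simp add: O_SU_closed deformed_mult_closed)

text \<open>The pointwise product of isotypic elements is a multiple of their deformed product, so
  it stays in the deformed algebra. The summands are kept isotypic because the twist must still be
  undone, and on them it is only a sign.\<close>

lemma last_row_subset_deformed:
  "last_row_algebra \<subseteq> fsums {a \<in> star_generated (SU4 lam) {coord 4 4 l | l. l \<in> {1..4}}. \<exists>r q. a \<in> isotypic 4 (r, q)}"
    (is "_ \<subseteq> fsums ?S")
proof (rule star_generated_subset_sums)
  let ?X = "{coord 4 4 l | l. l \<in> {1..4}}"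
  let ?B = "star_generated (SU4 lam) ?X"
  have "star_subalgebra (SU4 lam) ?B"
    by (rule star_generated_subalgebra[OF _ SU_deformed_subalgebra]) (auto intro!: O_SU_coord)
  note B = star_subalgebraD[OF this, unfolded SU_deformed_simps]
  show "?X \<subseteq> ?S"
  proof clarify
    fix l :: nat assume l: "l \<in> {1..4}"
    then have "coord 4 4 l \<in> ?B" by (intro hull_inc) blast
    moreover have "coord 4 4 l \<in> isotypic 4 (coord_weight 4 4, coord_weight 4 l)"
      using l by (intro coord_isotypic) simp_all
    ultimately show "coord 4 4 l \<in> ?B \<and> (\<exists>r q. coord 4 4 l \<in> isotypic 4 (r, q))" by (intro conjI exI)
  qed
  show "SU_one 4 \<in> ?S" using B(3) isotypic_SU_one[of 4] by (intro CollectI conjI exI)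
  show "?S \<subseteq> carrier (SU_functions 4)"
  proof
    fix a assume "a \<in> ?S"
    then have "a \<in> O_SU 4" using isotypicD by blast
    then show "a \<in> carrier (SU_functions 4)" using SU_zero_outside[of a 4] by simp
  qed
  show "a * b \<in> ?S" if ab: "a \<in> ?S" "b \<in> ?S" for a b
  proof -
    from ab obtain r q r' q' where iso: "a \<in> isotypic 4 (r, q)" "b \<in> isotypic 4 (r', q')"
      and m: "a \<in> ?B" "b \<in> ?B" by (elim CollectE conjE exE) (rule that)
    have "a * b \<in> ?B" unfolding isotypic_unphase[OF iso, of lam] by (intro B m)
    then show ?thesis using isotypic_mult[OF iso] by (intro CollectI conjI exI)
  qed
  show "fscale c a \<in> ?S" if "a \<in> ?S" for c a
  proof -
    from that obtain r q where a: "a \<in> isotypic 4 (r, q)" "a \<in> ?B" by (elim CollectE conjE exE) (rule that)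
    show ?thesis using B(6)[OF a(2)] isotypic_fscale[OF a(1)] by (intro CollectI conjI exI)
  qed
  show "fstar a \<in> ?S" if "a \<in> ?S" for a
  proof -
    from that obtain r q where a: "a \<in> isotypic 4 (r, q)" "a \<in> ?B" by (elim CollectE conjE exE) (rule that)
    show ?thesis using B(7)[OF a(2)] isotypic_fstar[OF a(1)] by (intro CollectI conjI exI)
  qed
qed

context SU_twist
begin

text \<open>Closure under the involution does not come from the axioms of an action but from the
  concrete form of \<open>twisted_coaction\<close>, which commutes with
  \<open>fstar\<close>.\<close>

lemma fixed_points_subalgebra:
  "star_subalgebra (SU4 lam) {f \<in> O_SU 4. \<rho> f = SU_one 3 \<boxtimes> f}" (is "star_subalgebra _ ?F")
proof -
  have one: "deformed_mult 3 K (SU_one 3) (SU_one 3) = SU_one 3" for K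
  proof -
    have "SU_one 3 * SU_one 3 = SU_one 3" by (rule ext) (simp add: SU_one_def)
    then show ?thesis
      unfolding deformed_mult_isotypic[OF isotypic_SU_one isotypic_SU_one] by (simp add: deform_phase_def torus_form_def)
  qed
  have "deformed_mult 4 lam f g \<in> ?F" if fg: "f \<in> ?F" "g \<in> ?F" for f g
  proof -
    have o: "f \<in> O_SU 4" "g \<in> O_SU 4" and f: "\<rho> f = (\<Sum>(a, b)\<leftarrow>[(SU_one 3, f)]. a \<boxtimes> b)"
      and g: "\<rho> g = (\<Sum>(a, b)\<leftarrow>[(SU_one 3, g)]. a \<boxtimes> b)" using fg by simp_all
    have s: "set [(SU_one 3, f)] \<subseteq> O_SU 3 \<times> O_SU 4" "set [(SU_one 3, g)] \<subseteq> O_SU 3 \<times> O_SU 4"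
      using o by (simp_all add: O_SU_closed)
    have "\<rho> (deformed_mult 4 lam f g) = SU_one 3 \<boxtimes> deformed_mult 4 lam f g"
      unfolding \<rho>_mult[OF o] f g SU3_def tensor_algebra_mult[OF s] by (simp add: one)
    then show ?thesis using deformed_mult_closed[OF o] by blast
  qed
  moreover have "fstar f \<in> ?F" if "f \<in> ?F" for f
  proof -
    have f: "f \<in> O_SU 4" "\<rho> f = SU_one 3 \<boxtimes> f" using that by simp_all
    have "fstar (SU_one 3 \<boxtimes> f) = SU_one 3 \<boxtimes> fstar f"
      by (rule ext) (auto simp: fstar_def etensor_def SU_one_def)
    then show ?thesis using O_SU_closed(6)[OF f(1)] f(2) by (simp add: twisted_coaction_fstar)
  qed
  moreover have "f + g \<in> ?F" if "f \<in> ?F" "g \<in> ?F" for f g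
  proof -
    from that have fg: "f \<in> O_SU 4" "g \<in> O_SU 4" "\<rho> f = SU_one 3 \<boxtimes> f" "\<rho> g = SU_one 3 \<boxtimes> g" by simp_all
    have "\<rho> (f + g) = SU_one 3 \<boxtimes> (f + g)" unfolding twisted_coaction_add fg etensor_add(2) ..
    then show ?thesis using O_SU_closed(3)[OF fg(1,2)] by blast
  qed
  moreover have "fscale c f \<in> ?F" if "f \<in> ?F" for c f
    using that by (simp add: twisted_coaction_fscale etensor_fscale O_SU_closed)
  moreover have "0 \<in> ?F"
  proof -
    have "SU_one 3 \<boxtimes> (0 :: complex mat \<Rightarrow> complex) = 0" using etensor_fscale(2)[of "SU_one 3" 0 0] by simp
    then show ?thesis using O_SU_closed(1)[of 4] twisted_coaction_zero[of T] by (intro CollectI conjI) (simp_all only:)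
  qed
  moreover have "SU_one 4 \<in> ?F" using \<rho>_SU_one O_SU_closed(2) by blast
  ultimately show ?thesis unfolding star_subalgebra_def SU_deformed_simps by simp
qed

text \<open>For a fixed f, the twisted function \<open>tw T f\<close> is left invariant and thus a
  polynomial in the last row and its conjugate. A second twist recovers f and does not leave the
  algebra generated by the last row.\<close>

lemma fixed_points_\<rho>:
  "{f \<in> O_SU 4. \<rho> f = SU_one 3 \<boxtimes> f} = star_generated (SU4 lam) {coord 4 4 l | l. l \<in> {1..4}}"
    (is "?F = ?B")
proof
  show "?B \<subseteq> ?F"
    by (rule hull_minimal) (auto intro!: O_SU_coord \<rho>_coord_last fixed_points_subalgebra)
  have "star_subalgebra (SU4 lam) ?B"
    by (rule star_generated_subalgebra[OF _ SU_deformed_subalgebra]) (auto intro!: O_SU_coord)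
  note B = star_subalgebraD[OF this, unfolded SU_deformed_simps]
  show "?F \<subseteq> ?B"
  proof
    fix f assume "f \<in> ?F"
    then have f: "f \<in> O_SU 4" "\<rho> f = SU_one 3 \<boxtimes> f" by simp_all
    have "tw T f \<in> last_row_algebra"
      by (rule left_invariant_last_row_algebra[OF tw_O_SU[OF f(1)]]) (rule tw_fixed_invariant[OF f])
    then have "tw T f \<in> fsums {a \<in> ?B. \<exists>r q. a \<in> isotypic 4 (r, q)}"
      using last_row_subset_deformed by blast
    \<comment> \<open>The twist preserves \<open>?B\<close> because it acts by a scalar on each
      isotypic summand.\<close>
    then have "tw T (tw T f) \<in> ?B"
    proof (induction rule: fsums.induct)
      case fsums_zero
      show ?case unfolding tw_zero by (rule B)
    next
      case (fsums_add a x)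
      then obtain r q where a: "a \<in> ?B" "a \<in> isotypic 4 (r, q)" by (elim CollectE conjE exE) (rule that)
      show ?case unfolding tw_add tw_isotypic[OF a(2)] by (intro B a fsums_add)
    qed
    then show "f \<in> ?B" unfolding tw_tw[OF f(1)] .
  qed
qed

end

theorem proposition2p4:
  fixes \<theta> :: real and lam :: "nat \<Rightarrow> nat \<Rightarrow> real"
  assumes antisym: "\<forall>i\<in>{1..3}. \<forall>j\<in>{1..3}. lam i j = - lam j i"
  shows "((\<exists>\<rho>. SU3_action_on_SU4 \<theta> lam \<rho>) \<longleftrightarrow>
            [\<theta> = lam 1 2] (rmod 1) \<and> [lam 1 2 = - lam 1 3] (rmod 1) \<and>
            [- lam 1 3 = lam 2 3] (rmod 1)) \<and>
         (\<forall>\<rho>. SU3_action_on_SU4 \<theta> lam \<rho> \<longrightarrow>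
            fixed_points (SU3 \<theta>) (SU4 lam) \<rho> =
              star_generated (SU4 lam) {coord 4 4 l | l. l \<in> {1..4}})"
proof (intro conjI allI impI iffI)
  assume "\<exists>\<rho>. SU3_action_on_SU4 \<theta> lam \<rho>"
  then obtain \<rho> where "SU3_action_on_SU4 \<theta> lam \<rho>" ..
  note c = action_conditions[OF antisym this]
  show "[\<theta> = lam 1 2] (rmod 1)" by (rule c)
  show "[lam 1 2 = - lam 1 3] (rmod 1)" by (rule c)
  show "[- lam 1 3 = lam 2 3] (rmod 1)" by (rule c)
next
  assume "[\<theta> = lam 1 2] (rmod 1) \<and> [lam 1 2 = - lam 1 3] (rmod 1) \<and> [- lam 1 3 = lam 2 3] (rmod 1)"
  then obtain T \<sigma> where "SU_twist \<theta> lam T \<sigma>" using SU_twist_exists[OF antisym] by blast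
  from SU_twist.SU3_action_\<rho>[OF this] show "\<exists>\<rho>. SU3_action_on_SU4 \<theta> lam \<rho>" by (intro exI)
next
  fix \<rho> assume act: "SU3_action_on_SU4 \<theta> lam \<rho>"
  \<comment> \<open>The existence of an arbitrary action already forces the congruences, hence a
    twist; by uniqueness the given action can then be replaced by the twisted coaction.\<close>
  obtain T \<sigma> where tw: "SU_twist \<theta> lam T \<sigma>"
    using SU_twist_exists[OF antisym action_conditions[OF antisym act]] by blast
  have "fixed_points (SU3 \<theta>) (SU4 lam) \<rho> = {f \<in> O_SU 4. \<rho> f = SU_one 3 \<boxtimes> f}"
    by (simp add: fixed_points_def SU3_def)
  also have "\<dots> = {f \<in> O_SU 4. twisted_coaction T f = SU_one 3 \<boxtimes> f}"
    using SU3_action_unique[OF act SU_twist.SU3_action_\<rho>[OF tw]] by (intro Collect_cong conj_cong) simp_all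
  finally show "fixed_points (SU3 \<theta>) (SU4 lam) \<rho> = star_generated (SU4 lam) {coord 4 4 l | l. l \<in> {1..4}}"
    unfolding SU_twist.fixed_points_\<rho>[OF tw] .
qed

end
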